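(* Let $k\ge1$ be an integer and let $E\subset\mathbb{R}^2$ be a triangle (with three edges). Order the degrees of freedom of $V_{k,k}(E)$ so that the first $S$ of them, $\delta_1,\dots,\delta_S$, are exactly the boundary degrees of freedom together with the internal moments $\int_E\varphi\,q\,dE$ for $q$ in a basis of $\mathbb{P}_{k-3}(E)$. Then the Serendipity virtual element space $$V^S_k(E)=\{\varphi\in V_{k,k}(E):\ \delta_r(\varphi)=\delta_r(\Pi^{\mathcal S}_k\varphi)\ \ \forall\, r=S+1,\dots,N_E\}$$ has the same number of degrees of freedom as the classical Lagrange finite element space of degree $k$ on $E$, and coincides with it: $V^S_k(E)=\mathbb{P}_k(E)$.
   Context: $\mathbb{P}_k(\mathcal{O})$ denotes the polynomials of degree $\le k$ restricted to $\mathcal{O}$ (in two variables on $E$, in one variable on an edge $e$), with $\mathbb{P}_j=\{0\}$ for $j<0$. The classical Lagrange finite element space of degree $k$ on a triangle $E$ is $\mathbb{P}_k(E)$. The space is $V_{k,k}(E)=\{\varphi\in C^0(\overline{E}):\ \varphi_{|e}\in\mathbb{P}_k(e)\ \text{for every edge } e,\ \Delta\varphi\in\mathbb{P}_k(E)\}$. Its degrees of freedom are: (1) the values of $\varphi$ at the vertices; (2) the edge moments $\int_e\varphi\,q\,ds$ for $q$ in a basis of $\mathbb{P}_{k-2}(e)$, for every edge $e$; (3) the internal moments $\int_E\varphi\,q\,dE$ for $q$ in a basis of $\mathbb{P}_k(E)$ (chosen to contain a basis of $\mathbb{P}_{k-3}(E)$). Those in (1) and (2) are called the boundary degrees of freedom.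 On a triangle their total number is $N_E=3k+\frac{(k+1)(k+2)}{2}=\dim V_{k,k}(E)$, and they are unisolvent for $V_{k,k}(E)$ (i.e. $\varphi\mapsto(\delta_1(\varphi),\dots,\delta_{N_E}(\varphi))$ is a bijection onto $\mathbb{R}^{N_E}$). The operator $\Pi^{\mathcal S}_k:V_{k,k}(E)\to\mathbb{P}_k(E)$: put $\mathcal{D}\varphi=(\delta_1(\varphi),\dots,\delta_S(\varphi))\in\mathbb{R}^S$ and let $(\cdot,\cdot)_{\mathbb{R}^S}$ be the Euclidean scalar product (or any symmetric positive definite bilinear form) on $\mathbb{R}^S$; then $\Pi^{\mathcal S}_k\varphi$ is the unique element of $\mathbb{P}_k(E)$ with $(\mathcal{D}(\Pi^{\mathcal S}_k\varphi-\varphi),\mathcal{D}q)_{\mathbb{R}^S}=0$ for all $q\in\mathbb{P}_k(E)$; it is well defined because a polynomial in $\mathbb{P}_k(E)$ on which $\delta_1,\dots,\delta_S$ all vanish is identically zero. *)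

theory Defs
  imports
    "HOL-Analysis.Analysis"
    "HOL-Computational_Algebra.Polynomial"
    "HOL-Library.Function_Algebras"
begin

text \<open>
  The plane is \<^typ>\<open>real \<times> real\<close> with its Euclidean norm. A function on a set \<open>A\<close> is represented by
  its extension by zero to the whole plane, so that function spaces on \<open>A\<close> are honest subspaces of
  a function type and equality of such functions is equality on \<open>A\<close>.
\<close>

type_synonym plane = "real \<times> real"

definition restr0 :: "'a set \<Rightarrow> ('a \<Rightarrow> real) \<Rightarrow> 'a \<Rightarrow> real" where
  "restr0 A f = (\<lambda>x. if x \<in> A then f x else 0)"

definition fun_scale :: "real \<Rightarrow> ('a \<Rightarrow> real) \<Rightarrow> 'a \<Rightarrow> real" where
  "fun_scale c f = (\<lambda>x. c * f x)"

interpretation fun_space: vector_space "fun_scale :: real \<Rightarrow> ('a \<Rightarrow> real) \<Rightarrow> 'a \<Rightarrow> real"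
  by unfold_locales (auto simp: fun_scale_def fun_eq_iff algebra_simps)

definition is_basis :: "('a \<Rightarrow> real) set \<Rightarrow> ('a \<Rightarrow> real) set \<Rightarrow> bool" where
  "is_basis B W \<longleftrightarrow> fun_space.independent B \<and> fun_space.span B = W"


subsection \<open>Polynomial spaces\<close>

text \<open>The degree bound is an integer: both spaces are \<open>{0}\<close> for a negative bound.\<close>

definition poly_plane :: "int \<Rightarrow> plane set \<Rightarrow> (plane \<Rightarrow> real) set" where
  "poly_plane d E =
    {restr0 E (\<lambda>(x, y). \<Sum>(i, j) \<in> {(i, j). int (i + j) \<le> d}. c i j * x ^ i * y ^ j)
      | c :: nat \<Rightarrow> nat \<Rightarrow> real. True}"

text \<open>An edge is given by its pair of end points.\<close>

type_synonym edge = "plane \<times> plane"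

definition edge_set :: "edge \<Rightarrow> plane set" where
  "edge_set e = closed_segment (fst e) (snd e)"

definition poly_edge :: "int \<Rightarrow> edge \<Rightarrow> (plane \<Rightarrow> real) set" where
  "poly_edge d e =
    {\<phi>. (\<forall>x. x \<notin> edge_set e \<longrightarrow> \<phi> x = 0) \<and>
        (\<exists>p :: real poly. (p = 0 \<or> int (degree p) \<le> d) \<and>
          (\<forall>t \<in> {0..1}. \<phi> (linepath (fst e) (snd e) t) = poly p t))}"


subsection \<open>The Laplacian in the sense of distributions\<close>

definition partial :: "'a::euclidean_space \<Rightarrow> ('a \<Rightarrow> real) \<Rightarrow> 'a \<Rightarrow> real" where
  "partial i f = (\<lambda>x. frechet_derivative f (at x) i)"

primrec C_diff :: "nat \<Rightarrow> ('a::euclidean_space \<Rightarrow> real) \<Rightarrow> bool" where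
  "C_diff 0 f \<longleftrightarrow> continuous_on UNIV f"
| "C_diff (Suc n) f \<longleftrightarrow>
    (\<forall>x. f differentiable (at x)) \<and> (\<forall>i \<in> Basis. C_diff n (partial i f))"

definition laplacian :: "('a::euclidean_space \<Rightarrow> real) \<Rightarrow> 'a \<Rightarrow> real" where
  "laplacian f = (\<lambda>x. \<Sum>i \<in> Basis. partial i (partial i f) x)"

definition test_function :: "'a::euclidean_space set \<Rightarrow> ('a \<Rightarrow> real) \<Rightarrow> bool" where
  "test_function \<Omega> \<psi> \<longleftrightarrow>
    (\<forall>n. C_diff n \<psi>) \<and> compact (closure {x. \<psi> x \<noteq> 0}) \<and> closure {x. \<psi> x \<noteq> 0} \<subseteq> \<Omega>"

definition has_weak_laplacian ::
    "('a::euclidean_space \<Rightarrow> real) \<Rightarrow> ('a \<Rightarrow> real) \<Rightarrow> 'a set \<Rightarrow> bool" where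
  "has_weak_laplacian \<phi> f \<Omega> \<longleftrightarrow>
    (\<forall>\<psi>. test_function \<Omega> \<psi> \<longrightarrow>
      (LINT x:\<Omega>|lborel. \<phi> x * laplacian \<psi> x) = (LINT x:\<Omega>|lborel. f x * \<psi> x))"


subsection \<open>The virtual element space on a triangle\<close>

definition closed_triangle :: "plane \<Rightarrow> plane \<Rightarrow> plane \<Rightarrow> plane set" where
  "closed_triangle a b c = convex hull {a, b, c}"

definition triangle_edges :: "plane \<Rightarrow> plane \<Rightarrow> plane \<Rightarrow> edge set" where
  "triangle_edges a b c = {(a, b), (b, c), (c, a)}"

definition vem_space :: "nat \<Rightarrow> plane \<Rightarrow> plane \<Rightarrow> plane \<Rightarrow> (plane \<Rightarrow> real) set" where
  "vem_space k a b c =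
    {\<phi>. (\<forall>x. x \<notin> closed_triangle a b c \<longrightarrow> \<phi> x = 0) \<and>
        continuous_on (closed_triangle a b c) \<phi> \<and>
        (\<forall>e \<in> triangle_edges a b c. restr0 (edge_set e) \<phi> \<in> poly_edge (int k) e) \<and>
        (\<exists>f \<in> poly_plane (int k) (closed_triangle a b c).
          has_weak_laplacian \<phi> f (interior (closed_triangle a b c)))}"


subsection \<open>Degrees of freedom\<close>

datatype dof =
    Vertex_Value plane
  | Edge_Moment edge "plane \<Rightarrow> real"
  | Internal_Moment "plane \<Rightarrow> real"

text \<open>The factor \<open>dist\<close> is the length element \<open>ds\<close> in the parametrisation of the edge over \<open>[0,1]\<close>.\<close>

primrec dof_value :: "plane set \<Rightarrow> dof \<Rightarrow> (plane \<Rightarrow> real) \<Rightarrow> real" where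
  "dof_value E (Vertex_Value v) \<phi> = \<phi> v"
| "dof_value E (Edge_Moment e q) \<phi> =
    (LINT t:{0..1}|lborel.
      \<phi> (linepath (fst e) (snd e) t) * q (linepath (fst e) (snd e) t) * dist (fst e) (snd e))"
| "dof_value E (Internal_Moment q) \<phi> = (LINT x:E|lborel. \<phi> x * q x)"

definition boundary_dofs ::
    "plane \<Rightarrow> plane \<Rightarrow> plane \<Rightarrow> (edge \<Rightarrow> (plane \<Rightarrow> real) set) \<Rightarrow> dof set" where
  "boundary_dofs a b c Qe =
    Vertex_Value ` {a, b, c} \<union> (\<Union>e \<in> triangle_edges a b c. Edge_Moment e ` Qe e)"


subsection \<open>The Serendipity projection and the Serendipity space\<close>

definition vec_space :: "nat \<Rightarrow> (nat \<Rightarrow> real) set" where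
  "vec_space S = {u. \<forall>r. r \<notin> {1..S} \<longrightarrow> u r = 0}"

definition sym_pos_def_form ::
    "nat \<Rightarrow> ((nat \<Rightarrow> real) \<Rightarrow> (nat \<Rightarrow> real) \<Rightarrow> real) \<Rightarrow> bool" where
  "sym_pos_def_form S B \<longleftrightarrow>
    (\<forall>u \<in> vec_space S. \<forall>v \<in> vec_space S. \<forall>w \<in> vec_space S. B (u + v) w = B u w + B v w) \<and>
    (\<forall>c. \<forall>u \<in> vec_space S. \<forall>w \<in> vec_space S. B (fun_scale c u) w = c * B u w) \<and>
    (\<forall>u \<in> vec_space S. \<forall>w \<in> vec_space S. B u w = B w u) \<and>
    (\<forall>u \<in> vec_space S. u \<noteq> 0 \<longrightarrow> B u u > 0)"

lemma sym_pos_def_form_Euclidean: "sym_pos_def_form S (\<lambda>u v. \<Sum>r = 1..S. u r * v r)"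
proof -
  have "(\<Sum>r = 1..S. u r * u r) > 0" if "u \<in> vec_space S" "u \<noteq> 0" for u
  proof -
    from that obtain r where "r \<in> {1..S}" "u r \<noteq> 0"
      unfolding vec_space_def fun_eq_iff by (auto simp: zero_fun_def)
    then show ?thesis
      by (intro sum_pos2[of _ r]) (auto simp: zero_less_mult_iff linorder_neq_iff)
  qed
  then show ?thesis
    unfolding sym_pos_def_form_def fun_scale_def
    by (auto simp: sum.distrib sum_distrib_left algebra_simps)
qed

definition dof_vector ::
    "plane set \<Rightarrow> (nat \<Rightarrow> dof) \<Rightarrow> nat \<Rightarrow> (plane \<Rightarrow> real) \<Rightarrow> nat \<Rightarrow> real" where
  "dof_vector E \<delta> S \<phi> = (\<lambda>r. if r \<in> {1..S} then dof_value E (\<delta> r) \<phi> else 0)"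

definition unisolvent ::
    "plane set \<Rightarrow> (nat \<Rightarrow> dof) \<Rightarrow> nat \<Rightarrow> (plane \<Rightarrow> real) set \<Rightarrow> bool" where
  "unisolvent E \<delta> S V \<longleftrightarrow> bij_betw (dof_vector E \<delta> S) V (vec_space S)"

definition serendipity_proj ::
    "nat \<Rightarrow> plane set \<Rightarrow> (nat \<Rightarrow> dof) \<Rightarrow> nat \<Rightarrow> ((nat \<Rightarrow> real) \<Rightarrow> (nat \<Rightarrow> real) \<Rightarrow> real) \<Rightarrow>
      (plane \<Rightarrow> real) \<Rightarrow> plane \<Rightarrow> real" where
  "serendipity_proj k E \<delta> S B \<phi> =
    (THE p. p \<in> poly_plane (int k) E \<and>
      (\<forall>q \<in> poly_plane (int k) E. B (dof_vector E \<delta> S (p - \<phi>)) (dof_vector E \<delta> S q) = 0))"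

definition serendipity_space ::
    "nat \<Rightarrow> plane \<Rightarrow> plane \<Rightarrow> plane \<Rightarrow> (nat \<Rightarrow> dof) \<Rightarrow> nat \<Rightarrow> nat \<Rightarrow>
      ((nat \<Rightarrow> real) \<Rightarrow> (nat \<Rightarrow> real) \<Rightarrow> real) \<Rightarrow> (plane \<Rightarrow> real) set" where
  "serendipity_space k a b c \<delta> S N B =
    {\<phi> \<in> vem_space k a b c. \<forall>r \<in> {S + 1..N}.
      dof_value (closed_triangle a b c) (\<delta> r) \<phi> =
      dof_value (closed_triangle a b c) (\<delta> r) (serendipity_proj k (closed_triangle a b c) \<delta> S B \<phi>)}"

end

theory Submission
  imports Defs
begin

text \<open>
  Write \<open>D \<phi>\<close> for the vector of the first \<open>S\<close> degrees of freedom of \<open>\<phi>\<close>. Two unisolvence facts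
  together make the Serendipity space collapse to the polynomials.

  First, \<open>D\<close> is a bijection from the polynomials of degree at most \<open>k\<close> on the triangle onto the vectors
  of length \<open>S\<close>. It is injective: if \<open>D p = 0\<close>, then \<open>p\<close> vanishes on the three edges (on an edge, \<open>p\<close> is
  \<open>t (1 - t) r(t)\<close> with \<open>r\<close> of degree at most \<open>k - 2\<close>, and testing with \<open>r\<close> gives \<open>r = 0\<close>), so \<open>p\<close> is the
  product of the three linear forms of the edges with some \<open>q\<close> of degree at most \<open>k - 3\<close>; the product of
  the forms has constant sign on the triangle, so testing with \<open>q\<close> gives \<open>p = 0\<close>
  (\<open>poly_plane_unisolvence\<close>). And the dimensions agree: \<open>3 + 3 (k - 1)\<close> boundary degrees of
  freedom and the dimension of degree \<open>k - 3\<close> add up to the dimension of degree \<open>k\<close>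
  (\<open>card_boundary_and_internal_dofs\<close>). Hence the projection interpolates: it sends \<open>\<phi>\<close> to the unique
  polynomial \<open>p\<close> with \<open>D p = D \<phi>\<close> (\<open>serendipity_proj_interpolates\<close>).

  Second, a function of the virtual element space is determined by all of its degrees of freedom
  (\<open>vem_unisolvence\<close>). If \<open>\<phi>\<close> is in the Serendipity space and \<open>p\<close> is its projection, then \<open>\<phi>\<close> and
  \<open>p\<close> agree in the first \<open>S\<close> degrees of freedom by the above and in the remaining ones by definition
  of the space, so \<open>\<phi> = p\<close>.

  The analytic work is in the second fact. Let \<open>\<phi>\<close> have vanishing degrees of freedom. Then \<open>\<phi> = 0\<close> on
  the boundary, and the integral of \<open>\<phi> g\<close> over the triangle is zero for the polynomial \<open>g = \<Delta>\<phi>\<close>.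
  Formally the integral of \<open>\<bar>\<nabla>\<phi>\<bar>\<^sup>2\<close> equals minus the integral of \<open>\<phi> g\<close> and is therefore zero, but
  \<open>\<phi>\<close> is only continuous and \<open>\<Delta>\<phi> = g\<close> holds only in the weak sense. The function is therefore extended
  by zero and mollified to \<open>u\<close>, and the energy identity is tested with \<open>w(u)\<close> for a truncation \<open>w\<close>
  that vanishes near \<open>0\<close>. As \<open>\<phi>\<close> is small near the boundary, \<open>w(u)\<close> has its support where
  \<open>\<Delta>u\<close> is a mollification of \<open>g\<close>. A Poincare inequality turns the energy into an upper bound for the
  integral of \<open>w(u)\<^sup>2\<close> (\<open>cutoff_energy\<close>), and passing to the limit gives that the integral of \<open>\<phi>\<^sup>2\<close> is zero
  (\<open>weak_laplacian_uniqueness\<close>).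
\<close>

section \<open>Partial derivatives and smooth bump functions\<close>

text \<open>
  Only derivatives along lines are needed below, because all integrations by parts are done one
  coordinate at a time.
\<close>

definition has_partial :: "'a::real_normed_vector \<Rightarrow> ('a \<Rightarrow> real) \<Rightarrow> ('a \<Rightarrow> real) \<Rightarrow> bool" where
  "has_partial e F F' \<longleftrightarrow> (\<forall>x. ((\<lambda>t. F (x + t *\<^sub>R e)) has_real_derivative F' x) (at 0))"

lemma has_partialD:
  assumes "has_partial e F F'"
  shows "((\<lambda>t. F (x + t *\<^sub>R e)) has_real_derivative F' (x + s *\<^sub>R e)) (at s)"
proof -
  have "((\<lambda>t. F ((x + s *\<^sub>R e) + t *\<^sub>R e)) has_real_derivative F' (x + s *\<^sub>R e)) (at 0)"
    using assms unfolding has_partial_def by blast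
  then have "((\<lambda>t. F (x + (t + s) *\<^sub>R e)) has_real_derivative F' (x + s *\<^sub>R e)) (at 0)"
    by (simp add: algebra_simps)
  then show ?thesis
    using DERIV_shift[of "\<lambda>t. F (x + t *\<^sub>R e)" "F' (x + s *\<^sub>R e)" 0 s] by simp
qed

lemma has_partial_add:
  "has_partial e F F' \<Longrightarrow> has_partial e G G' \<Longrightarrow> has_partial e (\<lambda>x. F x + G x) (\<lambda>x. F' x + G' x)"
  unfolding has_partial_def by (auto intro!: derivative_eq_intros)

lemma has_partial_diff:
  "has_partial e F F' \<Longrightarrow> has_partial e G G' \<Longrightarrow> has_partial e (\<lambda>x. F x - G x) (\<lambda>x. F' x - G' x)"
  unfolding has_partial_def by (auto intro!: derivative_eq_intros)

lemma has_partial_mult: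
  "has_partial e F F' \<Longrightarrow> has_partial e G G' \<Longrightarrow>
    has_partial e (\<lambda>x. F x * G x) (\<lambda>x. F' x * G x + F x * G' x)"
  unfolding has_partial_def by (auto intro!: derivative_eq_intros)

lemma has_partial_compose:
  assumes "has_partial e F F'" and "\<And>s. (w has_real_derivative w' s) (at s)"
  shows "has_partial e (\<lambda>x. w (F x)) (\<lambda>x. w' (F x) * F' x)"
  unfolding has_partial_def
proof
  fix x
  have "((\<lambda>t. F (x + t *\<^sub>R e)) has_real_derivative F' x) (at 0)"
    using assms(1) unfolding has_partial_def by blast
  from DERIV_chain2[OF _ this, of w "w' (F x)"] assms(2)
  show "((\<lambda>t. w (F (x + t *\<^sub>R e))) has_real_derivative w' (F x) * F' x) (at 0)"
    by simp
qed

lemma C_diff_Suc_has_partial: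
  assumes "C_diff (Suc n) f" "i \<in> Basis"
  shows "has_partial i f (partial i f)"
  unfolding has_partial_def
proof
  fix x :: 'a
  have "(f has_derivative frechet_derivative f (at x)) (at x)"
    using assms frechet_derivative_works by auto
  then have "(f has_derivative frechet_derivative f (at x)) (at (x + 0 *\<^sub>R i))"
    by simp
  moreover have "((\<lambda>t. x + t *\<^sub>R i) has_vector_derivative i) (at 0)"
    by (auto intro!: derivative_eq_intros)
  ultimately have "((f \<circ> (\<lambda>t. x + t *\<^sub>R i)) has_vector_derivative frechet_derivative f (at x) i) (at 0)"
    by (rule vector_derivative_diff_chain_within[rotated, OF has_derivative_at_withinI]) 
  then show "((\<lambda>t. f (x + t *\<^sub>R i)) has_real_derivative partial i f x) (at 0)"
    by (simp add: has_real_derivative_iff_has_vector_derivative partial_def o_def)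
qed

lemma C_diff_continuous: "C_diff n f \<Longrightarrow> continuous_on UNIV f"
  by (cases n) (auto simp: continuous_on_eq_continuous_at differentiable_imp_continuous_within)

lemma C_diff_Suc_D: "C_diff (Suc n) f \<Longrightarrow> C_diff n f"
proof (induction n arbitrary: f)
  case 0
  then show ?case using C_diff_continuous[of "Suc 0" f] by simp
next
  case (Suc n)
  then show ?case by (metis C_diff.simps(2))
qed

lemma C_diff_const: "C_diff n (\<lambda>x. c)"
proof (induction n arbitrary: c)
  case (Suc n)
  have "partial i (\<lambda>x::'a. c) = (\<lambda>x. 0)" for i
    by (auto simp: partial_def)
  with Suc show ?case by auto
qed auto

lemma C_diff_add: "C_diff n f \<Longrightarrow> C_diff n g \<Longrightarrow> C_diff n (\<lambda>x. f x + g x)"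
proof (induction n arbitrary: f g)
  case 0
  then show ?case by (auto intro: continuous_intros)
next
  case (Suc n)
  have d: "((\<lambda>x. f x + g x) has_derivative
      (\<lambda>h. frechet_derivative f (at x) h + frechet_derivative g (at x) h)) (at x)" for x
    using Suc.prems by (intro has_derivative_add) (auto simp: frechet_derivative_works)
  have "partial i (\<lambda>x. f x + g x) = (\<lambda>x. partial i f x + partial i g x)" for i
    unfolding partial_def by (simp add: frechet_derivative_at[OF d, symmetric])
  with Suc show ?case by auto
qed

lemma C_diff_mult: "C_diff n f \<Longrightarrow> C_diff n g \<Longrightarrow> C_diff n (\<lambda>x. f x * g x)"
proof (induction n arbitrary: f g)
  case 0
  then show ?case by (auto intro: continuous_intros)
next
  case (Suc n)
  have d: "((\<lambda>x. f x * g x) has_derivative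
      (\<lambda>h. f x * frechet_derivative g (at x) h + frechet_derivative f (at x) h * g x)) (at x)" for x
    using Suc.prems by (intro has_derivative_mult) (auto simp: frechet_derivative_works)
  have "partial i (\<lambda>x. f x * g x) = (\<lambda>x. f x * partial i g x + partial i f x * g x)" for i
    unfolding partial_def by (simp add: frechet_derivative_at[OF d, symmetric])
  moreover have "C_diff n f" "C_diff n g"
    using Suc.prems C_diff_Suc_D by auto
  ultimately show ?case
    using Suc by (auto intro!: C_diff_add)
qed

text \<open>
  For a family of functions of one variable that is closed under differentiation, composing with a
  linear functional stays within the family up to a constant factor. This is what makes the induction
  over the order of differentiability work.
\<close>

lemma C_diff_ridge:
  assumes "\<And>q s. (G q has_real_derivative G (T q) s) (at s)"
  shows "C_diff n (\<lambda>x. G q (l \<bullet> x + c))"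
proof (induction n arbitrary: q)
  case 0
  have "continuous_on UNIV (G q)"
    using assms by (meson DERIV_continuous_on has_field_derivative_at_within)
  then show ?case
    by (auto intro!: continuous_intros continuous_on_compose2[of UNIV "G q"])
next
  case (Suc n)
  have d: "((\<lambda>x. G q (l \<bullet> x + c)) has_derivative (\<lambda>h. G (T q) (l \<bullet> x + c) * (l \<bullet> h))) (at x)" for x
  proof -
    have "(G q has_derivative (*) (G (T q) (l \<bullet> x + c))) (at (l \<bullet> x + c))"
      using assms by (simp add: has_field_derivative_def)
    moreover have "((\<lambda>x. l \<bullet> x + c) has_derivative (\<lambda>h. l \<bullet> h)) (at x)"
      by (auto intro!: derivative_eq_intros)
    ultimately show ?thesis
      using has_derivative_compose by blast
  qed
  have "partial i (\<lambda>x. G q (l \<bullet> x + c)) = (\<lambda>x. G (T q) (l \<bullet> x + c) * (l \<bullet> i))" for i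
    unfolding partial_def by (simp add: frechet_derivative_at[OF d, symmetric])
  moreover have "(\<lambda>x. G q (l \<bullet> x + c)) differentiable (at x)" for x
    using d differentiable_def by blast
  ultimately show ?case
    using Suc by (auto intro!: C_diff_mult C_diff_const)
qed

text \<open>
  The classical smooth function \<open>exp (- 1 / t)\<close>, extended by zero, together with the polynomial factors
  in \<open>1 / t\<close> that its derivatives produce; with them the family is closed under differentiation.
\<close>

definition flat_exp :: "real poly \<Rightarrow> real \<Rightarrow> real" where
  "flat_exp q t = (if t \<le> 0 then 0 else poly q (1 / t) * exp (- (1 / t)))"

lemma poly_times_exp_minus_tendsto_0: "((\<lambda>s::real. poly p s * exp (- s)) \<longlongrightarrow> 0) at_top"
proof -
  have "((\<lambda>s::real. s ^ k * poly p s * exp (- s)) \<longlongrightarrow> 0) at_top" for k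
  proof (induction p arbitrary: k)
    case (pCons a p)
    have "((\<lambda>s::real. a * (s ^ k / exp s) + s ^ Suc k * poly p s * exp (- s)) \<longlongrightarrow> a * 0 + 0) at_top"
      by (intro tendsto_intros tendsto_power_div_exp_0 pCons.IH)
    then show ?case by (simp add: algebra_simps exp_minus divide_inverse)
  qed simp
  from this[of 0] show ?thesis by simp
qed

text \<open>
  With \<open>s = 1 / t\<close>, the derivative of \<open>q(s) exp (- s)\<close> with respect to \<open>t\<close> is
  \<open>s\<^sup>2 (q(s) - q'(s)) exp (- s)\<close>. At \<open>t = 0\<close> the exponential beats every polynomial.
\<close>

lemma flat_exp_has_derivative:
  "(flat_exp q has_real_derivative flat_exp (pCons 0 (pCons 0 (q - pderiv q))) t) (at t)"
proof -
  consider "t < 0" | "t > 0" | "t = 0" by linarith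
  then show ?thesis
  proof cases
    case 1
    have "((\<lambda>_. 0) has_real_derivative 0) (at t)" by simp
    then have "(flat_exp q has_real_derivative 0) (at t)"
      by (rule has_field_derivative_transform_within_open[where S="{..<0}"])
         (use 1 in \<open>auto simp: flat_exp_def\<close>)
    then show ?thesis using 1 by (simp add: flat_exp_def)
  next
    case 2
    have "((\<lambda>t. poly q (1 / t) * exp (- (1 / t))) has_real_derivative
        flat_exp (pCons 0 (pCons 0 (q - pderiv q))) t) (at t)"
      using 2 by (auto intro!: derivative_eq_intros simp: flat_exp_def divide_simps)
         (auto simp: algebra_simps power2_eq_square)
    then show ?thesis
      by (rule has_field_derivative_transform_within_open[where S="{0<..}"])
         (use 2 in \<open>auto simp: flat_exp_def\<close>)
  next
    case 3
    have "((\<lambda>h. poly (pCons 0 q) (inverse h) * exp (- inverse h)) \<longlongrightarrow> 0) (at_right 0)"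
      using filterlim_compose[OF poly_times_exp_minus_tendsto_0 filterlim_inverse_at_top_right] by blast
    moreover have "\<forall>\<^sub>F h in at_right 0. poly (pCons 0 q) (inverse h) * exp (- inverse h) =
        (flat_exp q (0 + h) - flat_exp q 0) / h"
      by (auto simp: eventually_at_right_field flat_exp_def divide_simps intro!: exI[of _ 1])
    ultimately have r: "((\<lambda>h. (flat_exp q (0 + h) - flat_exp q 0) / h) \<longlongrightarrow> 0) (at_right 0)"
      by (rule Lim_transform_eventually)
    have "\<forall>\<^sub>F h in at_left 0. 0 = (flat_exp q (0 + h) - flat_exp q 0) / h"
      by (auto simp: eventually_at_left_field flat_exp_def intro!: exI[of _ "-1"])
    then have l: "((\<lambda>h. (flat_exp q (0 + h) - flat_exp q 0) / h) \<longlongrightarrow> 0) (at_left 0)"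
      by (rule Lim_transform_eventually[rotated]) simp
    from l r show ?thesis
      using 3 by (auto simp: DERIV_def filterlim_at_split flat_exp_def)
  qed
qed

lemma partial_translate:
  assumes "\<And>x. f differentiable (at x)"
  shows "partial i (\<lambda>y. f (y - x)) = (\<lambda>y. partial i f (y - x))"
proof
  fix y
  have "((\<lambda>y. f (y - x)) has_derivative frechet_derivative f (at (y - x))) (at y)"
  proof -
    have "((\<lambda>y. y - x) has_derivative (\<lambda>h. h)) (at y)"
      by (auto intro!: derivative_eq_intros)
    moreover have "(f has_derivative frechet_derivative f (at (y - x))) (at (y - x))"
      using assms frechet_derivative_works by blast
    ultimately show ?thesis
      using has_derivative_compose by fastforce
  qed
  from frechet_derivative_at[OF this, symmetric] show "partial i (\<lambda>y. f (y - x)) y = partial i f (y - x)"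
    unfolding partial_def by simp
qed

lemma Basis_plane: "(Basis :: plane set) = {(1, 0), (0, 1)}"
  by (auto simp: Basis_prod_def)

lemma laplacian_plane:
  fixes f :: "plane \<Rightarrow> real"
  shows "laplacian f x = partial (1, 0) (partial (1, 0) f) x + partial (0, 1) (partial (0, 1) f) x"
  by (simp add: laplacian_def Basis_plane)

abbreviation square :: "real \<Rightarrow> plane set" where
  "square r \<equiv> cbox (- r, - r) (r, r)"

lemma mem_square: "z \<in> square r \<longleftrightarrow> \<bar>fst z\<bar> \<le> r \<and> \<bar>snd z\<bar> \<le> r"
  by (cases z) (auto simp: cbox_Pair_iff)

text \<open>
  A product of one-variable bumps: the support is a square instead of a disc, which is just as good for
  mollifying and avoids radial functions.
\<close>

definition bump :: "real \<Rightarrow> plane \<Rightarrow> real" where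
  "bump \<epsilon> z = flat_exp 1 (fst z + \<epsilon>) * flat_exp 1 (\<epsilon> - fst z) *
    (flat_exp 1 (snd z + \<epsilon>) * flat_exp 1 (\<epsilon> - snd z))"

lemma flat_exp_1_nonneg: "flat_exp 1 t \<ge> 0" and flat_exp_1_pos_iff: "flat_exp 1 t > 0 \<longleftrightarrow> t > 0"
  by (auto simp: flat_exp_def)

lemma bump_nonneg: "bump \<epsilon> z \<ge> 0"
  by (simp add: bump_def flat_exp_1_nonneg)

lemma bump_eq_0: "z \<notin> square \<epsilon> \<Longrightarrow> bump \<epsilon> z = 0"
  by (auto simp: bump_def flat_exp_def mem_square)

lemma bump_0_pos: "\<epsilon> > 0 \<Longrightarrow> bump \<epsilon> 0 > 0"
  by (simp add: bump_def flat_exp_1_pos_iff)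

lemma C_diff_bump: "C_diff n (\<lambda>y. c * bump \<epsilon> (y - x))"
proof -
  have r: "C_diff n (\<lambda>y::plane. flat_exp 1 (l \<bullet> y + d))" for l d
    by (rule C_diff_ridge[where G=flat_exp, OF flat_exp_has_derivative])
  have "(\<lambda>y. c * bump \<epsilon> (y - x)) = (\<lambda>y. c *
    (flat_exp 1 ((1, 0) \<bullet> y + (\<epsilon> - fst x)) * flat_exp 1 ((-1, 0) \<bullet> y + (\<epsilon> + fst x)) *
    (flat_exp 1 ((0, 1) \<bullet> y + (\<epsilon> - snd x)) * flat_exp 1 ((0, -1) \<bullet> y + (\<epsilon> + snd x)))))"
    by (auto simp: bump_def fun_eq_iff algebra_simps inner_prod_def)
  then show ?thesis
    by (simp only:) (intro C_diff_mult C_diff_const r)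
qed

lemma box_square_nonempty: "r > 0 \<Longrightarrow> box (- r, - r) (r, r :: real) \<noteq> {}"
  by (auto simp: box_ne_empty Basis_plane)

lemma mollifier_exists:
  assumes "\<epsilon> > 0"
  obtains K :: "plane \<Rightarrow> real" where
    "\<And>n x. C_diff n (\<lambda>y. K (y - x))" "\<And>z. K z \<ge> 0" "\<And>z. z \<notin> square \<epsilon> \<Longrightarrow> K z = 0"
    "integral (square \<epsilon>) K = 1"
proof -
  have cont: "continuous_on (square \<epsilon>) (bump \<epsilon>)"
    using C_diff_continuous[OF C_diff_bump[of 0 1 \<epsilon> 0]]
    by (auto intro: continuous_on_subset)
  define I where "I = integral (square \<epsilon>) (bump \<epsilon>)"
  have "I \<ge> 0"
    unfolding I_def by (intro integral_nonneg integrable_continuous cont) (auto simp: bump_nonneg)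
  moreover have "I \<noteq> 0"
    using integral_cbox_eq_0_iff[OF cont box_square_nonempty[OF assms]] bump_nonneg bump_0_pos[OF assms]
    unfolding I_def by (metis abs_0 assms fst_zero less_irrefl less_le mem_square snd_zero)
  ultimately have "I > 0" by simp
  show ?thesis
  proof (rule that[of "\<lambda>z. (1 / I) * bump \<epsilon> z"])
    show "C_diff n (\<lambda>y. 1 / I * bump \<epsilon> (y - x))" for n x
      by (rule C_diff_bump)
    show "integral (square \<epsilon>) (\<lambda>z. (1 / I) * bump \<epsilon> z) = 1"
      using \<open>I > 0\<close> unfolding integral_mult_right I_def[symmetric] by simp
  qed (use \<open>I > 0\<close> bump_nonneg bump_eq_0 in auto)
qed

section \<open>Integration by parts and mollification\<close>

text \<open>
  Fubini and the fundamental theorem of calculus in the direction \<open>e\<close>.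
\<close>

lemma integral_partial_eq_0:
  fixes F :: "plane \<Rightarrow> real"
  assumes e: "e \<in> Basis" and F: "has_partial e F F'" and cont: "continuous_on UNIV F'"
    and zero: "\<And>x. x \<notin> square r \<Longrightarrow> F x = 0" and r: "r < R" "0 < R"
  shows "integral (square R) F' = 0"
proof -
  have c: "continuous_on (square R) F'"
    using cont continuous_on_subset by blast
  have c': "continuous_on (square R) (\<lambda>(x, y). F' (x, y))"
    using c by (simp add: case_prod_unfold)
  consider "e = (1, 0)" | "e = (0, 1)"
    using e by (auto simp: Basis_plane)
  then show ?thesis
  proof cases
    case 1
    have "((\<lambda>s. F' (s, y)) has_integral F (R, y) - F (- R, y)) {- R .. R}" for y
    proof (rule fundamental_theorem_of_calculus)
      show "- R \<le> R" using r by simp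
      fix s
      have "((\<lambda>t. F (t, y)) has_real_derivative F' (s, y)) (at s)"
        using has_partialD[OF F, of "(0, y)" s] 1 by simp
      then show "((\<lambda>t. F (t, y)) has_vector_derivative F' (s, y)) (at s within {- R .. R})"
        by (simp add: has_real_derivative_iff_has_vector_derivative has_vector_derivative_at_within)
    qed
    moreover have "F (R, y) = 0" "F (- R, y) = 0" for y
      using r by (auto intro!: zero simp: mem_square)
    ultimately have "integral (cbox (- R) R) (\<lambda>s. F' (s, y)) = 0" for y
      by (simp add: integral_unique)
    then show ?thesis
      using integral_prod_continuous[OF c] integral_swap_continuous[of _ _ _ _ "\<lambda>x y. F' (x, y)", OF c']
      by simp
  next
    case 2
    have "((\<lambda>s. F' (x, s)) has_integral F (x, R) - F (x, - R)) {- R .. R}" for x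
    proof (rule fundamental_theorem_of_calculus)
      show "- R \<le> R" using r by simp
      fix s
      have "((\<lambda>t. F (x, t)) has_real_derivative F' (x, s)) (at s)"
        using has_partialD[OF F, of "(x, 0)" s] 2 by simp
      then show "((\<lambda>t. F (x, t)) has_vector_derivative F' (x, s)) (at s within {- R .. R})"
        by (simp add: has_real_derivative_iff_has_vector_derivative has_vector_derivative_at_within)
    qed
    moreover have "F (x, R) = 0" "F (x, - R) = 0" for x
      using r by (auto intro!: zero simp: mem_square)
    ultimately have "integral (cbox (- R) R) (\<lambda>s. F' (x, s)) = 0" for x
      by (simp add: integral_unique)
    then show ?thesis
      using integral_prod_continuous[OF c] by simp
  qed
qed

lemma continuous_on_mollify:
  assumes "continuous_on UNIV \<phi>" "continuous_on UNIV K"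
  shows "continuous_on UNIV (\<lambda>x. integral (cbox A B) (\<lambda>y. \<phi> y * K (y - x)) :: real)"
  by (intro integral_continuous_on_param)
    (auto simp: case_prod_unfold intro!: continuous_intros
      continuous_on_compose2[OF assms(1)] continuous_on_compose2[OF assms(2)])

text \<open>
  Differentiation under the integral sign; the sign comes from the argument \<open>y - x\<close> of the kernel.
\<close>

lemma has_partial_mollify:
  assumes \<phi>: "continuous_on UNIV \<phi>" and K: "has_partial e K K'" "continuous_on UNIV K" "continuous_on UNIV K'"
  shows "has_partial e (\<lambda>x. integral (cbox A B) (\<lambda>y. \<phi> y * K (y - x)))
    (\<lambda>x. integral (cbox A B) (\<lambda>y. \<phi> y * (- K' (y - x))))"
  unfolding has_partial_def
proof
  fix x
  note ci = continuous_intros continuous_on_compose2[OF \<phi>] continuous_on_compose2[OF K(2)]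
    continuous_on_compose2[OF K(3)]
  have "((\<lambda>t. integral (cbox A B) (\<lambda>y. \<phi> y * K (y - (x + t *\<^sub>R e)))) has_real_derivative
      integral (cbox A B) (\<lambda>y. \<phi> y * (- K' (y - (x + 0 *\<^sub>R e))))) (at 0 within UNIV)"
  proof (rule leibniz_rule_field_derivative)
    fix t y
    have "((\<lambda>t. - t) has_real_derivative - 1) (at t)"
      by (auto intro!: derivative_eq_intros)
    from DERIV_chain2[OF has_partialD[OF K(1), of "y - x" "- t"] this]
    have "((\<lambda>t. K (y - x - t *\<^sub>R e)) has_real_derivative - K' (y - x - t *\<^sub>R e)) (at t)"
      by simp
    from DERIV_cmult[OF this, of "\<phi> y"]
    show "((\<lambda>t. \<phi> y * K (y - (x + t *\<^sub>R e))) has_real_derivative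
        \<phi> y * (- K' (y - (x + t *\<^sub>R e)))) (at t within UNIV)"
      by (simp add: algebra_simps)
  next
    show "(\<lambda>y. \<phi> y * K (y - (x + t *\<^sub>R e))) integrable_on cbox A B" for t
      by (intro integrable_continuous) (auto intro!: ci)
    show "continuous_on (UNIV \<times> cbox A B) (\<lambda>(t, y). \<phi> y * (- K' (y - (x + t *\<^sub>R e))))"
      by (auto simp: case_prod_unfold intro!: ci)
  qed auto
  then show "((\<lambda>t. integral (cbox A B) (\<lambda>y. \<phi> y * K (y - (x + t *\<^sub>R e)))) has_real_derivative
      integral (cbox A B) (\<lambda>y. \<phi> y * (- K' (y - x)))) (at 0)"
    by simp
qed

text \<open>
  A kernel of mass one takes an average of the values that \<open>h\<close> has on the square around \<open>x\<close>. The
  condition on \<open>x\<close> keeps that square inside the domain of integration.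
\<close>

lemma mollify_approx:
  fixes h K :: "plane \<Rightarrow> real"
  assumes h: "continuous_on UNIV h"
    and K: "continuous_on UNIV K" "\<And>z. K z \<ge> 0" "\<And>z. z \<notin> square \<epsilon> \<Longrightarrow> K z = 0" "integral (square \<epsilon>) K = 1"
    and x: "x \<in> square (R - 1)" and \<epsilon>: "\<epsilon> \<le> 1"
    and close: "\<And>y. y - x \<in> square \<epsilon> \<Longrightarrow> \<bar>h y - h x\<bar> \<le> \<tau>"
  shows "\<bar>integral (square R) (\<lambda>y. h y * K (y - x)) - h x\<bar> \<le> \<tau>"
proof -
  note ci = continuous_intros continuous_on_compose2[OF h] continuous_on_compose2[OF K(1)]
  have int: "(\<lambda>y. (c y :: real) * K (y - x)) integrable_on square R" if "continuous_on UNIV c" for c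
    by (intro integrable_continuous) (auto intro!: ci continuous_on_compose2[OF that])
  have "(K has_integral 1) (square \<epsilon>)"
    using K(4) integrable_continuous[of _ _ K] K(1)
    by (metis continuous_on_subset has_integral_iff top_greatest)
  from has_integral_shift_cbox[OF this, of "- x"]
  have "((\<lambda>y. K (y - x)) has_integral 1) (cbox ((- \<epsilon>, - \<epsilon>) + x) ((\<epsilon>, \<epsilon>) + x))"
    by simp
  then have mass: "((\<lambda>y. K (y - x)) has_integral 1) (square R)"
  proof (rule has_integral_on_superset)
    show "K (y - x) = 0" if "y \<notin> cbox ((- \<epsilon>, - \<epsilon>) + x) ((\<epsilon>, \<epsilon>) + x)" for y
      using that by (intro K(3)) (cases x; cases y; auto simp: mem_square cbox_Pair_iff)
    show "cbox ((- \<epsilon>, - \<epsilon>) + x) ((\<epsilon>, \<epsilon>) + x) \<subseteq> square R"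
      using x \<epsilon> by (cases x) (auto simp: mem_square cbox_Pair_iff)
  qed
  have "integral (square R) (\<lambda>y. h y * K (y - x)) - h x =
      integral (square R) (\<lambda>y. h y * K (y - x)) - integral (square R) (\<lambda>y. h x * K (y - x))"
    using mass by (simp add: integral_unique)
  also have "\<dots> = integral (square R) (\<lambda>y. h y * K (y - x) - h x * K (y - x))"
    by (intro integral_diff[symmetric] int h) auto
  finally have eq: "integral (square R) (\<lambda>y. h y * K (y - x)) - h x =
    integral (square R) (\<lambda>y. h y * K (y - x) - h x * K (y - x))" .
  have "norm (integral (square R) (\<lambda>y. h y * K (y - x) - h x * K (y - x))) \<le>
      integral (square R) (\<lambda>y. \<tau> * K (y - x))"
  proof (rule integral_norm_bound_integral)
    show "(\<lambda>y. h y * K (y - x) - h x * K (y - x)) integrable_on square R"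
      by (intro integrable_diff int h) auto
    show "(\<lambda>y. \<tau> * K (y - x)) integrable_on square R"
      by (intro int) auto
    fix y
    show "norm (h y * K (y - x) - h x * K (y - x)) \<le> \<tau> * K (y - x)"
    proof (cases "y - x \<in> square \<epsilon>")
      case True
      have "norm (h y * K (y - x) - h x * K (y - x)) = \<bar>h y - h x\<bar> * K (y - x)"
        using K(2)[of "y - x"] by (simp add: left_diff_distrib[symmetric] abs_mult)
      then show ?thesis
        using close[OF True] K(2)[of "y - x"] by (simp add: mult_right_mono)
    qed (simp add: K(3))
  qed
  also have "\<dots> = \<tau>"
    using mass by (simp add: integral_unique)
  finally show ?thesis using eq by simp
qed

section \<open>Energy estimate with a truncated function\<close>

text \<open>
  A continuously differentiable substitute for \<open>max t 0\<close>, with error at most \<open>\<delta>\<close>.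
\<close>

definition soft_ramp :: "real \<Rightarrow> real \<Rightarrow> real" where
  "soft_ramp \<delta> t = (max t 0)\<^sup>2 / (max t 0 + \<delta>)"

definition soft_step :: "real \<Rightarrow> real \<Rightarrow> real" where
  "soft_step \<delta> t = 1 - \<delta>\<^sup>2 / (max t 0 + \<delta>)\<^sup>2"

text \<open>
  The truncation \<open>s \<mapsto> sgn s (\<bar>s\<bar> - \<delta>)\<^sup>2 / \<bar>s\<bar>\<close>, which vanishes on \<open>[- \<delta>, \<delta>]\<close>. The quadratic
  contact makes it continuously differentiable, which plain soft thresholding is not.
\<close>

definition cutoff :: "real \<Rightarrow> real \<Rightarrow> real" where
  "cutoff \<delta> s = soft_ramp \<delta> (s - \<delta>) - soft_ramp \<delta> (- s - \<delta>)"

definition cutoff' :: "real \<Rightarrow> real \<Rightarrow> real" where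
  "cutoff' \<delta> s = soft_step \<delta> (s - \<delta>) + soft_step \<delta> (- s - \<delta>)"

lemma soft_ramp_has_derivative:
  assumes "\<delta> > 0"
  shows "(soft_ramp \<delta> has_real_derivative soft_step \<delta> t) (at t)"
proof -
  consider "t < 0" | "t > 0" | "t = 0" by linarith
  then show ?thesis
  proof cases
    case 1
    have "((\<lambda>_. 0) has_real_derivative 0) (at t)" by simp
    then have "(soft_ramp \<delta> has_real_derivative 0) (at t)"
      by (rule has_field_derivative_transform_within_open[where S="{..<0}"])
         (use 1 in \<open>auto simp: soft_ramp_def\<close>)
    then show ?thesis using 1 assms by (simp add: soft_step_def)
  next
    case 2
    then have p: "t + \<delta> \<noteq> 0" using assms by auto
    have "((\<lambda>t. t\<^sup>2 / (t + \<delta>)) has_real_derivative (2 * t * (t + \<delta>) - t\<^sup>2) / (t + \<delta>)\<^sup>2) (at t)"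
      using p by (auto intro!: derivative_eq_intros simp: power2_eq_square)
    moreover have "(2 * t * (t + \<delta>) - t\<^sup>2) / (t + \<delta>)\<^sup>2 = soft_step \<delta> t"
    proof -
      have "2 * t * (t + \<delta>) - t\<^sup>2 = (t + \<delta>)\<^sup>2 - \<delta>\<^sup>2"
        by (simp add: algebra_simps power2_eq_square)
      then show ?thesis
        using p 2 by (simp add: soft_step_def diff_divide_distrib)
    qed
    ultimately have "((\<lambda>t. t\<^sup>2 / (t + \<delta>)) has_real_derivative soft_step \<delta> t) (at t)"
      by simp
    then show ?thesis
      by (rule has_field_derivative_transform_within_open[where S="{0<..}"])
         (use 2 in \<open>auto simp: soft_ramp_def\<close>)
  next
    case 3
    have "((\<lambda>h. (soft_ramp \<delta> (0 + h) - soft_ramp \<delta> 0) / h) \<longlongrightarrow> 0) (at 0)"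
    proof (rule Lim_null_comparison)
      have "norm ((soft_ramp \<delta> (0 + h) - soft_ramp \<delta> 0) / h) \<le> \<bar>h\<bar> / \<delta>" for h
      proof (cases "h \<le> 0")
        case True
        then show ?thesis using assms by (simp add: soft_ramp_def divide_nonpos_pos)
      next
        case False
        then have "h / (h + \<delta>) \<le> h / \<delta>"
          using assms by (intro divide_left_mono) auto
        then show ?thesis using False assms by (simp add: soft_ramp_def power2_eq_square)
      qed
      then show "\<forall>\<^sub>F h in at 0. norm ((soft_ramp \<delta> (0 + h) - soft_ramp \<delta> 0) / h) \<le> \<bar>h\<bar> / \<delta>"
        by simp
      have "((\<lambda>h. \<bar>h\<bar> / \<delta>) \<longlongrightarrow> \<bar>0\<bar> / \<delta>) (at 0)"
        using assms by (intro tendsto_intros) auto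
      then show "((\<lambda>h. \<bar>h\<bar> / \<delta>) \<longlongrightarrow> 0) (at 0)" by simp
    qed
    then show ?thesis
      using 3 assms by (simp add: DERIV_def soft_step_def)
  qed
qed

lemma cutoff_has_derivative:
  assumes "\<delta> > 0"
  shows "(cutoff \<delta> has_real_derivative cutoff' \<delta> s) (at s)"
proof -
  have 1: "((\<lambda>s. soft_ramp \<delta> (s - \<delta>)) has_real_derivative soft_step \<delta> (s - \<delta>) * 1) (at s)"
    by (rule DERIV_chain2[OF soft_ramp_has_derivative[OF assms]]) (auto intro!: derivative_eq_intros)
  have 2: "((\<lambda>s. soft_ramp \<delta> (- s - \<delta>)) has_real_derivative soft_step \<delta> (- s - \<delta>) * (- 1)) (at s)"
    by (rule DERIV_chain2[OF soft_ramp_has_derivative[OF assms]]) (auto intro!: derivative_eq_intros)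
  show ?thesis
    using DERIV_diff[OF 1 2] by (simp add: cutoff_def[abs_def] cutoff'_def)
qed

lemma continuous_on_cutoff: "\<delta> > 0 \<Longrightarrow> continuous_on UNIV (cutoff \<delta>)"
  by (meson DERIV_continuous_on cutoff_has_derivative has_field_derivative_at_within)

lemma continuous_on_cutoff': "\<delta> > 0 \<Longrightarrow> continuous_on UNIV (cutoff' \<delta>)"
  unfolding cutoff'_def[abs_def] soft_step_def[abs_def]
  by (intro continuous_intros ballI) (auto simp: max_def)

lemma cutoff_eq_0: "\<bar>s\<bar> \<le> \<delta> \<Longrightarrow> cutoff \<delta> s = 0"
  by (auto simp: cutoff_def soft_ramp_def)

lemma soft_ramp_bounds:
  assumes "\<delta> > 0" "t \<ge> 0"
  shows "0 \<le> soft_ramp \<delta> t" "soft_ramp \<delta> t \<le> t" "t - \<delta> \<le> soft_ramp \<delta> t"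
proof -
  have p: "t + \<delta> > 0" using assms by auto
  show "0 \<le> soft_ramp \<delta> t" using assms by (auto simp: soft_ramp_def)
  show "soft_ramp \<delta> t \<le> t"
    using assms p by (simp add: soft_ramp_def field_simps power2_eq_square)
  have "(t - \<delta>) * (t + \<delta>) \<le> t\<^sup>2" by (simp add: algebra_simps power2_eq_square)
  then show "t - \<delta> \<le> soft_ramp \<delta> t"
    using assms p by (simp add: soft_ramp_def pos_le_divide_eq)
qed

lemma cutoff_close:
  assumes "\<delta> > 0"
  shows "\<bar>cutoff \<delta> s - s\<bar> \<le> 2 * \<delta>"
proof -
  have z: "soft_ramp \<delta> t = 0" if "t \<le> 0" for t using that by (simp add: soft_ramp_def)
  consider "s > \<delta>" | "s < - \<delta>" | "\<bar>s\<bar> \<le> \<delta>" by linarith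
  then show ?thesis
  proof cases
    case 1
    then show ?thesis
      using assms soft_ramp_bounds[of \<delta> "s - \<delta>"] z[of "- s - \<delta>"] by (simp add: cutoff_def abs_if)
  next
    case 2
    then show ?thesis
      using assms soft_ramp_bounds[of \<delta> "- s - \<delta>"] z[of "s - \<delta>"] by (simp add: cutoff_def abs_if)
  qed (use assms cutoff_eq_0 in auto)
qed

lemma soft_step_bounds:
  assumes "\<delta> > 0"
  shows "0 \<le> soft_step \<delta> t" "soft_step \<delta> t \<le> 1" "t \<le> 0 \<Longrightarrow> soft_step \<delta> t = 0"
proof -
  have "\<delta>\<^sup>2 \<le> (max t 0 + \<delta>)\<^sup>2" using assms by (intro power_mono) auto
  moreover have "(max t 0 + \<delta>)\<^sup>2 > 0" using assms by (auto simp: max_def)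
  ultimately show "0 \<le> soft_step \<delta> t" "soft_step \<delta> t \<le> 1" "t \<le> 0 \<Longrightarrow> soft_step \<delta> t = 0"
    using assms by (auto simp: soft_step_def)
qed

lemma cutoff'_bounds:
  assumes "\<delta> > 0"
  shows "0 \<le> cutoff' \<delta> s" "cutoff' \<delta> s \<le> 1"
proof -
  note bounds = soft_step_bounds[OF assms, of "s - \<delta>"] soft_step_bounds[OF assms, of "- s - \<delta>"]
  show "0 \<le> cutoff' \<delta> s"
    using bounds by (simp add: cutoff'_def)
  show "cutoff' \<delta> s \<le> 1"
    using bounds assms by (cases "s \<ge> 0") (simp_all add: cutoff'_def)
qed

text \<open>
  Write \<open>w\<close> for the truncated function \<open>cutoff \<delta> (u x)\<close> and \<open>m \<in> [0, 1]\<close> for the derivative of the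
  truncation. Integrating the derivatives of \<open>w u1\<close>, \<open>w u2\<close> shows that the integral of
  \<open>m (u1\<^sup>2 + u2\<^sup>2)\<close> is minus that of \<open>w (u11 + u22)\<close>. Integrating the derivative of \<open>x1 w\<^sup>2\<close> in the
  first coordinate \<open>x1\<close> gives the Poincare inequality: the integral of \<open>w\<^sup>2 + 2 x1 w m u1\<close> is zero, and
  the cross term is absorbed by Young's inequality because \<open>\<bar>x1\<bar> \<le> R\<close> and \<open>m\<^sup>2 \<le> m\<close>.
\<close>

lemma cutoff_energy:
  fixes u :: "plane \<Rightarrow> real"
  assumes \<delta>: "\<delta> > 0" and R: "R > 1"
    and p: "has_partial (1, 0) u u1" "has_partial (0, 1) u u2"
      "has_partial (1, 0) u1 u11" "has_partial (0, 1) u2 u22"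
    and c: "continuous_on UNIV u" "continuous_on UNIV u1" "continuous_on UNIV u2"
      "continuous_on UNIV u11" "continuous_on UNIV u22"
    and zero: "\<And>x. x \<notin> square (R - 1) \<Longrightarrow> u x = 0"
  shows "integral (square R) (\<lambda>x. (cutoff \<delta> (u x))\<^sup>2 + 4 * R\<^sup>2 * (cutoff \<delta> (u x) * (u11 x + u22 x))) \<le> 0"
proof -
  let ?w = "\<lambda>x. cutoff \<delta> (u x)" and ?w' = "\<lambda>x. cutoff' \<delta> (u x)"
  have cw: "continuous_on UNIV ?w" "continuous_on UNIV ?w'"
    using continuous_on_compose2[OF continuous_on_cutoff[OF \<delta>] c(1)]
      continuous_on_compose2[OF continuous_on_cutoff'[OF \<delta>] c(1)] by auto
  have int: "f integrable_on square R" if "continuous_on UNIV f" for f :: "plane \<Rightarrow> real"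
    using that by (meson continuous_on_subset integrable_continuous subset_UNIV)
  note ci = continuous_intros c cw
  have w: "has_partial e ?w (\<lambda>x. ?w' x * v x)" if "has_partial e u v" for e v
    by (rule has_partial_compose[OF that cutoff_has_derivative[OF \<delta>]])
  have wz: "?w x = 0" if "x \<notin> square (R - 1)" for x
    using zero[OF that] \<delta> by (simp add: cutoff_eq_0)
  have 1: "integral (square R) (\<lambda>x. ?w' x * u1 x * u1 x + ?w x * u11 x) = 0"
    by (rule integral_partial_eq_0[OF _ has_partial_mult[OF w[OF p(1)] p(3)], of "R - 1"])
      (use R wz in \<open>auto simp: Basis_plane intro!: ci\<close>)
  have 2: "integral (square R) (\<lambda>x. ?w' x * u2 x * u2 x + ?w x * u22 x) = 0"
    by (rule integral_partial_eq_0[OF _ has_partial_mult[OF w[OF p(2)] p(4)], of "R - 1"])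
      (use R wz in \<open>auto simp: Basis_plane intro!: ci\<close>)
  have f: "has_partial (1, 0) (fst :: plane \<Rightarrow> real) (\<lambda>x. 1)"
    unfolding has_partial_def by (auto intro!: derivative_eq_intros)
  have 3: "integral (square R) (\<lambda>x. 1 * (?w x * ?w x) +
      fst x * (?w' x * u1 x * ?w x + ?w x * (?w' x * u1 x))) = 0"
    by (rule integral_partial_eq_0[OF _ has_partial_mult[OF f has_partial_mult[OF w[OF p(1)] w[OF p(1)]]], of "R - 1"])
      (use R wz in \<open>auto simp: Basis_plane intro!: ci\<close>)
  let ?A = "\<lambda>x. ?w' x * u1 x * u1 x + ?w x * u11 x"
  let ?B = "\<lambda>x. ?w' x * u2 x * u2 x + ?w x * u22 x"
  let ?C = "\<lambda>x. 1 * (?w x * ?w x) + fst x * (?w' x * u1 x * ?w x + ?w x * (?w' x * u1 x))"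
  let ?L = "\<lambda>x. (?w x)\<^sup>2 + 4 * R\<^sup>2 * (?w x * (u11 x + u22 x))"
  let ?U = "\<lambda>x. 2 * ?C x + 4 * R\<^sup>2 * (?A x + ?B x)"
  have "integral (square R) ?L \<le> integral (square R) ?U"
  proof (rule integral_le)
    show "?L integrable_on square R" "?U integrable_on square R"
      by (intro int; auto intro!: ci)+
    fix x assume x: "x \<in> square R"
    \<comment> \<open>The difference of the integrands is \<open>(a + 2 x1 m v)\<^sup>2 + 4 (R\<^sup>2 m - x1\<^sup>2 m\<^sup>2) v\<^sup>2\<close> plus the nonnegative
      contribution of \<open>u2\<close>, where \<open>x1\<close> stands for \<open>fst x\<close>.\<close>
    define a where "a = ?w x"
    define m where "m = ?w' x"
    define v where "v = u1 x"
    have m: "0 \<le> m" "m \<le> 1" using cutoff'_bounds[OF \<delta>] by (auto simp: m_def)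
    have "(fst x)\<^sup>2 \<le> R\<^sup>2"
      using x R by (auto simp: mem_square abs_le_square_iff[symmetric])
    moreover have "m\<^sup>2 \<le> m" using m by (simp add: power2_eq_square mult_left_le)
    ultimately have "(fst x)\<^sup>2 * m\<^sup>2 \<le> R\<^sup>2 * m" by (intro mult_mono) auto
    then have "(fst x)\<^sup>2 * m\<^sup>2 * v\<^sup>2 \<le> R\<^sup>2 * m * v\<^sup>2" by (rule mult_right_mono) simp
    moreover have "(a + 2 * (fst x * m * v))\<^sup>2 \<ge> 0" by simp
    then have "a\<^sup>2 + 4 * (a * (fst x * m * v)) + 4 * ((fst x)\<^sup>2 * m\<^sup>2 * v\<^sup>2) \<ge> 0"
      by (simp add: power2_eq_square algebra_simps)
    ultimately have k: "a\<^sup>2 + 4 * (a * (fst x * m * v)) + 4 * (R\<^sup>2 * m * v\<^sup>2) \<ge> 0"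
      by linarith
    have b: "R\<^sup>2 * (m * (u2 x * u2 x)) \<ge> 0" using m by simp
    have "?U x - ?L x = a\<^sup>2 + 4 * (a * (fst x * m * v)) + 4 * (R\<^sup>2 * m * v\<^sup>2) + 4 * (R\<^sup>2 * (m * (u2 x * u2 x)))"
      unfolding a_def[symmetric] m_def[symmetric] v_def[symmetric]
      by (simp add: power2_eq_square algebra_simps)
    then show "?L x \<le> ?U x" using k b by linarith
  qed
  also have "integral (square R) ?U = 2 * integral (square R) ?C +
      4 * R\<^sup>2 * (integral (square R) ?A + integral (square R) ?B)"
  proof -
    have i: "?A integrable_on square R" "?B integrable_on square R" "?C integrable_on square R"
      by (intro int; auto intro!: ci)+
    have "(?U has_integral 2 * integral (square R) ?C +
      4 * R\<^sup>2 * (integral (square R) ?A + integral (square R) ?B)) (square R)"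
      using i by (intro has_integral_add has_integral_mult_right integrable_integral)
    then show ?thesis by (rule integral_unique)
  qed
  also have "\<dots> = 0" unfolding 1 2 3 by simp
  finally show ?thesis .
qed

section \<open>Uniqueness for the weak Laplacian with zero boundary values\<close>

lemma set_integral_eq_integral_square:
  fixes F :: "plane \<Rightarrow> real"
  assumes "continuous_on UNIV F" "\<And>x. x \<notin> \<Omega> \<Longrightarrow> F x = 0" "\<Omega> \<subseteq> square R"
  shows "(LINT x:\<Omega>|lborel. F x) = integral (square R) F"
proof -
  have "(\<lambda>x. indicator \<Omega> x *\<^sub>R F x) = (\<lambda>x. indicator (square R) x *\<^sub>R F x)"
    using assms(2,3) by (fastforce simp: indicator_def)
  then have "(LINT x:\<Omega>|lborel. F x) = (LINT x:square R|lborel. F x)"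
    unfolding set_lebesgue_integral_def by simp
  also have "\<dots> = integral (square R) F"
  proof (rule set_borel_integral_eq_integral)
    show "set_integrable lborel (square R) F"
      unfolding set_integrable_def
      by (rule borel_integrable_compact[OF compact_cbox]) (meson assms(1) continuous_on_subset subset_UNIV)
  qed
  finally show ?thesis .
qed

lemma square_mono: "r \<le> s \<Longrightarrow> square r \<subseteq> square s"
  unfolding subset_iff mem_square by auto

lemma mem_shifted_square: "y \<in> cbox (x + (- \<epsilon>, - \<epsilon>)) (x + (\<epsilon>, \<epsilon>)) \<longleftrightarrow> y - x \<in> square \<epsilon>"
  by (cases x; cases y) (auto simp: mem_square cbox_Pair_iff)

lemma bounded_subset_square:
  assumes "bounded (\<Omega> :: plane set)"
  obtains r where "r > 0" "\<Omega> \<subseteq> square r"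
proof -
  obtain r where r: "r > 0" "\<And>z. z \<in> \<Omega> \<Longrightarrow> norm z \<le> r"
    using assms bounded_pos by blast
  have "\<Omega> \<subseteq> square r"
  proof
    fix z assume "z \<in> \<Omega>"
    then have "norm (fst z) \<le> r" "norm (snd z) \<le> r"
      using r(2)[of z] norm_fst_le[of "fst z" "snd z"] norm_snd_le[of "snd z" "fst z"] by auto
    then show "z \<in> square r" unfolding mem_square by simp
  qed
  then show ?thesis using that r(1) by blast
qed

lemma square_norm: "z \<in> square \<epsilon> \<Longrightarrow> norm z \<le> 2 * \<epsilon>"
  using norm_Pair_le[of "fst z" "snd z"] by (auto simp: mem_square)

lemma uniform_continuity_square:
  fixes h :: "plane \<Rightarrow> real"
  assumes "continuous_on UNIV h" "\<tau> > 0"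
  obtains \<epsilon> where "\<epsilon> > 0" "\<epsilon> \<le> 1" "\<And>x y. x \<in> square R \<Longrightarrow> y - x \<in> square \<epsilon> \<Longrightarrow> \<bar>h y - h x\<bar> \<le> \<tau>"
proof -
  have "uniformly_continuous_on (square (R + 1)) h"
    by (rule compact_uniformly_continuous) (use assms continuous_on_subset in auto)
  then obtain d where d: "d > 0"
    "\<And>x y. x \<in> square (R + 1) \<Longrightarrow> y \<in> square (R + 1) \<Longrightarrow> dist y x < d \<Longrightarrow> dist (h y) (h x) < \<tau>"
    using assms(2) unfolding uniformly_continuous_on_def by blast
  show ?thesis
  proof (rule that[of "min 1 (d / 3)"])
    fix x y assume x: "x \<in> square R" and y: "y - x \<in> square (min 1 (d / 3))"
    have "x \<in> square (R + 1)" "y \<in> square (R + 1)"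
      using x y unfolding mem_square by auto
    moreover have "dist y x < d"
      using square_norm[OF y] d(1) by (auto simp: dist_norm min_def split: if_splits)
    ultimately show "\<bar>h y - h x\<bar> \<le> \<tau>"
      using d(2)[of x y] by (simp add: dist_real_def)
  qed (use d in auto)
qed

text \<open>
  The approximation is the mollification of \<open>\<phi>\<close> with a kernel so narrow that \<open>\<phi>\<close> and \<open>g\<close> vary by at
  most \<open>\<tau>\<close> over its support. Where \<open>\<bar>\<phi> x\<bar> > \<tau>\<close>, the function \<open>\<phi>\<close> has no zero on the square around
  \<open>x\<close>, so this square lies in \<open>\<Omega>\<close>. The translated kernel is then a test function, and the weak equation
  turns the Laplacian of the mollification into a mollification of \<open>g\<close>.
\<close>

lemma smooth_approximation:
  fixes \<phi> g :: "plane \<Rightarrow> real"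
  assumes \<phi>: "continuous_on UNIV \<phi>" "\<And>x. x \<notin> \<Omega> \<Longrightarrow> \<phi> x = 0" and \<Omega>: "\<Omega> \<subseteq> square (R - 2)"
    and g: "continuous_on UNIV g" and weak: "has_weak_laplacian \<phi> g \<Omega>" and \<tau>: "\<tau> > 0"
  obtains u u1 u2 u11 u22 where
    "has_partial (1, 0) u u1" "has_partial (0, 1) u u2"
    "has_partial (1, 0) u1 u11" "has_partial (0, 1) u2 u22"
    "continuous_on UNIV u" "continuous_on UNIV u1" "continuous_on UNIV u2"
    "continuous_on UNIV u11" "continuous_on UNIV u22"
    "\<And>x. x \<notin> square (R - 1) \<Longrightarrow> u x = 0"
    "\<And>x. \<bar>u x - \<phi> x\<bar> \<le> \<tau>"
    "\<And>x. \<bar>\<phi> x\<bar> > \<tau> \<Longrightarrow> \<bar>u11 x + u22 x - g x\<bar> \<le> \<tau>"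
proof -
  obtain \<epsilon>1 where e1: "\<epsilon>1 > 0" "\<epsilon>1 \<le> 1" "\<And>x y. x \<in> square R \<Longrightarrow> y - x \<in> square \<epsilon>1 \<Longrightarrow> \<bar>\<phi> y - \<phi> x\<bar> \<le> \<tau>"
    using uniform_continuity_square[OF \<phi>(1) \<tau>] by metis
  obtain \<epsilon>2 where e2: "\<epsilon>2 > 0" "\<epsilon>2 \<le> 1" "\<And>x y. x \<in> square R \<Longrightarrow> y - x \<in> square \<epsilon>2 \<Longrightarrow> \<bar>g y - g x\<bar> \<le> \<tau>"
    using uniform_continuity_square[OF g \<tau>] by metis
  define \<epsilon> where "\<epsilon> = min \<epsilon>1 \<epsilon>2"
  have \<epsilon>: "\<epsilon> > 0" "\<epsilon> \<le> 1" using e1 e2 by (auto simp: \<epsilon>_def)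
  have sub: "square \<epsilon> \<subseteq> square \<epsilon>1" "square \<epsilon> \<subseteq> square \<epsilon>2" by (auto simp: mem_square \<epsilon>_def)
  obtain K where K: "\<And>n x. C_diff n (\<lambda>y. K (y - x))" "\<And>z. K z \<ge> 0"
    "\<And>z. z \<notin> square \<epsilon> \<Longrightarrow> K z = 0" "integral (square \<epsilon>) K = 1"
    using mollifier_exists[OF \<epsilon>(1)] by metis
  have CK: "C_diff n K" for n using K(1)[of n 0] by simp
  define K1 where "K1 = partial (1, 0) K"
  define K2 where "K2 = partial (0, 1) K"
  define K11 where "K11 = partial (1, 0) K1"
  define K22 where "K22 = partial (0, 1) K2"
  have CK12: "C_diff n K1" "C_diff n K2" for n
    using CK[of "Suc n"] by (auto simp: K1_def K2_def Basis_plane)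
  have CK1122: "C_diff n K11" "C_diff n K22" for n
    using CK12[of "Suc n"] by (auto simp: K11_def K22_def Basis_plane)
  have pK: "has_partial (1, 0) K K1" "has_partial (0, 1) K K2"
    "has_partial (1, 0) K1 K11" "has_partial (0, 1) K2 K22"
    unfolding K1_def K2_def K11_def K22_def
    by (rule C_diff_Suc_has_partial[where n=0]; (rule CK | rule CK12[unfolded K1_def K2_def] | simp add: Basis_plane))+
  have cK: "continuous_on UNIV K" "continuous_on UNIV K1" "continuous_on UNIV K2"
      "continuous_on UNIV K11" "continuous_on UNIV K22"
    using C_diff_continuous[OF CK] C_diff_continuous[OF CK12(1)] C_diff_continuous[OF CK12(2)]
     C_diff_continuous[OF CK1122(1)] C_diff_continuous[OF CK1122(2)] by blast+
  have pK': "has_partial (1, 0) (\<lambda>z. - K1 z) (\<lambda>z. - K11 z)" "has_partial (0, 1) (\<lambda>z. - K2 z) (\<lambda>z. - K22 z)"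
    using pK(3,4) unfolding has_partial_def by (auto intro!: derivative_eq_intros)
  have cK': "continuous_on UNIV (\<lambda>z. - K1 z)" "continuous_on UNIV (\<lambda>z. - K2 z)"
      "continuous_on UNIV (\<lambda>z. - K11 z)" "continuous_on UNIV (\<lambda>z. - K22 z)"
    using cK by (auto intro!: continuous_intros)
  define M where "M = (\<lambda>k x. integral (square R) (\<lambda>y. \<phi> y * (k (y - x) :: real)))"
  have cM: "continuous_on UNIV (M k)" if "continuous_on UNIV k" for k
    unfolding M_def by (rule continuous_on_mollify[OF \<phi>(1) that])
  have laplace: "laplacian (\<lambda>y. K (y - x)) y = K11 (y - x) + K22 (y - x)" for x y
  proof -
    have d: "K differentiable (at z)" "K1 differentiable (at z)" "K2 differentiable (at z)" for z
      using CK[of "Suc 0"] CK12[of "Suc 0"] unfolding C_diff.simps by blast+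
    show ?thesis
      using d by (simp add: laplacian_plane partial_translate K11_def K22_def K1_def K2_def)
  qed
  have far: "\<phi> y * k (y - x) = 0" if "x \<notin> square (R - 1)" "\<And>z. z \<notin> square \<epsilon> \<Longrightarrow> k z = 0" for x y and k :: "plane \<Rightarrow> real"
  proof (cases "y \<in> \<Omega>")
    case True
    then have "y \<in> square (R - 2)" using \<Omega> by blast
    then have "y - x \<notin> square \<epsilon>" using that(1) \<epsilon> unfolding mem_square by auto
    then show ?thesis using that(2) by simp
  qed (simp add: \<phi>)
  have close: "\<bar>M K x - \<phi> x\<bar> \<le> \<tau>" for x
  proof (cases "x \<in> square (R - 1)")
    case True
    then have x: "x \<in> square R" using square_mono[of "R - 1" R] by auto
    show ?thesis unfolding M_def
      by (rule mollify_approx[OF \<phi>(1) cK(1) K(2-4) True \<epsilon>(2)]) (use e1(3)[OF x] sub in auto)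
  next
    case False
    then have "x \<notin> \<Omega>" using \<Omega> square_mono[of "R - 2" "R - 1"] by auto
    moreover have "(\<lambda>y. \<phi> y * K (y - x)) = (\<lambda>y. 0)"
      using far[where k = K, OF False] K(3) by blast
    ultimately show ?thesis using \<phi>(2) \<tau> by (simp only: M_def) simp
  qed
  have lap: "\<bar>M K11 x + M K22 x - g x\<bar> \<le> \<tau>" if big: "\<bar>\<phi> x\<bar> > \<tau>" for x
  proof -
    have "x \<in> \<Omega>" using big \<phi>(2)[of x] \<tau> by (cases "x \<in> \<Omega>") auto
    then have x: "x \<in> square (R - 1)" "x \<in> square R"
      using \<Omega> square_mono[of "R - 2" "R - 1"] square_mono[of "R - 1" R] by auto
    have supp: "y \<in> \<Omega>" if "y - x \<in> square \<epsilon>" for y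
    proof -
      have "\<bar>\<phi> y - \<phi> x\<bar> \<le> \<tau>" using e1(3)[OF x(2)] that sub by blast
      then have "\<phi> y \<noteq> 0" using big by auto
      then show ?thesis using \<phi>(2) by blast
    qed
    let ?S = "{y. K (y - x) \<noteq> 0}"
    have S: "?S \<subseteq> cbox (x + (- \<epsilon>, - \<epsilon>)) (x + (\<epsilon>, \<epsilon>))"
    proof
      fix y assume "y \<in> ?S"
      then have "y - x \<in> square \<epsilon>" using K(3) by blast
      then show "y \<in> cbox (x + (- \<epsilon>, - \<epsilon>)) (x + (\<epsilon>, \<epsilon>))"
        unfolding mem_shifted_square .
    qed
    then have clS: "closure ?S \<subseteq> cbox (x + (- \<epsilon>, - \<epsilon>)) (x + (\<epsilon>, \<epsilon>))"
      by (rule closure_minimal[OF _ closed_cbox])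
    have "test_function \<Omega> (\<lambda>y. K (y - x))"
      unfolding test_function_def
    proof (intro conjI allI)
      show "C_diff n (\<lambda>y. K (y - x))" for n by (rule K(1))
      show "compact (closure ?S)"
        using clS by (meson bounded_cbox bounded_subset closed_closure compact_eq_bounded_closed)
      show "closure ?S \<subseteq> \<Omega>"
      proof
        fix y assume "y \<in> closure ?S"
        then have "y - x \<in> square \<epsilon>"
          using clS mem_shifted_square by blast
        then show "y \<in> \<Omega>" by (rule supp)
      qed
    qed
    then have "(LINT y:\<Omega>|lborel. \<phi> y * laplacian (\<lambda>y. K (y - x)) y) = (LINT y:\<Omega>|lborel. g y * K (y - x))"
      using weak unfolding has_weak_laplacian_def by blast
    moreover have "(LINT y:\<Omega>|lborel. \<phi> y * laplacian (\<lambda>y. K (y - x)) y) =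
        integral (square R) (\<lambda>y. \<phi> y * (K11 (y - x) + K22 (y - x)))"
      unfolding laplace
    proof (rule set_integral_eq_integral_square)
      show "continuous_on UNIV (\<lambda>y. \<phi> y * (K11 (y - x) + K22 (y - x)))"
        by (intro continuous_intros \<phi>(1) continuous_on_compose2[OF cK(4)] continuous_on_compose2[OF cK(5)]) auto
      show "\<Omega> \<subseteq> square R" using \<Omega> square_mono[of "R - 2" R] by auto
    qed (simp add: \<phi>)
    moreover have "(LINT y:\<Omega>|lborel. g y * K (y - x)) = integral (square R) (\<lambda>y. g y * K (y - x))"
    proof (rule set_integral_eq_integral_square)
      show "continuous_on UNIV (\<lambda>y. g y * K (y - x))"
        by (intro continuous_intros g continuous_on_compose2[OF cK(1)]) auto
      show "\<Omega> \<subseteq> square R" using \<Omega> square_mono[of "R - 2" R] by auto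
      show "g y * K (y - x) = 0" if "y \<notin> \<Omega>" for y
      proof -
        have "y - x \<notin> square \<epsilon>" using supp that by blast
        then show ?thesis using K(3) by simp
      qed
    qed
    moreover have "integral (square R) (\<lambda>y. \<phi> y * (K11 (y - x) + K22 (y - x))) = M K11 x + M K22 x"
    proof -
      have "(\<lambda>y. \<phi> y * k (y - x)) integrable_on square R" if "continuous_on UNIV k" for k :: "plane \<Rightarrow> real"
        by (intro integrable_continuous continuous_intros continuous_on_subset[OF \<phi>(1)]
            continuous_on_compose2[OF that]) auto
      then show ?thesis
        unfolding M_def using cK by (simp add: distrib_left integral_add)
    qed
    ultimately have "M K11 x + M K22 x = integral (square R) (\<lambda>y. g y * K (y - x))"
      by metis
    moreover have "\<bar>integral (square R) (\<lambda>y. g y * K (y - x)) - g x\<bar> \<le> \<tau>"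
      by (rule mollify_approx[OF g cK(1) K(2-4) x(1) \<epsilon>(2)]) (use e2(3)[OF x(2)] sub in auto)
    ultimately show ?thesis by simp
  qed
  show ?thesis
  proof (rule that[of "M K" "M (\<lambda>z. - K1 z)" "M (\<lambda>z. - K2 z)" "M K11" "M K22"])
    show "has_partial (1, 0) (M K) (M (\<lambda>z. - K1 z))" "has_partial (0, 1) (M K) (M (\<lambda>z. - K2 z))"
      unfolding M_def by (rule has_partial_mollify[OF \<phi>(1)]; rule pK cK)+
    show "has_partial (1, 0) (M (\<lambda>z. - K1 z)) (M K11)" "has_partial (0, 1) (M (\<lambda>z. - K2 z)) (M K22)"
      using has_partial_mollify[OF \<phi>(1) pK'(1) cK'(1,3), of "(- R, - R)" "(R, R)"]
        has_partial_mollify[OF \<phi>(1) pK'(2) cK'(2,4), of "(- R, - R)" "(R, R)"]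
      by (simp_all add: M_def)
    show "M K x = 0" if "x \<notin> square (R - 1)" for x
    proof -
      have "(\<lambda>y. \<phi> y * K (y - x)) = (\<lambda>y. 0)"
        using far[where k = K, OF that] K(3) by blast
      then show ?thesis by (simp only: M_def) simp
    qed
  qed (rule cM cK cK' close lap; assumption?)+
qed

text \<open>
  Truncating the smooth approximation at height \<open>2 \<tau>\<close> makes its support lie in the set where its
  Laplacian is close to \<open>g\<close>. The energy estimate then bounds the integral of \<open>\<phi>\<^sup>2 + 4 R\<^sup>2 \<phi> g\<close> by a multiple
  of \<open>\<tau>\<close>, where the second summand integrates to zero.
\<close>

theorem weak_laplacian_uniqueness:
  fixes \<phi> g :: "plane \<Rightarrow> real"
  assumes \<phi>: "continuous_on UNIV \<phi>" "\<And>x. x \<notin> \<Omega> \<Longrightarrow> \<phi> x = 0" and \<Omega>: "bounded \<Omega>"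
    and g: "continuous_on UNIV g" and weak: "has_weak_laplacian \<phi> g \<Omega>"
    and orth: "(LINT x:\<Omega>|lborel. \<phi> x * g x) = 0"
  shows "\<phi> x = 0"
proof -
  obtain r where r: "r > 0" "\<Omega> \<subseteq> square r"
    using bounded_subset_square[OF \<Omega>] .
  define R where "R = r + 2"
  have R: "R > 1" and \<Omega>R: "\<Omega> \<subseteq> square (R - 2)"
    using r by (simp_all add: R_def)
  have cont: "continuous_on (square R) \<phi>" "continuous_on (square R) g"
    using \<phi>(1) g continuous_on_subset by blast+
  obtain m where m: "\<And>x. x \<in> square R \<Longrightarrow> norm (\<phi> x) \<le> m" "\<And>x. x \<in> square R \<Longrightarrow> norm (g x) \<le> m" "m \<ge> 1"
  proof -
    obtain m1 where m1: "\<forall>y \<in> \<phi> ` square R. norm y \<le> m1"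
      using compact_imp_bounded[OF compact_continuous_image[OF cont(1) compact_cbox]]
      unfolding bounded_iff by blast
    obtain m2 where m2: "\<forall>y \<in> g ` square R. norm y \<le> m2"
      using compact_imp_bounded[OF compact_continuous_image[OF cont(2) compact_cbox]]
      unfolding bounded_iff by blast
    show ?thesis
      by (rule that[of "max 1 (max m1 m2)"]) (use m1 m2 in \<open>auto simp: le_max_iff_disj\<close>)
  qed
  \<comment> \<open>The constant collects the errors from replacing \<open>\<phi>\<close> by the truncation (at most \<open>5 \<tau>\<close>) and \<open>g\<close> by \<open>U\<close> (at most \<open>\<tau>\<close>).\<close>
  define C where "C = 5 * (2 * m + 5) + 4 * R\<^sup>2 * (6 * m + 5)"
  have Cpos: "C > 0" unfolding C_def using m(3) by (intro add_pos_nonneg mult_pos_pos mult_nonneg_nonneg) auto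
  let ?V = "measure lborel (square R)"
  have int: "f integrable_on square R" if "continuous_on UNIV f" for f :: "plane \<Rightarrow> real"
    using that by (meson continuous_on_subset integrable_continuous subset_UNIV)
  have orth': "integral (square R) (\<lambda>x. \<phi> x * g x) = 0"
    using orth set_integral_eq_integral_square[of "\<lambda>x. \<phi> x * g x" \<Omega> R] \<phi> g \<Omega>R
      square_mono[of "R - 2" R]
    by (auto intro!: continuous_intros)
  have small: "integral (square R) (\<lambda>x. (\<phi> x)\<^sup>2) \<le> C * \<tau> * ?V" if \<tau>: "0 < \<tau>" "\<tau> \<le> 1" for \<tau>
  proof -
    obtain u u1 u2 u11 u22 where u:
      "has_partial (1, 0) u u1" "has_partial (0, 1) u u2"
      "has_partial (1, 0) u1 u11" "has_partial (0, 1) u2 u22"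
      "continuous_on UNIV u" "continuous_on UNIV u1" "continuous_on UNIV u2"
      "continuous_on UNIV u11" "continuous_on UNIV u22"
      "\<And>x. x \<notin> square (R - 1) \<Longrightarrow> u x = 0"
      "\<And>x. \<bar>u x - \<phi> x\<bar> \<le> \<tau>"
      "\<And>x. \<bar>\<phi> x\<bar> > \<tau> \<Longrightarrow> \<bar>u11 x + u22 x - g x\<bar> \<le> \<tau>"
      using smooth_approximation[OF \<phi> \<Omega>R g weak \<tau>(1)] by metis
    define w where "w = (\<lambda>x. cutoff (2 * \<tau>) (u x))"
    define U where "U = (\<lambda>x. u11 x + u22 x)"
    have cw: "continuous_on UNIV w"
      unfolding w_def using continuous_on_compose2[OF continuous_on_cutoff u(5)] \<tau> by auto
    have cU: "continuous_on UNIV U" unfolding U_def using u by (intro continuous_intros)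
    have energy: "integral (square R) (\<lambda>x. (w x)\<^sup>2 + 4 * R\<^sup>2 * (w x * U x)) \<le> 0"
      unfolding w_def U_def using cutoff_energy[OF _ R u(1-10), of "2 * \<tau>"] \<tau> by simp
    have "integral (square R) (\<lambda>x. (\<phi> x)\<^sup>2 + 4 * R\<^sup>2 * (\<phi> x * g x)) \<le>
        integral (square R) (\<lambda>x. (w x)\<^sup>2 + 4 * R\<^sup>2 * (w x * U x) + C * \<tau>)"
    proof (rule integral_le)
      show "(\<lambda>x. (\<phi> x)\<^sup>2 + 4 * R\<^sup>2 * (\<phi> x * g x)) integrable_on square R"
        "(\<lambda>x. (w x)\<^sup>2 + 4 * R\<^sup>2 * (w x * U x) + C * \<tau>) integrable_on square R"
        using \<phi> g cw cU by (auto intro!: int continuous_intros)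
      fix x assume x: "x \<in> square R"
      have b: "\<bar>\<phi> x\<bar> \<le> m" "\<bar>g x\<bar> \<le> m" using m x by auto
      have wu: "\<bar>w x - u x\<bar> \<le> 4 * \<tau>" using cutoff_close[of "2 * \<tau>" "u x"] \<tau> by (simp add: w_def)
      have w\<phi>: "\<bar>w x - \<phi> x\<bar> \<le> 5 * \<tau>" using wu u(11)[of x] by linarith
      have dich: "w x = 0 \<or> \<bar>U x - g x\<bar> \<le> \<tau>"
      proof (cases "\<bar>\<phi> x\<bar> > \<tau>")
        case True then show ?thesis using u(12) by (simp add: U_def)
      next
        case False
        then have "\<bar>u x\<bar> \<le> 2 * \<tau>" using u(11)[of x] by linarith
        then show ?thesis by (simp add: w_def cutoff_eq_0)
      qed
      have sq: "(\<phi> x)\<^sup>2 - (w x)\<^sup>2 \<le> 5 * \<tau> * (2 * m + 5)"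
      proof -
        have "(\<phi> x)\<^sup>2 - (w x)\<^sup>2 = (\<phi> x - w x) * (\<phi> x + w x)"
          by (simp add: power2_eq_square algebra_simps)
        also have "\<dots> \<le> \<bar>\<phi> x - w x\<bar> * \<bar>\<phi> x + w x\<bar>" by (metis abs_ge_self abs_mult)
        also have "\<dots> \<le> (5 * \<tau>) * (2 * m + 5)" using w\<phi> b \<tau> by (intro mult_mono) auto
        finally show ?thesis .
      qed
      have pr: "\<phi> x * g x - w x * U x \<le> (6 * m + 5) * \<tau>"
      proof -
        have 1: "(\<phi> x - w x) * g x \<le> (5 * \<tau>) * m"
        proof -
          have "(\<phi> x - w x) * g x \<le> \<bar>\<phi> x - w x\<bar> * \<bar>g x\<bar>" by (metis abs_ge_self abs_mult)
          also have "\<dots> \<le> (5 * \<tau>) * m" using w\<phi> b \<tau> by (intro mult_mono) auto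
          finally show ?thesis .
        qed
        have 2: "w x * (g x - U x) \<le> (m + 5) * \<tau>"
        proof (cases "w x = 0")
          case False
          have "w x * (g x - U x) \<le> \<bar>w x\<bar> * \<bar>g x - U x\<bar>" by (metis abs_ge_self abs_mult)
          also have "\<dots> \<le> (m + 5) * \<tau>" using False dich w\<phi> b \<tau> by (intro mult_mono) auto
          finally show ?thesis .
        qed (use m(3) \<tau> in auto)
        have "\<phi> x * g x - w x * U x = (\<phi> x - w x) * g x + w x * (g x - U x)"
          by (simp add: algebra_simps)
        then show ?thesis using 1 2 by (simp add: algebra_simps)
      qed
      have "4 * R\<^sup>2 * (\<phi> x * g x - w x * U x) \<le> 4 * R\<^sup>2 * ((6 * m + 5) * \<tau>)"
        using pr by (intro mult_left_mono) auto
      with sq show "(\<phi> x)\<^sup>2 + 4 * R\<^sup>2 * (\<phi> x * g x) \<le> (w x)\<^sup>2 + 4 * R\<^sup>2 * (w x * U x) + C * \<tau>"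
        unfolding C_def by (simp add: algebra_simps)
    qed
    also have "\<dots> = integral (square R) (\<lambda>x. (w x)\<^sup>2 + 4 * R\<^sup>2 * (w x * U x)) + C * \<tau> * ?V"
      using cw cU by (subst integral_add) (auto intro!: int continuous_intros)
    also have "integral (square R) (\<lambda>x. (\<phi> x)\<^sup>2 + 4 * R\<^sup>2 * (\<phi> x * g x)) =
        integral (square R) (\<lambda>x. (\<phi> x)\<^sup>2) + 4 * R\<^sup>2 * integral (square R) (\<lambda>x. \<phi> x * g x)"
      using \<phi> g by (subst integral_add) (auto intro!: int continuous_intros)
    finally show ?thesis using energy orth' by simp
  qed
  have nonneg: "integral (square R) (\<lambda>x. (\<phi> x)\<^sup>2) \<ge> 0"
    using \<phi> by (intro integral_nonneg int) (auto intro!: continuous_intros)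
  have "integral (square R) (\<lambda>x. (\<phi> x)\<^sup>2) = 0"
  proof (rule ccontr)
    let ?I = "integral (square R) (\<lambda>x. (\<phi> x)\<^sup>2)"
    assume "?I \<noteq> 0"
    then have I: "?I > 0" using nonneg by simp
    define \<tau> where "\<tau> = min 1 (?I / (2 * C * (?V + 1)))"
    have p: "2 * C * (?V + 1) > 0" using Cpos by (intro mult_pos_pos) (auto simp: add_nonneg_pos)
    have t: "0 < \<tau>" "\<tau> \<le> 1" using I p by (auto simp: \<tau>_def)
    have "?I \<le> C * \<tau> * ?V" by (rule small[OF t])
    also have "\<dots> \<le> C * \<tau> * (?V + 1)" using Cpos t by (intro mult_left_mono) auto
    also have "\<dots> \<le> C * (?I / (2 * C * (?V + 1))) * (?V + 1)"
      using Cpos by (intro mult_right_mono mult_left_mono) (auto simp: \<tau>_def)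
    also have "\<dots> = ?I / 2" using Cpos p by (simp add: field_simps)
    finally show False using I by simp
  qed
  then have "\<forall>x\<in>square R. (\<phi> x)\<^sup>2 = 0"
    using integral_cbox_eq_0_iff[of "(- R, - R)" "(R, R)" "\<lambda>x. (\<phi> x)\<^sup>2"] cont(1) box_square_nonempty[of R] R
    by (auto intro!: continuous_intros)
  moreover have "x \<in> square R" if "x \<in> \<Omega>" using that \<Omega>R square_mono[of "R - 2" R] by auto
  ultimately show ?thesis using \<phi>(2) by (cases "x \<in> \<Omega>") auto
qed

section \<open>Weak Laplacians of classical functions and of differences\<close>

lemma partial_eq_0_outside:
  assumes "x \<notin> closure {x. f x \<noteq> 0}"
  shows "partial i f x = 0"
proof -
  have "((\<lambda>_. 0) has_derivative (\<lambda>_. 0)) (at x)" by simp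
  moreover have "open (- closure {x. f x \<noteq> 0})" "x \<in> - closure {x. f x \<noteq> 0}"
    using assms by auto
  moreover have "0 = f y" if "y \<in> - closure {x. f x \<noteq> 0}" for y
    using that closure_subset[of "{x. f x \<noteq> 0}"] by auto
  ultimately have "(f has_derivative (\<lambda>_. 0)) (at x)"
    by (rule has_derivative_transform_within_open)
  from frechet_derivative_at[OF this, symmetric] show ?thesis
    by (simp add: partial_def)
qed

lemma closure_support_partial: "closure {x. partial i f x \<noteq> 0} \<subseteq> closure {x. f x \<noteq> 0}"
  using partial_eq_0_outside by (intro closure_minimal) auto

lemma test_function_partial:
  assumes "test_function \<Omega> \<psi>" "i \<in> Basis"
  shows "test_function \<Omega> (partial i \<psi>)"
  unfolding test_function_def
proof (intro conjI allI)
  show "C_diff n (partial i \<psi>)" for n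
    using assms C_diff.simps(2)[of n \<psi>] unfolding test_function_def by blast
  show "compact (closure {x. partial i \<psi> x \<noteq> 0})"
    using assms closure_support_partial[of i \<psi>] unfolding test_function_def
    by (meson bounded_subset closed_closure compact_eq_bounded_closed)
  show "closure {x. partial i \<psi> x \<noteq> 0} \<subseteq> \<Omega>"
    using assms closure_support_partial[of i \<psi>] unfolding test_function_def by blast
qed

lemma test_function_eq_0: "test_function \<Omega> \<psi> \<Longrightarrow> x \<notin> \<Omega> \<Longrightarrow> \<psi> x = 0"
  unfolding test_function_def using closure_subset[of "{x. \<psi> x \<noteq> 0}"] by blast

lemma test_function_continuous: "test_function \<Omega> \<psi> \<Longrightarrow> continuous_on UNIV \<psi>"
  unfolding test_function_def using C_diff_continuous by blast

lemma test_function_has_partial: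
  "test_function \<Omega> \<psi> \<Longrightarrow> i \<in> Basis \<Longrightarrow> has_partial i \<psi> (partial i \<psi>)"
  unfolding test_function_def using C_diff_Suc_has_partial by blast

text \<open>
  Green's second identity: \<open>P11 \<psi> - P \<psi>11\<close> is the derivative of \<open>P1 \<psi> - P \<psi>1\<close>, which has compact
  support.
\<close>

lemma has_weak_laplacian_classical:
  fixes \<phi> :: "plane \<Rightarrow> real"
  assumes \<Omega>: "bounded \<Omega>"
    and p: "has_partial (1, 0) P P1" "has_partial (1, 0) P1 P11"
      "has_partial (0, 1) P P2" "has_partial (0, 1) P2 P22"
    and c: "continuous_on UNIV P" "continuous_on UNIV P11" "continuous_on UNIV P22"
    and \<phi>: "\<And>x. x \<in> \<Omega> \<Longrightarrow> \<phi> x = P x" and f: "\<And>x. x \<in> \<Omega> \<Longrightarrow> f x = P11 x + P22 x"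
  shows "has_weak_laplacian \<phi> f \<Omega>"
  unfolding has_weak_laplacian_def
proof (intro allI impI)
  fix \<psi> assume \<psi>: "test_function \<Omega> \<psi>"
  obtain r where r: "r > 0" "\<Omega> \<subseteq> square r"
    using bounded_subset_square[OF \<Omega>] .
  define R where "R = r + 1"
  have R: "r < R" "0 < R" "\<Omega> \<subseteq> square R"
    using r square_mono[of r R] by (auto simp: R_def)
  let ?e1 = "(1, 0) :: plane" and ?e2 = "(0, 1) :: plane"
  have B: "?e1 \<in> Basis" "?e2 \<in> Basis" by (auto simp: Basis_plane)
  note t1 = test_function_partial[OF \<psi> B(1)] and t2 = test_function_partial[OF \<psi> B(2)]
  note t11 = test_function_partial[OF t1 B(1)] and t22 = test_function_partial[OF t2 B(2)]
  note ci = continuous_intros c test_function_continuous[OF \<psi>]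
    test_function_continuous[OF t11] test_function_continuous[OF t22]
  have green: "integral (square R) (\<lambda>x. Pe' x * \<psi> x - P x * partial e (partial e \<psi>) x) = 0"
    if e: "e \<in> Basis" and pe: "has_partial e P Pe" "has_partial e Pe Pe'" "continuous_on UNIV Pe'" for e Pe Pe'
  proof (rule integral_partial_eq_0[OF e _ _ _ R(1,2)])
    note te = test_function_partial[OF \<psi> e]
    note tee = test_function_partial[OF te e]
    have "has_partial e (\<lambda>x. Pe x * \<psi> x - P x * partial e \<psi> x)
      (\<lambda>x. (Pe' x * \<psi> x + Pe x * partial e \<psi> x) -
        (Pe x * partial e \<psi> x + P x * partial e (partial e \<psi>) x))"
      by (intro has_partial_diff has_partial_mult pe test_function_has_partial[OF \<psi> e]
          test_function_has_partial[OF te e])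
    then show "has_partial e (\<lambda>x. Pe x * \<psi> x - P x * partial e \<psi> x)
      (\<lambda>x. Pe' x * \<psi> x - P x * partial e (partial e \<psi>) x)"
      by (simp add: algebra_simps)
    show "continuous_on UNIV (\<lambda>x. Pe' x * \<psi> x - P x * partial e (partial e \<psi>) x)"
      by (intro continuous_intros c pe test_function_continuous[OF \<psi>] test_function_continuous[OF tee])
    show "Pe x * \<psi> x - P x * partial e \<psi> x = 0" if "x \<notin> square r" for x
    proof -
      have "x \<notin> \<Omega>" using that r by blast
      then show ?thesis using test_function_eq_0[OF \<psi>, of x] test_function_eq_0[OF te, of x] by simp
    qed
  qed
  have int: "h integrable_on square R" if "continuous_on UNIV h" for h :: "plane \<Rightarrow> real"
    using that by (meson continuous_on_subset integrable_continuous subset_UNIV)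
  let ?\<psi>1 = "partial ?e1 (partial ?e1 \<psi>)" and ?\<psi>2 = "partial ?e2 (partial ?e2 \<psi>)"
  have cont: "continuous_on UNIV (\<lambda>x. (P11 x + P22 x) * \<psi> x)" "continuous_on UNIV (\<lambda>x. P x * (?\<psi>1 x + ?\<psi>2 x))"
    "continuous_on UNIV (\<lambda>x. P11 x * \<psi> x - P x * ?\<psi>1 x)" "continuous_on UNIV (\<lambda>x. P22 x * \<psi> x - P x * ?\<psi>2 x)"
    by (intro ci)+
  have "integral (square R) (\<lambda>x. (P11 x + P22 x) * \<psi> x) - integral (square R) (\<lambda>x. P x * (?\<psi>1 x + ?\<psi>2 x)) =
      integral (square R) (\<lambda>x. (P11 x + P22 x) * \<psi> x - P x * (?\<psi>1 x + ?\<psi>2 x))"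
    by (rule integral_diff[symmetric, OF int[OF cont(1)] int[OF cont(2)]])
  also have "\<dots> = integral (square R) (\<lambda>x. (P11 x * \<psi> x - P x * ?\<psi>1 x) + (P22 x * \<psi> x - P x * ?\<psi>2 x))"
    by (rule arg_cong[where f = "integral (square R)"]) (simp add: fun_eq_iff algebra_simps)
  also have "\<dots> = 0"
    unfolding integral_add[OF int[OF cont(3)] int[OF cont(4)]]
      green[OF B(1) p(1,2) c(2)] green[OF B(2) p(3,4) c(3)] by simp
  finally have eq: "integral (square R) (\<lambda>x. P x * (?\<psi>1 x + ?\<psi>2 x)) =
    integral (square R) (\<lambda>x. (P11 x + P22 x) * \<psi> x)" by simp
  have "(LINT x:\<Omega>|lborel. \<phi> x * laplacian \<psi> x) = (LINT x:\<Omega>|lborel. P x * laplacian \<psi> x)"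
    unfolding set_lebesgue_integral_def
    by (rule Bochner_Integration.integral_cong) (auto simp: indicator_def \<phi>)
  also have "\<dots> = integral (square R) (\<lambda>x. P x * (?\<psi>1 x + ?\<psi>2 x))"
    unfolding laplacian_plane
    by (rule set_integral_eq_integral_square[OF cont(2) _ R(3)])
      (simp add: test_function_eq_0[OF t11] test_function_eq_0[OF t22])
  also have "\<dots> = (LINT x:\<Omega>|lborel. (P11 x + P22 x) * \<psi> x)"
    unfolding eq
    by (rule set_integral_eq_integral_square[OF cont(1) _ R(3), symmetric])
      (simp add: test_function_eq_0[OF \<psi>])
  also have "\<dots> = (LINT x:\<Omega>|lborel. f x * \<psi> x)"
    unfolding set_lebesgue_integral_def
    by (rule Bochner_Integration.integral_cong) (auto simp: indicator_def f)
  finally show "(LINT x:\<Omega>|lborel. \<phi> x * laplacian \<psi> x) = (LINT x:\<Omega>|lborel. f x * \<psi> x)" .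
qed

lemma set_integrable_compact_continuous:
  fixes h :: "'a::euclidean_space \<Rightarrow> real"
  assumes "compact E" "continuous_on E h"
  shows "set_integrable lborel E h"
  unfolding set_integrable_def by (rule borel_integrable_compact[OF assms])

lemma has_weak_laplacian_diff:
  fixes \<phi>1 \<phi>2 :: "plane \<Rightarrow> real"
  assumes E: "compact E" "\<Omega> \<subseteq> E" "open \<Omega>"
    and c: "continuous_on E \<phi>1" "continuous_on E \<phi>2" "continuous_on E f1" "continuous_on E f2"
    and weak: "has_weak_laplacian \<phi>1 f1 \<Omega>" "has_weak_laplacian \<phi>2 f2 \<Omega>"
  shows "has_weak_laplacian (\<lambda>x. \<phi>1 x - \<phi>2 x) (\<lambda>x. f1 x - f2 x) \<Omega>"
  unfolding has_weak_laplacian_def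
proof (intro allI impI)
  fix \<psi> assume \<psi>: "test_function \<Omega> \<psi>"
  have B: "(1, 0) \<in> (Basis :: plane set)" "(0, 1) \<in> (Basis :: plane set)" by (auto simp: Basis_plane)
  note t11 = test_function_partial[OF test_function_partial[OF \<psi> B(1)] B(1)]
  note t22 = test_function_partial[OF test_function_partial[OF \<psi> B(2)] B(2)]
  have cl: "continuous_on UNIV (laplacian \<psi>)"
    unfolding laplacian_plane[abs_def]
    by (intro continuous_intros test_function_continuous[OF t11] test_function_continuous[OF t22])
  have int: "set_integrable lborel \<Omega> (\<lambda>x. h x * k x)"
    if "continuous_on E h" "continuous_on UNIV k" for h k :: "plane \<Rightarrow> real"
  proof (rule set_integrable_subset)
    show "set_integrable lborel E (\<lambda>x. h x * k x)"
      using that by (intro set_integrable_compact_continuous E continuous_intros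
          continuous_on_subset[OF that(2) subset_UNIV])
  qed (use E in auto)
  have "(LINT x:\<Omega>|lborel. (\<phi>1 x - \<phi>2 x) * laplacian \<psi> x) =
      (LINT x:\<Omega>|lborel. \<phi>1 x * laplacian \<psi> x) - (LINT x:\<Omega>|lborel. \<phi>2 x * laplacian \<psi> x)"
    unfolding left_diff_distrib by (rule set_integral_diff(2)[OF int[OF c(1) cl] int[OF c(2) cl]])
  moreover have "(LINT x:\<Omega>|lborel. (f1 x - f2 x) * \<psi> x) =
      (LINT x:\<Omega>|lborel. f1 x * \<psi> x) - (LINT x:\<Omega>|lborel. f2 x * \<psi> x)"
    unfolding left_diff_distrib
    by (rule set_integral_diff(2)[OF int[OF c(3)] int[OF c(4)]]) (rule test_function_continuous[OF \<psi>])+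
  ultimately show "(LINT x:\<Omega>|lborel. (\<phi>1 x - \<phi>2 x) * laplacian \<psi> x) =
      (LINT x:\<Omega>|lborel. (f1 x - f2 x) * \<psi> x)"
    using weak \<psi> unfolding has_weak_laplacian_def by simp
qed

section \<open>Polynomials in two variables\<close>

definition degs :: "int \<Rightarrow> (nat \<times> nat) set" where
  "degs d = {p. int (fst p + snd p) \<le> d}"

definition mono2 :: "nat \<times> nat \<Rightarrow> plane \<Rightarrow> real" where
  "mono2 p z = fst z ^ fst p * snd z ^ snd p"

text \<open>
  Polynomials on the whole plane. Algebra is easier here than with the functions in \<^const>\<open>poly_plane\<close>,
  which are cut off outside their domain.
\<close>

definition poly2 :: "int \<Rightarrow> (plane \<Rightarrow> real) set" where
  "poly2 d = {(\<lambda>z. \<Sum>p\<in>degs d. c p * mono2 p z) | c. True}"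

lemma finite_degs: "finite (degs d)"
  by (rule finite_subset[of _ "{..nat d} \<times> {..nat d}"]) (auto simp: degs_def)

lemma poly_plane_eq: "poly_plane d E = restr0 E ` poly2 d"
proof -
  have eq: "(\<lambda>(x, y). \<Sum>(i, j) \<in> {(i, j). int (i + j) \<le> d}. c i j * x ^ i * y ^ j) =
      (\<lambda>z. \<Sum>p\<in>degs d. (case_prod c) p * mono2 p z)" for c :: "nat \<Rightarrow> nat \<Rightarrow> real"
    by (auto simp: degs_def mono2_def case_prod_unfold fun_eq_iff mult.assoc intro!: sum.cong)
  show ?thesis
  proof
    show "poly_plane d E \<subseteq> restr0 E ` poly2 d"
      unfolding poly_plane_def eq poly2_def by blast
    show "restr0 E ` poly2 d \<subseteq> poly_plane d E"
    proof
      fix f assume "f \<in> restr0 E ` poly2 d"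
      then obtain c where "f = restr0 E (\<lambda>z. \<Sum>p\<in>degs d. c p * mono2 p z)"
        unfolding poly2_def by blast
      then have "f = restr0 E (\<lambda>z. \<Sum>p\<in>degs d. (case_prod (curry c)) p * mono2 p z)" by simp
      then show "f \<in> poly_plane d E"
        unfolding poly_plane_def eq by blast
    qed
  qed
qed

lemma poly2_add: "f \<in> poly2 d \<Longrightarrow> g \<in> poly2 d \<Longrightarrow> (\<lambda>z. f z + g z) \<in> poly2 d"
proof -
  assume "f \<in> poly2 d" "g \<in> poly2 d"
  then obtain a b where "f = (\<lambda>z. \<Sum>p\<in>degs d. a p * mono2 p z)" "g = (\<lambda>z. \<Sum>p\<in>degs d. b p * mono2 p z)"
    unfolding poly2_def by blast
  then have "(\<lambda>z. f z + g z) = (\<lambda>z. \<Sum>p\<in>degs d. (a p + b p) * mono2 p z)"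
    by (simp add: sum.distrib algebra_simps)
  then show ?thesis unfolding poly2_def mem_Collect_eq by metis
qed

lemma poly2_scale: "f \<in> poly2 d \<Longrightarrow> (\<lambda>z. r * f z) \<in> poly2 d"
proof -
  assume "f \<in> poly2 d"
  then obtain a where "f = (\<lambda>z. \<Sum>p\<in>degs d. a p * mono2 p z)"
    unfolding poly2_def by blast
  then have "(\<lambda>z. r * f z) = (\<lambda>z. \<Sum>p\<in>degs d. (r * a p) * mono2 p z)"
    by (simp add: sum_distrib_left algebra_simps)
  then show ?thesis unfolding poly2_def mem_Collect_eq by metis
qed

lemma poly2_zero: "(\<lambda>z. 0) \<in> poly2 d"
  unfolding poly2_def mem_Collect_eq by (rule exI[of _ "\<lambda>_. 0"]) simp

lemma poly2_mono2:
  assumes "p \<in> degs d"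
  shows "mono2 p \<in> poly2 d"
proof -
  have "mono2 p = (\<lambda>z. \<Sum>q\<in>degs d. (if q = p then 1 else 0) * mono2 q z)"
  proof
    fix z
    have "(\<Sum>q\<in>degs d. (if q = p then 1 else 0) * mono2 q z) = (\<Sum>q\<in>degs d. (if q = p then mono2 q z else 0))"
      by (rule sum.cong) auto
    then show "mono2 p z = (\<Sum>q\<in>degs d. (if q = p then 1 else 0) * mono2 q z)"
      using assms finite_degs by simp
  qed
  then show ?thesis unfolding poly2_def mem_Collect_eq by (intro exI[of _ "\<lambda>q. if q = p then 1 else 0"] conjI TrueI)
qed

lemma poly2_sum: "(\<And>i. i \<in> I \<Longrightarrow> f i \<in> poly2 d) \<Longrightarrow> (\<lambda>z. \<Sum>i\<in>I. f i z) \<in> poly2 d"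
  by (induction I rule: infinite_finite_induct) (auto intro: poly2_zero poly2_add)

lemma poly2_induct [consumes 1, case_names zero add mono2]:
  assumes f: "f \<in> poly2 d"
    and zero: "P (\<lambda>z. 0)" and add: "\<And>g h. P g \<Longrightarrow> P h \<Longrightarrow> P (\<lambda>z. g z + h z)"
    and mono2: "\<And>c i j. int (i + j) \<le> d \<Longrightarrow> P (\<lambda>z. c * (fst z ^ i * snd z ^ j))"
  shows "P f"
proof -
  obtain c where c: "f = (\<lambda>z. \<Sum>p\<in>degs d. c p * mono2 p z)"
    using f unfolding poly2_def by blast
  have "P (\<lambda>z. \<Sum>p\<in>A. c p * mono2 p z)" if "A \<subseteq> degs d" for A
    using finite_subset[OF that finite_degs] that
  proof (induction A rule: finite_induct)
    case (insert p A)
    have "P (\<lambda>z. c p * mono2 p z + (\<Sum>p\<in>A. c p * mono2 p z))"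
      using insert mono2[of "fst p" "snd p" "c p"] by (intro add) (auto simp: mono2_def degs_def)
    then show ?case using insert by simp
  qed (simp add: zero)
  then show ?thesis using c by simp
qed

lemma poly2_degree_mono:
  assumes "f \<in> poly2 d" "d \<le> e"
  shows "f \<in> poly2 e"
  using assms(1)
proof (induction rule: poly2_induct)
  case (mono2 c i j)
  have "(i, j) \<in> degs e" using mono2 assms(2) by (simp add: degs_def)
  from poly2_scale[OF poly2_mono2[OF this], of c] show ?case by (simp add: mono2_def)
qed (auto intro: poly2_zero poly2_add)

lemma poly2_mult:
  assumes f: "f \<in> poly2 d" and g: "g \<in> poly2 e"
  shows "(\<lambda>z. f z * g z) \<in> poly2 (d + e)"
  using f
proof (induction rule: poly2_induct)
  case (add a b)
  then show ?case using poly2_add by (simp add: distrib_right)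
next
  case (mono2 c i j)
  note ij = mono2
  from g show ?case
  proof (induction rule: poly2_induct)
    case (add a b)
    then show ?case using poly2_add by (simp add: distrib_left)
  next
    case (mono2 c' i' j')
    have "(i + i', j + j') \<in> degs (d + e)" using mono2 ij by (simp add: degs_def)
    from poly2_scale[OF poly2_mono2[OF this], of "c * c'"] show ?case
      by (simp add: mono2_def power_add algebra_simps)
  qed (simp add: poly2_zero)
qed (simp add: poly2_zero)

lemma poly2_const: "d \<ge> 0 \<Longrightarrow> (\<lambda>z. c) \<in> poly2 d"
  using poly2_scale[OF poly2_mono2[of "(0, 0)" d], of c] by (simp add: degs_def mono2_def)

lemma poly2_fst: "d \<ge> 1 \<Longrightarrow> fst \<in> poly2 d" and poly2_snd: "d \<ge> 1 \<Longrightarrow> snd \<in> poly2 d"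
  using poly2_mono2[of "(1, 0)" d] poly2_mono2[of "(0, 1)" d]
  by (simp_all add: degs_def mono2_def[abs_def])

lemma poly2_power: "f \<in> poly2 1 \<Longrightarrow> (\<lambda>z. f z ^ n) \<in> poly2 (int n)"
proof (induction n)
  case (Suc n)
  then show ?case using poly2_mult[of f 1 "\<lambda>z. f z ^ n" "int n"] by simp
qed (simp add: poly2_const)

lemma poly2_compose:
  assumes L: "L \<in> poly2 1" "M \<in> poly2 1" and f: "f \<in> poly2 d"
  shows "(\<lambda>z. f (L z, M z)) \<in> poly2 d"
  using f
proof (induction rule: poly2_induct)
  case (mono2 c i j)
  have "(\<lambda>z. c * (L z ^ i * M z ^ j)) \<in> poly2 (int i + int j)"
    by (intro poly2_scale poly2_mult poly2_power L)
  then show ?case using mono2 by (auto elim: poly2_degree_mono)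
qed (auto intro: poly2_zero poly2_add)

lemma poly2_continuous: "f \<in> poly2 d \<Longrightarrow> continuous_on UNIV f"
  unfolding poly2_def mono2_def by (auto intro!: continuous_intros)

lemma poly2_has_partial:
  assumes "f \<in> poly2 d"
  shows "\<exists>g \<in> poly2 d. has_partial (1, 0) f g" "\<exists>g \<in> poly2 d. has_partial (0, 1) f g"
proof -
  have mon: "(\<lambda>z. c * mono2 (i, j) z) \<in> poly2 d" if "int (i + j) \<le> d" for c i j
    using poly2_scale[OF poly2_mono2[of "(i, j)" d], of c] that by (simp add: degs_def)
  show "\<exists>g \<in> poly2 d. has_partial (1, 0) f g"
    using assms
  proof (induction rule: poly2_induct)
    case zero
    show ?case by (rule bexI[OF _ poly2_zero]) (simp add: has_partial_def)
  next
    case (add g h)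
    then obtain g' h' where "g' \<in> poly2 d" "h' \<in> poly2 d" "has_partial (1, 0) g g'" "has_partial (1, 0) h h'"
      by blast
    then show ?case by (intro bexI[of _ "\<lambda>z. g' z + h' z"] has_partial_add poly2_add)
  next
    case (mono2 c i j)
    have "has_partial (1, 0) (\<lambda>z. c * (fst z ^ i * snd z ^ j)) (\<lambda>z. (c * of_nat i) * mono2 (i - 1, j) z)"
      unfolding has_partial_def mono2_def by (auto intro!: derivative_eq_intros)
    moreover have "int (i - 1 + j) \<le> d" using mono2 by linarith
    ultimately show ?case by (intro bexI[OF _ mon])
  qed
  show "\<exists>g \<in> poly2 d. has_partial (0, 1) f g"
    using assms
  proof (induction rule: poly2_induct)
    case zero
    show ?case by (rule bexI[OF _ poly2_zero]) (simp add: has_partial_def)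
  next
    case (add g h)
    then obtain g' h' where "g' \<in> poly2 d" "h' \<in> poly2 d" "has_partial (0, 1) g g'" "has_partial (0, 1) h h'"
      by blast
    then show ?case by (intro bexI[of _ "\<lambda>z. g' z + h' z"] has_partial_add poly2_add)
  next
    case (mono2 c i j)
    have "has_partial (0, 1) (\<lambda>z. c * (fst z ^ i * snd z ^ j)) (\<lambda>z. (c * of_nat j) * mono2 (i, j - 1) z)"
      unfolding has_partial_def mono2_def by (auto intro!: derivative_eq_intros)
    moreover have "int (i + (j - 1)) \<le> d" using mono2 by linarith
    ultimately show ?case by (intro bexI[OF _ mon])
  qed
qed

lemma poly2_linepath:
  assumes "f \<in> poly2 d"
  shows "\<exists>p :: real poly. (p = 0 \<or> int (degree p) \<le> d) \<and> (\<forall>t. f (linepath a b t) = poly p t)"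
  using assms
proof (induction rule: poly2_induct)
  case zero
  show ?case by (rule exI[of _ 0]) simp
next
  case (add g h)
  then obtain p q where pq: "p = 0 \<or> int (degree p) \<le> d" "\<forall>t. g (linepath a b t) = poly p t"
    "q = 0 \<or> int (degree q) \<le> d" "\<forall>t. h (linepath a b t) = poly q t" by blast
  have "p + q = 0 \<or> int (degree (p + q)) \<le> d"
  proof (cases "p = 0 \<or> q = 0")
    case False
    then show ?thesis using pq degree_add_le_max[of p q] by (auto simp: max_def split: if_splits)
  qed (use pq in auto)
  then show ?case using pq by (intro exI[of _ "p + q"]) auto
next
  case (mono2 c i j)
  let ?x = "[:fst a, fst b - fst a:]" and ?y = "[:snd a, snd b - snd a:]"
  have "degree (smult c (?x ^ i * ?y ^ j)) \<le> degree (?x ^ i) + degree (?y ^ j)"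
    using degree_smult_le degree_mult_le order_trans by blast
  also have "degree (?x ^ i) \<le> i"
    using degree_power_le[of ?x i] by (auto split: if_splits)
  also have "degree (?y ^ j) \<le> j"
    using degree_power_le[of ?y j] by (auto split: if_splits)
  finally have "int (degree (smult c (?x ^ i * ?y ^ j))) \<le> d" using mono2 by simp
  then show ?case
    by (intro exI[of _ "smult c (?x ^ i * ?y ^ j)"])
      (simp add: linepath_def algebra_simps)
qed

lemma poly_eq_0_on_interval:
  fixes p :: "real poly"
  assumes "a < b" "\<And>t. a < t \<Longrightarrow> t < b \<Longrightarrow> poly p t = 0"
  shows "p = 0"
proof (rule ccontr)
  assume "p \<noteq> 0"
  then have "finite {t. poly p t = 0}" by (rule poly_roots_finite)
  moreover have "{a<..<b} \<subseteq> {t. poly p t = 0}" using assms by auto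
  ultimately show False using assms(1) infinite_Ioo finite_subset by blast
qed

text \<open>
  An open set contains a box. For fixed \<open>x\<close> in its first side the polynomial in \<open>y\<close> has infinitely many
  zeros, so its coefficients vanish; these are polynomials in \<open>x\<close> with infinitely many zeros.
\<close>

lemma poly2_coeffs_eq_0:
  assumes "open U" "U \<noteq> {}" and zero: "\<And>z. z \<in> U \<Longrightarrow> (\<Sum>p\<in>degs d. c p * mono2 p z) = 0" and p: "p \<in> degs d"
  shows "c p = 0"
proof -
  obtain x0 y0 where U: "(x0, y0) \<in> U" using assms(2) by auto
  obtain A B where AB: "open A" "open B" "x0 \<in> A" "y0 \<in> B" "A \<times> B \<subseteq> U"
    using open_prod_elim[OF assms(1) U] by (metis mem_Sigma_iff)
  obtain r where r: "r > 0" "ball x0 r \<subseteq> A" using AB open_contains_ball by blast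
  obtain s where s: "s > 0" "ball y0 s \<subseteq> B" using AB open_contains_ball by blast
  have in_U: "(x, y) \<in> U" if "x0 - r < x" "x < x0 + r" "y0 - s < y" "y < y0 + s" for x y
  proof -
    have "x \<in> ball x0 r" "y \<in> ball y0 s" using that by (auto simp: dist_real_def)
    then show ?thesis using AB r s by blast
  qed
  have row: "(\<Sum>q\<in>degs d. if snd q = j then c q * x ^ fst q else 0) = 0" if x: "x0 - r < x" "x < x0 + r" for x j
  proof -
    let ?P = "\<Sum>q\<in>degs d. monom (c q * x ^ fst q) (snd q)"
    have "?P = 0"
    proof (rule poly_eq_0_on_interval)
      show "y0 - s < y0 + s" using s by simp
      fix y assume "y0 - s < y" "y < y0 + s"
      then show "poly ?P y = 0"
        using zero[OF in_U[OF x, of y]] by (simp add: poly_sum poly_monom mono2_def mult.assoc)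
    qed
    then have "coeff ?P j = 0" by simp
    then show ?thesis by (simp add: coeff_sum)
  qed
  let ?P = "\<Sum>q\<in>degs d. monom (if snd q = snd p then c q else 0) (fst q)"
  have "?P = 0"
  proof (rule poly_eq_0_on_interval)
    show "x0 - r < x0 + r" using r by simp
    fix x assume x: "x0 - r < x" "x < x0 + r"
    have "poly ?P x = (\<Sum>q\<in>degs d. if snd q = snd p then c q * x ^ fst q else 0)"
      unfolding poly_sum poly_monom by (rule sum.cong) auto
    then show "poly ?P x = 0" using row[OF x] by simp
  qed
  then have "coeff ?P (fst p) = 0" by simp
  moreover have "coeff ?P (fst p) = (\<Sum>q\<in>degs d. if q = p then c q else 0)"
    unfolding coeff_sum coeff_monom by (rule sum.cong) (auto simp: prod_eq_iff)
  ultimately have "(\<Sum>q\<in>degs d. if q = p then c q else 0) = 0" by simp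
  then show ?thesis using p finite_degs by simp
qed

text \<open>
  The affine form that vanishes on the line through \<open>p\<close> and \<open>q\<close>; as a number, twice the signed area of
  the triangle with vertices \<open>p\<close>, \<open>q\<close>, \<open>z\<close>.
\<close>

definition cross2 :: "plane \<Rightarrow> plane \<Rightarrow> plane \<Rightarrow> real" where
  "cross2 p q z = (fst q - fst p) * (snd z - snd p) - (snd q - snd p) * (fst z - fst p)"

lemma poly2_affine: "(\<lambda>z. \<alpha> + \<beta> * fst z + \<gamma> * snd z) \<in> poly2 1"
  by (intro poly2_add poly2_const poly2_scale poly2_fst poly2_snd) auto

text \<open>
  In orthogonal coordinates \<open>s\<close>, \<open>t\<close> adapted to the line, where the line is \<open>t = 0\<close>, the coefficients of
  the pure powers of \<open>s\<close> vanish. Hence every remaining monomial is divisible by \<open>t\<close>, and \<open>t\<close> is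
  \<open>cross2 p q\<close> up to a constant.
\<close>

lemma poly2_divide_by_line:
  assumes pq: "p \<noteq> q" and f: "f \<in> poly2 d" and zero: "\<And>t. 0 < t \<Longrightarrow> t < 1 \<Longrightarrow> f (linepath p q t) = 0"
  shows "\<exists>g \<in> poly2 (d - 1). \<forall>z. f z = cross2 p q z * g z"
proof -
  define v1 where "v1 = fst q - fst p"
  define v2 where "v2 = snd q - snd p"
  \<comment> \<open>\<open>(X, Y)\<close> maps adapted coordinates to the plane, and \<open>(S, T)\<close> is its inverse.\<close>
  define N where "N = v1\<^sup>2 + v2\<^sup>2"
  have N: "N \<noteq> 0" using pq by (auto simp: N_def v1_def v2_def sum_power2_eq_zero_iff prod_eq_iff)
  define X where "X = (\<lambda>z :: plane. fst p + v1 * fst z + (- v2) * snd z)"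
  define Y where "Y = (\<lambda>z :: plane. snd p + v2 * fst z + v1 * snd z)"
  define S where "S = (\<lambda>z :: plane. - (v1 * fst p + v2 * snd p) / N + v1 / N * fst z + v2 / N * snd z)"
  define T where "T = (\<lambda>z :: plane. (v2 * fst p - v1 * snd p) / N + (- v2 / N) * fst z + v1 / N * snd z)"
  have XYST: "X (S z, T z) = fst z" "Y (S z, T z) = snd z" for z
  proof -
    have "N * X (S z, T z) = N * fst z"
      using N unfolding X_def S_def T_def fst_conv snd_conv by (simp add: field_simps) (simp add: N_def algebra_simps power2_eq_square)
    moreover have "N * Y (S z, T z) = N * snd z"
      using N unfolding Y_def S_def T_def fst_conv snd_conv by (simp add: field_simps) (simp add: N_def algebra_simps power2_eq_square)
    ultimately show "X (S z, T z) = fst z" "Y (S z, T z) = snd z" using N by simp_all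
  qed
  have T: "T z = cross2 p q z / N" for z
    using N by (simp add: T_def cross2_def v1_def v2_def field_simps)
  have "(\<lambda>z. f (X z, Y z)) \<in> poly2 d"
    unfolding X_def Y_def by (rule poly2_compose[OF poly2_affine poly2_affine f])
  then obtain c where c: "(\<lambda>z. f (X z, Y z)) = (\<lambda>z. \<Sum>p\<in>degs d. c p * mono2 p z)"
    unfolding poly2_def by blast
  then have fc: "f (X z, Y z) = (\<Sum>p\<in>degs d. c p * mono2 p z)" for z by meson
  let ?P = "\<Sum>p\<in>degs d. monom (if snd p = 0 then c p else 0) (fst p)"
  have P: "poly ?P s = f (X (s, 0), Y (s, 0))" for s
    unfolding fc poly_sum poly_monom by (rule sum.cong) (auto simp: mono2_def)
  have "?P = 0"
  proof (rule poly_eq_0_on_interval)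
    show "(0::real) < 1" by simp
    fix s :: real assume s: "0 < s" "s < 1"
    have "(X (s, 0), Y (s, 0)) = linepath p q s"
      by (simp add: X_def Y_def v1_def v2_def linepath_def prod_eq_iff algebra_simps)
    then show "poly ?P s = 0" using zero[OF s] P by simp
  qed
  have c0: "c (i, 0) = 0" if "(i, 0) \<in> degs d" for i
  proof -
    have "coeff ?P i = 0" using \<open>?P = 0\<close> by simp
    moreover have "coeff ?P i = (\<Sum>p\<in>degs d. if p = (i, 0) then c p else 0)"
      unfolding coeff_sum coeff_monom by (rule sum.cong) auto
    ultimately show ?thesis using that finite_degs by simp
  qed
  define k where "k = (\<lambda>z. \<Sum>p\<in>degs d. if snd p = 0 then 0 else c p * mono2 (fst p, snd p - 1) z)"
  have k: "k \<in> poly2 (d - 1)"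
    unfolding k_def
  proof (rule poly2_sum)
    fix p assume "p \<in> degs d"
    then have "snd p \<noteq> 0 \<Longrightarrow> (fst p, snd p - 1) \<in> degs (d - 1)" by (auto simp: degs_def)
    then show "(\<lambda>z. if snd p = 0 then 0 else c p * mono2 (fst p, snd p - 1) z) \<in> poly2 (d - 1)"
      using poly2_zero poly2_scale[OF poly2_mono2] by (cases "snd p = 0") auto
  qed
  have fk: "f (X z, Y z) = snd z * k z" for z
  proof -
    have "c p * mono2 p z = snd z * (if snd p = 0 then 0 else c p * mono2 (fst p, snd p - 1) z)"
      if "p \<in> degs d" for p
    proof (cases "snd p = 0")
      case True
      then show ?thesis using c0[of "fst p"] that by (metis mult_zero_left mult_zero_right prod.collapse)
    next
      case False
      then have "snd z ^ snd p = snd z * snd z ^ (snd p - 1)" by (metis not_gr_zero power_minus_mult mult.commute)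
      then show ?thesis using False by (simp add: mono2_def)
    qed
    then show ?thesis unfolding fc k_def sum_distrib_left by (intro sum.cong) auto
  qed
  show ?thesis
  proof (intro bexI allI)
    have "(\<lambda>z. k (S z, T z)) \<in> poly2 (d - 1)"
      unfolding S_def T_def by (rule poly2_compose[OF poly2_affine poly2_affine k])
    from poly2_scale[OF this, of "1 / N"]
    show "(\<lambda>z. 1 / N * k (S z, T z)) \<in> poly2 (d - 1)" .
    fix z
    have "f z = f (X (S z, T z), Y (S z, T z))" unfolding XYST by simp
    also have "\<dots> = T z * k (S z, T z)" unfolding fk by simp
    finally show "f z = cross2 p q z * (1 / N * k (S z, T z))" unfolding T by simp
  qed
qed

section \<open>Counting dimensions\<close>

text \<open>
  There are \<open>d + 1\<close> monomials of exact degree \<open>d\<close>. The case \<open>d = - 1\<close> is included so that three steps down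
  from any \<open>k \<ge> 1\<close> are covered.
\<close>

lemma card_degs_step:
  assumes "d \<ge> -1"
  shows "card (degs d) = card (degs (d - 1)) + nat (d + 1)"
proof -
  let ?D = "(\<lambda>i. (i, nat d - i)) ` {..<nat (d + 1)}"
  have total: "int i + int (nat d - i) = d" if "i < nat (d + 1)" for i
    using that by linarith
  have "degs d = degs (d - 1) \<union> ?D"
  proof (intro equalityI subsetI)
    fix p assume "p \<in> degs d"
    then have h: "int (fst p + snd p) \<le> d" by (simp add: degs_def)
    show "p \<in> degs (d - 1) \<union> ?D"
    proof (cases "int (fst p + snd p) \<le> d - 1")
      case False
      then have e: "int (fst p + snd p) = d" using h by simp
      then have "p = (fst p, nat d - fst p)" "fst p < nat (d + 1)" by (auto simp: prod_eq_iff)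
      then show ?thesis by blast
    qed (simp add: degs_def)
  next
    fix p assume "p \<in> degs (d - 1) \<union> ?D"
    then show "p \<in> degs d" using total by (force simp: degs_def)
  qed
  moreover have "degs (d - 1) \<inter> ?D = {}" using total by (force simp: degs_def)
  moreover have "card ?D = nat (d + 1)" by (subst card_image) (auto simp: inj_on_def)
  ultimately show ?thesis using finite_degs by (simp add: card_Un_disjoint)
qed

lemma card_degs_three_steps:
  assumes "k \<ge> 1"
  shows "card (degs (int k)) = 3 * k + card (degs (int k - 3))"
  using card_degs_step[of "int k"] card_degs_step[of "int k - 1"] card_degs_step[of "int k - 2"] assms
  by (simp add: algebra_simps)

lemma sum_fun_apply: "(\<Sum>i\<in>I. f i) x = (\<Sum>i\<in>I. f i x)"
  by (induction I rule: infinite_finite_induct) auto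

text \<open>
  Independence of an indexed family, which includes that its members are distinct.
\<close>

definition lin_indep_family :: "'i set \<Rightarrow> ('i \<Rightarrow> 'a \<Rightarrow> real) \<Rightarrow> bool" where
  "lin_indep_family I m \<longleftrightarrow> (\<forall>c. (\<forall>x. (\<Sum>i\<in>I. c i * m i x) = 0) \<longrightarrow> (\<forall>i\<in>I. c i = 0))"

lemma basis_from_family:
  fixes m :: "'i \<Rightarrow> 'a \<Rightarrow> real"
  assumes I: "finite I" and indep: "lin_indep_family I m"
  shows "inj_on m I" "is_basis (m ` I) {(\<lambda>x. \<Sum>i\<in>I. c i * m i x) | c. True}"
proof -
  show inj: "inj_on m I"
  proof (rule inj_onI, rule ccontr)
    fix i j assume ij: "i \<in> I" "j \<in> I" "m i = m j" "i \<noteq> j"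
    define c where "c = (\<lambda>l. (if l = i then 1 else 0) - (if l = j then 1 else 0 :: real))"
    have "(\<Sum>l\<in>I. c l * m l x) = 0" for x
    proof -
      have "(\<Sum>l\<in>I. c l * m l x) = (\<Sum>l\<in>I. if l = i then m l x else 0) - (\<Sum>l\<in>I. if l = j then m l x else 0)"
        unfolding sum_subtractf[symmetric] by (rule sum.cong) (auto simp: c_def)
      then show ?thesis using ij I by simp
    qed
    then have "c i = 0" using indep ij(1) unfolding lin_indep_family_def by blast
    then show False using ij(4) by (simp add: c_def)
  qed
  have "fun_space.independent (m ` I)"
    unfolding fun_space.dependent_finite[OF finite_imageI[OF I]]
  proof safe
    fix u i assume 0: "(\<Sum>v\<in>m ` I. fun_scale (u v) v) = 0" and i: "i \<in> I" "u (m i) \<noteq> 0"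
    have "(\<Sum>j\<in>I. u (m j) * m j x) = 0" for x
    proof -
      have "(\<Sum>v\<in>m ` I. fun_scale (u v) v) x = 0" using 0 by simp
      then show ?thesis
        unfolding sum_fun_apply sum.reindex[OF inj] by (simp add: fun_scale_def)
    qed
    then have "u (m i) = 0"
      using indep[unfolded lin_indep_family_def, rule_format, of "\<lambda>j. u (m j)" i] i(1) by blast
    then show False using i by simp
  qed
  moreover have "fun_space.span (m ` I) = {(\<lambda>x. \<Sum>i\<in>I. c i * m i x) | c. True}"
  proof -
    have e: "(\<Sum>v\<in>m ` I. fun_scale (u v) v) = (\<lambda>x. \<Sum>i\<in>I. u (m i) * m i x)" for u
      unfolding fun_eq_iff sum_fun_apply sum.reindex[OF inj] by (simp add: fun_scale_def)
    have "(\<lambda>x. \<Sum>i\<in>I. c i * m i x) = (\<lambda>x. \<Sum>i\<in>I. c (inv_into I m (m i)) * m i x)" for c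
      using inj by (intro ext sum.cong) auto
    then have "(\<lambda>x. \<Sum>i\<in>I. c i * m i x) \<in> range (\<lambda>u x. \<Sum>i\<in>I. u (m i) * m i x)" for c
      by (rule image_eqI[of _ _ "\<lambda>v. c (inv_into I m v)"]) simp
    then show ?thesis
      unfolding fun_space.span_finite[OF finite_imageI[OF I]] e by auto
  qed
  ultimately show "is_basis (m ` I) {(\<lambda>x. \<Sum>i\<in>I. c i * m i x) | c. True}"
    unfolding is_basis_def by blast
qed

lemma basis_card_family:
  fixes m :: "'i \<Rightarrow> 'a \<Rightarrow> real"
  assumes I: "finite I" and indep: "lin_indep_family I m"
    and W: "W = {(\<lambda>x. \<Sum>i\<in>I. c i * m i x) | c. True}"
  shows "fun_space.dim W = card I" "is_basis B W \<Longrightarrow> finite B \<and> card B = card I"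
proof -
  note b = basis_from_family[OF I indep]
  have mI: "fun_space.independent (m ` I)" "fun_space.span (m ` I) = W" "card (m ` I) = card I"
    using b card_image unfolding is_basis_def W by auto
  have "fun_space.span (m ` I) = fun_space.span W"
    using mI(2) fun_space.span_span by metis
  from fun_space.dim_eq_card[OF this mI(1)] show "fun_space.dim W = card I" using mI(3) by simp
  assume "is_basis B W"
  then obtain h where "bij_betw h B (m ` I)"
    using fun_space.bij_if_span_eq_span_bases[of B "m ` I"] mI unfolding is_basis_def by auto
  then show "finite B \<and> card B = card I"
    using I mI(3) bij_betw_finite bij_betw_same_card by fastforce
qed

text \<open>
  Exchange argument: another vector outside the span of the family would give an independent set that is
  larger than the spanning set \<open>J\<close>.
\<close>

lemma independent_family_spans:
  fixes m :: "'i \<Rightarrow> 'a \<Rightarrow> real"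
  assumes I: "finite I" and indep: "lin_indep_family I m"
    and J: "finite J" "card J = card I"
    and sub: "\<And>i. i \<in> I \<Longrightarrow> m i \<in> fun_space.span J" and w: "w \<in> fun_space.span J"
  shows "\<exists>c. \<forall>x. w x = (\<Sum>i\<in>I. c i * m i x)"
proof -
  note b = basis_from_family[OF I indep]
  have mI: "fun_space.independent (m ` I)" "fun_space.span (m ` I) = {(\<lambda>x. \<Sum>i\<in>I. c i * m i x) | c. True}" "card (m ` I) = card I"
    using b card_image unfolding is_basis_def by auto
  have "w \<in> fun_space.span (m ` I)"
  proof (rule ccontr)
    assume n: "w \<notin> fun_space.span (m ` I)"
    then have "fun_space.independent (insert w (m ` I))"
      using mI(1) by (rule fun_space.independent_insertI)
    moreover have "insert w (m ` I) \<subseteq> fun_space.span J" using sub w by auto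
    ultimately have "card (insert w (m ` I)) \<le> card J"
      using fun_space.independent_span_bound[OF J(1)] by blast
    moreover have "w \<notin> m ` I" using n fun_space.span_base by metis
    ultimately show False using mI(3) I J by simp
  qed
  then show ?thesis unfolding mI(2) by auto
qed

section \<open>Degrees of freedom on an edge\<close>

text \<open>
  A condition under which the integrals in \<^const>\<open>dof_value\<close> exist for continuous functions, so that the
  degree of freedom is linear; for functions that are not integrable the integral is zero by
  convention, and linearity fails.
\<close>

primrec admissible_dof :: "plane set \<Rightarrow> dof \<Rightarrow> bool" where
  "admissible_dof E (Vertex_Value v) \<longleftrightarrow> True"
| "admissible_dof E (Edge_Moment e q) \<longleftrightarrow>
    edge_set e \<subseteq> E \<and> continuous_on {0..1} (\<lambda>t. q (linepath (fst e) (snd e) t))"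
| "admissible_dof E (Internal_Moment q) \<longleftrightarrow> continuous_on E q"

lemma linepath_in_edge: "t \<in> {0..1} \<Longrightarrow> linepath (fst e) (snd e) t \<in> edge_set e"
  unfolding edge_set_def by (metis atLeastAtMost_iff linepath_in_path)

lemma continuous_on_edge:
  fixes \<phi> :: "plane \<Rightarrow> real"
  assumes "continuous_on E \<phi>" "edge_set e \<subseteq> E"
  shows "continuous_on {0..1} (\<lambda>t. \<phi> (linepath (fst e) (snd e) t))"
  using assms linepath_in_edge[of _ e]
  by (intro continuous_on_compose2[OF assms(1)] continuous_on_linepath) auto

lemma dof_value_linear:
  assumes E: "compact E" and d: "admissible_dof E d" and c: "continuous_on E \<phi>" "continuous_on E \<psi>"
  shows "dof_value E d (\<lambda>x. r * \<phi> x + s * \<psi> x) = r * dof_value E d \<phi> + s * dof_value E d \<psi>"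
proof (cases d)
  case (Edge_Moment e q)
  let ?\<gamma> = "linepath (fst e) (snd e)"
  have i: "set_integrable lborel {0..1} (\<lambda>t. h (?\<gamma> t) * q (?\<gamma> t) * dist (fst e) (snd e))"
    if "continuous_on E h" for h :: "plane \<Rightarrow> real"
    using continuous_on_edge[OF that, of e] d Edge_Moment
    by (intro set_integrable_compact_continuous continuous_intros) auto
  have "(\<lambda>t. (r * \<phi> (?\<gamma> t) + s * \<psi> (?\<gamma> t)) * q (?\<gamma> t) * dist (fst e) (snd e)) =
      (\<lambda>t. r * (\<phi> (?\<gamma> t) * q (?\<gamma> t) * dist (fst e) (snd e)) +
        s * (\<psi> (?\<gamma> t) * q (?\<gamma> t) * dist (fst e) (snd e)))"
    by (simp add: fun_eq_iff algebra_simps)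
  then show ?thesis
    using i[OF c(1)] i[OF c(2)] unfolding Edge_Moment dof_value.simps
    by (simp only: set_integral_add(2)[OF set_integrable_mult_right set_integrable_mult_right]
        set_integral_mult_right)
next
  case (Internal_Moment q)
  have i: "set_integrable lborel E (\<lambda>x. h x * q x)" if "continuous_on E h" for h :: "plane \<Rightarrow> real"
    using that d Internal_Moment by (intro set_integrable_compact_continuous continuous_intros E) auto
  have "(\<lambda>x. (r * \<phi> x + s * \<psi> x) * q x) = (\<lambda>x. r * (\<phi> x * q x) + s * (\<psi> x * q x))"
    by (simp add: fun_eq_iff algebra_simps)
  then show ?thesis
    using i[OF c(1)] i[OF c(2)] unfolding Internal_Moment dof_value.simps
    by (simp only: set_integral_add(2)[OF set_integrable_mult_right set_integrable_mult_right]
        set_integral_mult_right)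
qed simp

lemma dof_value_sum:
  assumes E: "compact E" and d: "admissible_dof E d" and I: "finite I"
    and c: "\<And>i. i \<in> I \<Longrightarrow> continuous_on E (\<phi> i)"
  shows "dof_value E d (\<lambda>x. \<Sum>i\<in>I. c i * \<phi> i x) = (\<Sum>i\<in>I. c i * dof_value E d (\<phi> i))"
  using I c
proof (induction I rule: finite_induct)
  case empty
  show ?case using dof_value_linear[OF E d, of "\<lambda>_. 0" "\<lambda>_. 0" 0 0] by simp
next
  case (insert i I)
  have "continuous_on E (\<lambda>x. \<Sum>i\<in>I. c i * \<phi> i x)"
    using insert by (auto intro!: continuous_intros)
  from dof_value_linear[OF E d _ this, of "\<phi> i" "c i" 1] insert show ?case by simp
qed

lemma moment_eq_0_on_span:
  fixes \<gamma> :: "'b::euclidean_space \<Rightarrow> 'a" and h :: "'b \<Rightarrow> real"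
  assumes A: "compact A" and h: "continuous_on A h"
    and Q: "\<And>q. q \<in> Q \<Longrightarrow> continuous_on A (\<lambda>t. q (\<gamma> t))" "\<And>q. q \<in> Q \<Longrightarrow> (LINT t:A|lborel. h t * q (\<gamma> t)) = 0"
    and q: "q \<in> fun_space.span Q"
  shows "(LINT t:A|lborel. h t * q (\<gamma> t)) = 0"
proof -
  have "continuous_on A (\<lambda>t. q (\<gamma> t)) \<and> (LINT t:A|lborel. h t * q (\<gamma> t)) = 0"
    using q
  proof (induction rule: fun_space.span_induct_alt)
    case base
    show ?case by (simp add: zero_fun_def)
  next
    case (step c x y)
    have i: "set_integrable lborel A (\<lambda>t. h t * x (\<gamma> t))" "set_integrable lborel A (\<lambda>t. h t * y (\<gamma> t))"
      using Q(1)[OF step(1)] step(2) by (auto intro!: set_integrable_compact_continuous A continuous_intros h)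
    have "(\<lambda>t. h t * (fun_scale c x + y) (\<gamma> t)) = (\<lambda>t. c * (h t * x (\<gamma> t)) + h t * y (\<gamma> t))"
      by (simp add: fun_eq_iff fun_scale_def algebra_simps)
    then have "(LINT t:A|lborel. h t * (fun_scale c x + y) (\<gamma> t)) = 0"
      using i Q(2)[OF step(1)] step(2)
      by (simp only: set_integral_add(2)[OF set_integrable_mult_right] set_integral_mult_right
          mult_zero_right add_0_right)
    moreover have "continuous_on A (\<lambda>t. (fun_scale c x + y) (\<gamma> t))"
      using Q(1)[OF step(1)] step(2) by (auto simp: fun_scale_def intro!: continuous_intros)
    ultimately show ?case by blast
  qed
  then show ?thesis by blast
qed

definition edge_coord :: "edge \<Rightarrow> plane \<Rightarrow> real" where
  "edge_coord e x = ((x - fst e) \<bullet> (snd e - fst e)) / ((snd e - fst e) \<bullet> (snd e - fst e))"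

text \<open>
  The function on the edge whose pullback to \<open>[0, 1]\<close> is \<open>h\<close>.
\<close>

definition edge_fun :: "edge \<Rightarrow> (real \<Rightarrow> real) \<Rightarrow> plane \<Rightarrow> real" where
  "edge_fun e h = restr0 (edge_set e) (\<lambda>x. h (edge_coord e x))"

lemma edge_coord_linepath:
  assumes "fst e \<noteq> snd e"
  shows "edge_coord e (linepath (fst e) (snd e) t) = t"
proof -
  have "linepath (fst e) (snd e) t - fst e = t *\<^sub>R (snd e - fst e)"
    by (simp add: linepath_def algebra_simps)
  then show ?thesis using assms by (simp add: edge_coord_def)
qed

lemma edge_fun_linepath:
  "fst e \<noteq> snd e \<Longrightarrow> t \<in> {0..1} \<Longrightarrow> edge_fun e h (linepath (fst e) (snd e) t) = h t"
  using linepath_in_edge[of t e] edge_coord_linepath[of e t] by (simp add: edge_fun_def restr0_def)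

lemma edge_set_linepath: "x \<in> edge_set e \<Longrightarrow> \<exists>t\<in>{0..1}. x = linepath (fst e) (snd e) t"
  unfolding edge_set_def linepath_image_01[symmetric] by blast

lemma edge_fun_in_poly_edge:
  assumes "fst e \<noteq> snd e" "p = 0 \<or> int (degree p) \<le> d"
  shows "edge_fun e (poly p) \<in> poly_edge d e"
  unfolding poly_edge_def mem_Collect_eq
proof (intro conjI exI[of _ p])
  show "\<forall>x. x \<notin> edge_set e \<longrightarrow> edge_fun e (poly p) x = 0" by (simp add: edge_fun_def restr0_def)
qed (use assms edge_fun_linepath in auto)

lemma poly_edge_family:
  assumes e: "fst e \<noteq> snd e"
  shows "poly_edge d e = {(\<lambda>x. \<Sum>i\<in>{i. int i \<le> d}. c i * edge_fun e (\<lambda>t. t ^ i) x) | c. True}"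
    (is "_ = ?R")
proof
  have fin: "finite {i. int i \<le> d}" by (rule finite_subset[of _ "{..nat d}"]) auto
  show "poly_edge d e \<subseteq> ?R"
  proof
    fix \<phi> assume "\<phi> \<in> poly_edge d e"
    then obtain p where \<phi>: "\<And>x. x \<notin> edge_set e \<Longrightarrow> \<phi> x = 0" "p = 0 \<or> int (degree p) \<le> d"
      "\<And>t. t \<in> {0..1} \<Longrightarrow> \<phi> (linepath (fst e) (snd e) t) = poly p t"
      unfolding poly_edge_def by blast
    have p: "poly p t = (\<Sum>i\<in>{i. int i \<le> d}. coeff p i * t ^ i)" for t
    proof (cases "p = 0")
      case False
      then have "{..degree p} \<subseteq> {i. int i \<le> d}" using \<phi>(2) by auto
      then show ?thesis
        unfolding poly_altdef by (intro sum.mono_neutral_left fin) (auto simp: coeff_eq_0)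
    qed simp
    have "\<phi> x = (\<Sum>i\<in>{i. int i \<le> d}. coeff p i * edge_fun e (\<lambda>t. t ^ i) x)" for x
    proof (cases "x \<in> edge_set e")
      case True
      then obtain t where t: "t \<in> {0..1}" "x = linepath (fst e) (snd e) t"
        using edge_set_linepath by blast
      then show ?thesis using \<phi>(3)[OF t(1)] p by (simp add: edge_fun_linepath[OF e])
    qed (simp add: \<phi> edge_fun_def restr0_def)
    then show "\<phi> \<in> ?R" by blast
  qed
  show "?R \<subseteq> poly_edge d e"
  proof
    fix \<phi> assume "\<phi> \<in> ?R"
    then obtain c where c: "\<phi> = (\<lambda>x. \<Sum>i\<in>{i. int i \<le> d}. c i * edge_fun e (\<lambda>t. t ^ i) x)" by blast
    let ?p = "\<Sum>i\<in>{i. int i \<le> d}. monom (c i) i"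
    have "\<phi> = edge_fun e (poly ?p)"
      by (auto simp: c edge_fun_def restr0_def poly_sum poly_monom fun_eq_iff)
    moreover have "?p = 0 \<or> int (degree ?p) \<le> d"
    proof (cases "d < 0")
      case False
      have "degree ?p \<le> nat d"
        using False by (intro degree_sum_le fin) (auto intro!: order_trans[OF degree_monom_le])
      then show ?thesis using False by auto
    qed auto
    ultimately show "\<phi> \<in> poly_edge d e" using edge_fun_in_poly_edge[OF e] by simp
  qed
qed

lemma card_basis_poly_edge:
  assumes e: "fst e \<noteq> snd e" and B: "is_basis B (poly_edge d e)"
  shows "finite B \<and> card B = nat (d + 1)"
proof -
  let ?I = "{i. int i \<le> d}"
  have I: "?I = {..<nat (d + 1)}" by auto
  have fin: "finite ?I" unfolding I by simp
  have "lin_indep_family ?I (\<lambda>i. edge_fun e (\<lambda>t. t ^ i))"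
    unfolding lin_indep_family_def
  proof (intro allI impI ballI)
    fix c i assume z: "\<forall>x. (\<Sum>i\<in>?I. c i * edge_fun e (\<lambda>t. t ^ i) x) = 0" and i: "i \<in> ?I"
    have "(\<Sum>i\<in>?I. monom (c i) i) = 0"
    proof (rule poly_eq_0_on_interval)
      show "(0::real) < 1" by simp
      fix t :: real assume "0 < t" "t < 1"
      then have t: "t \<in> {0..1}" by simp
      show "poly (\<Sum>i\<in>?I. monom (c i) i) t = 0"
        using z[rule_format, of "linepath (fst e) (snd e) t"] edge_fun_linepath[OF e t]
        by (simp add: poly_sum poly_monom)
    qed
    then have "coeff (\<Sum>i\<in>?I. monom (c i) i) i = 0" by simp
    then show "c i = 0" unfolding coeff_sum coeff_monom using i fin by simp
  qed
  from basis_card_family(2)[OF fin this poly_edge_family[OF e] B]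
  have "finite B \<and> card B = card ?I" .
  then show ?thesis unfolding I by simp
qed

lemma poly_edge_continuous:
  assumes "\<phi> \<in> poly_edge d e"
  shows "continuous_on {0..1} (\<lambda>t. \<phi> (linepath (fst e) (snd e) t))"
proof -
  obtain p :: "real poly" where "\<forall>t\<in>{0..1}. \<phi> (linepath (fst e) (snd e) t) = poly p t"
    using assms unfolding poly_edge_def by blast
  then show ?thesis using continuous_on_cong[of "{0..1}" "{0..1}" "\<lambda>t. \<phi> (linepath (fst e) (snd e) t)" "poly p"]
    by (auto intro: continuous_intros)
qed

lemma poly_edge_diff:
  assumes "\<phi> \<in> poly_edge d e" "\<psi> \<in> poly_edge d e"
  shows "(\<lambda>x. \<phi> x - \<psi> x) \<in> poly_edge d e"
proof -
  obtain p q :: "real poly" where p: "p = 0 \<or> int (degree p) \<le> d" "\<forall>t\<in>{0..1}. \<phi> (linepath (fst e) (snd e) t) = poly p t"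
    and q: "q = 0 \<or> int (degree q) \<le> d" "\<forall>t\<in>{0..1}. \<psi> (linepath (fst e) (snd e) t) = poly q t"
    and z: "\<forall>x. x \<notin> edge_set e \<longrightarrow> \<phi> x = 0" "\<forall>x. x \<notin> edge_set e \<longrightarrow> \<psi> x = 0"
    using assms unfolding poly_edge_def by blast
  have "p - q = 0 \<or> int (degree (p - q)) \<le> d"
    using p(1) q(1) degree_diff_le_max[of p q] by (cases "p = 0"; cases "q = 0") (auto simp: max_def split: if_splits)
  then show ?thesis
    unfolding poly_edge_def mem_Collect_eq using p q z by (intro conjI exI[of _ "p - q"]) auto
qed

text \<open>
  In the parameter \<open>t\<close> of the edge, \<open>\<phi>\<close> is a polynomial with zeros at both ends, so it is
  \<open>t (t - 1) r(t)\<close> with \<open>r\<close> of degree at most \<open>k - 2\<close>. Since \<open>r\<close> is an admissible test function for the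
  moments, the integral of \<open>t (1 - t) r(t)\<^sup>2\<close> is zero.
\<close>

lemma edge_polynomial_eq_0:
  fixes \<phi> :: "plane \<Rightarrow> real"
  assumes e: "fst e \<noteq> snd e" and \<phi>: "restr0 (edge_set e) \<phi> \<in> poly_edge k e"
    and ends: "\<phi> (fst e) = 0" "\<phi> (snd e) = 0"
    and B: "is_basis B (poly_edge (k - 2) e)"
    and mom: "\<And>q. q \<in> B \<Longrightarrow> dof_value E (Edge_Moment e q) \<phi> = 0"
    and x: "x \<in> edge_set e"
  shows "\<phi> x = 0"
proof -
  let ?\<gamma> = "linepath (fst e) (snd e)"
  have r: "restr0 (edge_set e) \<phi> (?\<gamma> t) = \<phi> (?\<gamma> t)" if "t \<in> {0..1}" for t
    using linepath_in_edge[OF that, of e] by (simp add: restr0_def)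
  obtain p :: "real poly" where p: "p = 0 \<or> int (degree p) \<le> k" "\<And>t. t \<in> {0..1} \<Longrightarrow> \<phi> (?\<gamma> t) = poly p t"
    using \<phi> r unfolding poly_edge_def by force
  have "poly p 0 = 0" "poly p 1 = 0"
    using p(2)[of 0] p(2)[of 1] ends by (simp_all add: linepath_def)
  then obtain p1 where p1: "p = [:0, 1:] * p1" unfolding poly_eq_0_iff_dvd by auto
  then have "poly p1 1 = 0" using \<open>poly p 1 = 0\<close> by simp
  then obtain p2 where "p1 = [:-1, 1:] * p2" unfolding poly_eq_0_iff_dvd by auto
  then have p2: "p = ([:0, 1:] * [:-1, 1:]) * p2" using p1 by (simp only: mult.assoc)
  have deg: "p2 = 0 \<or> int (degree p2) \<le> k - 2"
  proof (cases "p2 = 0")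
    case False
    have "[:0, 1:] * [:-1, 1:] \<noteq> (0 :: real poly)" "degree ([:0, 1:] * [:-1, 1:] :: real poly) = 2"
      by simp_all
    then have "degree p = 2 + degree p2" "p \<noteq> 0"
      using False unfolding p2 by (simp_all only: degree_mult_eq mult_eq_0_iff not_False_eq_True simp_thms)
    then show ?thesis using p(1) by simp
  qed simp
  define q where "q = edge_fun e (poly p2)"
  have q: "q \<in> fun_space.span B"
    using edge_fun_in_poly_edge[OF e deg] B unfolding is_basis_def q_def by simp
  have cB: "continuous_on {0..1} (\<lambda>t. q' (?\<gamma> t))" if "q' \<in> B" for q'
    using that B fun_space.span_superset poly_edge_continuous unfolding is_basis_def by blast
  have c\<phi>: "continuous_on {0..1} (\<lambda>t. \<phi> (?\<gamma> t) * dist (fst e) (snd e))"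
  proof (rule continuous_on_eq)
    show "continuous_on {0..1} (\<lambda>t. poly p t * dist (fst e) (snd e))" by (intro continuous_intros)
  qed (simp add: p(2))
  have mB: "(LINT t:{0..1}|lborel. (\<phi> (?\<gamma> t) * dist (fst e) (snd e)) * q' (?\<gamma> t)) = 0" if "q' \<in> B" for q'
    using mom[OF that] by (simp add: ac_simps)
  have m: "(LINT t:{0..1}|lborel. (\<phi> (?\<gamma> t) * dist (fst e) (snd e)) * q (?\<gamma> t)) = 0"
    by (rule moment_eq_0_on_span[OF compact_Icc c\<phi> cB mB q])
  let ?F = "\<lambda>t. dist (fst e) (snd e) * (t * (1 - t) * (poly p2 t)\<^sup>2)"
  have F: "continuous_on {0..1} ?F" by (intro continuous_intros)
  have "(LINT t:{0..1}|lborel. ?F t) = (LINT t:{0..1}|lborel. (- 1) * ((\<phi> (?\<gamma> t) * dist (fst e) (snd e)) * q (?\<gamma> t)))"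
    unfolding set_lebesgue_integral_def
  proof (rule Bochner_Integration.integral_cong)
    fix t
    show "indicator {0..1} t *\<^sub>R ?F t =
        indicator {0..1} t *\<^sub>R ((- 1) * ((\<phi> (?\<gamma> t) * dist (fst e) (snd e)) * q (?\<gamma> t)))"
    proof (cases "t \<in> {0..1}")
      case True
      have "\<phi> (?\<gamma> t) = - (t * (1 - t) * poly p2 t)"
        using p(2)[OF True] by (simp add: p2 algebra_simps)
      moreover have "q (?\<gamma> t) = poly p2 t"
        by (simp add: q_def edge_fun_linepath[OF e True])
      ultimately show ?thesis by (simp add: power2_eq_square)
    qed simp
  qed simp
  also have "\<dots> = 0" unfolding set_integral_mult_right m by simp
  finally have "integral {0..1} ?F = 0"
    using set_borel_integral_eq_integral(2)[OF set_integrable_compact_continuous[OF compact_Icc F]] by (simp only:)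
  moreover have "?F t \<ge> 0" if "t \<in> {0..1}" for t
    using that by (intro mult_nonneg_nonneg) auto
  ultimately have "\<forall>t\<in>{0..1}. ?F t = 0"
    using integral_eq_0_iff[OF F zero_less_one] by blast
  obtain t where t: "t \<in> {0..1}" "x = ?\<gamma> t" using edge_set_linepath[OF x] by blast
  have "?F t = 0" using \<open>\<forall>t\<in>{0..1}. ?F t = 0\<close> t(1) by blast
  then have "poly p t = 0" using e unfolding p2 by auto
  then show ?thesis using p(2)[OF t(1)] t(2) by simp
qed

lemma continuous_on_restr0:
  fixes \<phi> :: "'a::topological_space \<Rightarrow> real"
  assumes "closed E" "continuous_on E \<phi>" "\<And>x. x \<in> frontier E \<Longrightarrow> \<phi> x = 0"
  shows "continuous_on UNIV (restr0 E \<phi>)"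
proof -
  have "continuous_on (E \<union> closure (- E)) (\<lambda>x. if x \<in> E then \<phi> x else 0)"
  proof (rule continuous_on_If)
    show "\<phi> x = 0" if "x \<in> closure (- E)" "x \<in> E" for x
      using that assms(1,3) by (simp add: frontier_closures)
    show "\<phi> x = 0" if "x \<in> E" "x \<notin> E" for x
      using that by simp
  qed (use assms in auto)
  moreover have "E \<union> closure (- E) = UNIV" using closure_subset[of "- E"] by blast
  ultimately show ?thesis unfolding restr0_def by simp
qed

text \<open>
  Continuity on the whole plane reduces the claim to a box, so that no regularity of the boundary of
  \<open>E\<close> enters.
\<close>

lemma eq_0_if_integral_eq_0:
  fixes F :: "plane \<Rightarrow> real"
  assumes "continuous_on UNIV F" "\<And>x. F x \<ge> 0" "\<And>x. x \<notin> E \<Longrightarrow> F x = 0" "bounded E"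
    and "(LINT x:E|lborel. F x) = 0"
  shows "F x = 0"
proof -
  obtain r where r: "r > 0" "E \<subseteq> square r" using bounded_subset_square[OF assms(4)] .
  have "integral (square r) F = 0"
    using set_integral_eq_integral_square[OF assms(1,3) r(2)] assms(5) by simp
  then have "\<forall>x\<in>square r. F x = 0"
    using integral_cbox_eq_0_iff[of "(- r, - r)" "(r, r)" F] assms(1,2) box_square_nonempty[OF r(1)]
    by (meson continuous_on_subset subset_UNIV)
  then show ?thesis using assms(3) r(2) by blast
qed

section \<open>Polynomials and virtual functions on a triangle\<close>

lemma cross2_nonzero:
  assumes "\<not> collinear {a, b, c}"
  shows "cross2 a b c \<noteq> 0"
proof
  assume 0: "cross2 a b c = 0"
  have "a \<noteq> b" using assms by auto
  define v where "v = b - a"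
  have "v \<noteq> 0" using \<open>a \<noteq> b\<close> by (simp add: v_def)
  then have N: "v \<bullet> v \<noteq> 0" by simp
  have "(v \<bullet> v) *\<^sub>R (c - a) = ((c - a) \<bullet> v) *\<^sub>R v"
    using 0 by (auto simp: cross2_def v_def prod_eq_iff inner_prod_def algebra_simps) algebra+
  then have "c - a = (((c - a) \<bullet> v) / (v \<bullet> v)) *\<^sub>R v"
    using N by (metis (no_types, opaque_lifting) divide_inverse_commute right_inverse scaleR_one scaleR_scaleR mult.commute)
  then have "collinear {0, b - a, c - a}"
    unfolding collinear_lemma v_def by blast
  then have "collinear {b, a, c}" by (subst collinear_3) auto
  then show False using assms by (simp add: insert_commute)
qed

text \<open>
  The three forms are the barycentric coordinates up to the common factor \<open>cross2 a b c\<close>.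
\<close>

lemma cross2_barycentric:
  assumes "u + v + w = 1" "z = u *\<^sub>R a + v *\<^sub>R b + w *\<^sub>R c"
  shows "cross2 a b z = w * cross2 a b c" "cross2 b c z = u * cross2 a b c" "cross2 c a z = v * cross2 a b c"
proof -
  have u: "u = 1 - v - w" using assms(1) by simp
  show "cross2 a b z = w * cross2 a b c" "cross2 b c z = u * cross2 a b c" "cross2 c a z = v * cross2 a b c"
    unfolding assms(2) u cross2_def by (simp_all add: algebra_simps)
qed

lemma closed_triangle_barycentric:
  "z \<in> closed_triangle a b c \<Longrightarrow>
    \<exists>u v w. 0 \<le> u \<and> 0 \<le> v \<and> 0 \<le> w \<and> u + v + w = 1 \<and> z = u *\<^sub>R a + v *\<^sub>R b + w *\<^sub>R c"
  unfolding closed_triangle_def convex_hull_3 by blast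

lemma compact_closed_triangle: "compact (closed_triangle a b c)"
  unfolding closed_triangle_def by (simp add: finite_imp_compact_convex_hull)

lemma frontier_closed_triangle:
  "frontier (closed_triangle a b c) = edge_set (a, b) \<union> edge_set (b, c) \<union> edge_set (c, a)"
  unfolding closed_triangle_def edge_set_def fst_conv snd_conv by (rule frontier_of_triangle) simp

lemma edge_subset_triangle: "e \<in> triangle_edges a b c \<Longrightarrow> edge_set e \<subseteq> closed_triangle a b c"
  using frontier_closed_triangle[of a b c] compact_imp_closed[OF compact_closed_triangle[of a b c]]
    frontier_subset_closed[of "closed_triangle a b c"]
  unfolding triangle_edges_def by auto

lemma interior_triangle_nonempty:
  fixes a b c :: plane
  assumes "\<not> collinear {a, b, c}"
  shows "interior (closed_triangle a b c) \<noteq> {}"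
proof -
  have "(1/3) *\<^sub>R a + (1/3) *\<^sub>R b + (1/3) *\<^sub>R c \<in> interior (closed_triangle a b c)"
  proof -
    have "DIM(plane) = 2" by simp
    note interior_convex_hull_3_minimal[OF assms this]
    then show ?thesis
      unfolding closed_triangle_def
      by (simp only:) (rule CollectI, rule exI[of _ "1/3"], rule exI[of _ "1/3"], rule exI[of _ "1/3"], simp)
  qed
  then show ?thesis by blast
qed

lemma continuous_restr0_poly2: "f \<in> poly2 d \<Longrightarrow> continuous_on E (restr0 E f)"
  by (rule continuous_on_eq[OF continuous_on_subset[OF poly2_continuous subset_UNIV]])
    (auto simp: restr0_def)

lemma poly_plane_continuous: "p \<in> poly_plane d E \<Longrightarrow> continuous_on E p"
  unfolding poly_plane_eq using continuous_restr0_poly2 by blast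

lemma poly_plane_family:
  "poly_plane d E = {(\<lambda>x. \<Sum>p\<in>degs d. c p * restr0 E (mono2 p) x) | c. True}"
proof -
  have "restr0 E (\<lambda>z. \<Sum>p\<in>degs d. c p * mono2 p z) = (\<lambda>x. \<Sum>p\<in>degs d. c p * restr0 E (mono2 p) x)" for c
    by (auto simp: restr0_def fun_eq_iff)
  then show ?thesis unfolding poly_plane_eq poly2_def by (auto simp: image_iff) metis
qed

lemma poly_plane_lin_indep:
  assumes "interior E \<noteq> {}"
  shows "lin_indep_family (degs d) (\<lambda>p. restr0 E (mono2 p))"
  unfolding lin_indep_family_def
proof (intro allI impI ballI)
  fix c p assume z: "\<forall>x. (\<Sum>p\<in>degs d. c p * restr0 E (mono2 p) x) = 0" and p: "p \<in> degs d"
  show "c p = 0"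
  proof (rule poly2_coeffs_eq_0[OF open_interior assms _ p])
    fix x assume "x \<in> interior E"
    then have "x \<in> E" using interior_subset by blast
    then show "(\<Sum>p\<in>degs d. c p * mono2 p x) = 0" using z[rule_format, of x] by (simp add: restr0_def)
  qed
qed

lemma poly_plane_diff:
  assumes "p \<in> poly_plane d E" "q \<in> poly_plane d E"
  shows "p - q \<in> poly_plane d E"
proof -
  obtain f g where fg: "f \<in> poly2 d" "p = restr0 E f" "g \<in> poly2 d" "q = restr0 E g"
    using assms unfolding poly_plane_eq by blast
  have "p - q = restr0 E (\<lambda>x. f x + (- 1) * g x)"
    by (auto simp: fg restr0_def fun_eq_iff)
  moreover have "(\<lambda>x. f x + (- 1) * g x) \<in> poly2 d" by (intro poly2_add poly2_scale fg)
  ultimately show ?thesis unfolding poly_plane_eq by blast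
qed

lemma poly_plane_in_vem_space:
  assumes "p \<in> poly_plane (int k) (closed_triangle a b c)"
  shows "p \<in> vem_space k a b c"
proof -
  let ?E = "closed_triangle a b c"
  obtain f where f: "f \<in> poly2 (int k)" "p = restr0 ?E f"
    using assms unfolding poly_plane_eq by blast
  have "restr0 (edge_set e) p \<in> poly_edge (int k) e" if e: "e \<in> triangle_edges a b c" for e
  proof -
    obtain q :: "real poly" where q: "q = 0 \<or> int (degree q) \<le> int k" "\<forall>t. f (linepath (fst e) (snd e) t) = poly q t"
      using poly2_linepath[OF f(1)] by blast
    have "restr0 (edge_set e) p (linepath (fst e) (snd e) t) = poly q t" if "t \<in> {0..1}" for t
      using linepath_in_edge[OF that, of e] edge_subset_triangle[OF e] q(2) by (auto simp: f restr0_def)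
    then show ?thesis using q(1) unfolding poly_edge_def mem_Collect_eq by (intro conjI exI[of _ q]) (auto simp: restr0_def)
  qed
  moreover have "\<exists>h\<in>poly_plane (int k) ?E. has_weak_laplacian p h (interior ?E)"
  proof -
    obtain f1 where f1: "f1 \<in> poly2 (int k)" "has_partial (1, 0) f f1" using poly2_has_partial[OF f(1)] by blast
    obtain f2 where f2: "f2 \<in> poly2 (int k)" "has_partial (0, 1) f f2" using poly2_has_partial[OF f(1)] by blast
    obtain f11 where f11: "f11 \<in> poly2 (int k)" "has_partial (1, 0) f1 f11" using poly2_has_partial[OF f1(1)] by blast
    obtain f22 where f22: "f22 \<in> poly2 (int k)" "has_partial (0, 1) f2 f22" using poly2_has_partial[OF f2(1)] by blast
    have b: "bounded (interior ?E)"
      using compact_imp_bounded[OF compact_closed_triangle] interior_subset bounded_subset by metis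
    have "has_weak_laplacian p (restr0 ?E (\<lambda>x. f11 x + f22 x)) (interior ?E)"
      by (rule has_weak_laplacian_classical[OF b f1(2) f11(2) f2(2) f22(2)
            poly2_continuous[OF f(1)] poly2_continuous[OF f11(1)] poly2_continuous[OF f22(1)]])
        (use interior_subset[of ?E] in \<open>auto simp: f restr0_def\<close>)
    moreover have "restr0 ?E (\<lambda>x. f11 x + f22 x) \<in> poly_plane (int k) ?E"
      unfolding poly_plane_eq using poly2_add[OF f11(1) f22(1)] by blast
    ultimately show ?thesis by blast
  qed
  ultimately show ?thesis
    using poly_plane_continuous[OF assms] unfolding vem_space_def by (simp add: f restr0_def)
qed

lemma vem_space_diff:
  assumes "\<phi> \<in> vem_space k a b c" "\<psi> \<in> vem_space k a b c"
  shows "\<phi> - \<psi> \<in> vem_space k a b c"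
proof -
  let ?E = "closed_triangle a b c"
  obtain f where f: "f \<in> poly_plane (int k) ?E" "has_weak_laplacian \<phi> f (interior ?E)"
    using assms unfolding vem_space_def by blast
  obtain g where g: "g \<in> poly_plane (int k) ?E" "has_weak_laplacian \<psi> g (interior ?E)"
    using assms unfolding vem_space_def by blast
  have c: "continuous_on ?E \<phi>" "continuous_on ?E \<psi>"
    using assms unfolding vem_space_def by blast+
  have "has_weak_laplacian (\<lambda>x. \<phi> x - \<psi> x) (\<lambda>x. f x - g x) (interior ?E)"
    by (rule has_weak_laplacian_diff[OF compact_closed_triangle interior_subset open_interior c
          poly_plane_continuous[OF f(1)] poly_plane_continuous[OF g(1)] f(2) g(2)])
  then have "has_weak_laplacian (\<phi> - \<psi>) (f - g) (interior ?E)"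
    by (simp add: fun_diff_def)
  moreover have "restr0 (edge_set e) (\<phi> - \<psi>) \<in> poly_edge (int k) e" if "e \<in> triangle_edges a b c" for e
  proof -
    have "restr0 (edge_set e) (\<phi> - \<psi>) = (\<lambda>x. restr0 (edge_set e) \<phi> x - restr0 (edge_set e) \<psi> x)"
      by (auto simp: restr0_def fun_eq_iff)
    then show ?thesis using poly_edge_diff that assms unfolding vem_space_def by simp
  qed
  moreover have "continuous_on ?E (\<phi> - \<psi>)"
    unfolding fun_diff_def by (intro continuous_intros c)
  moreover have "\<forall>x. x \<notin> ?E \<longrightarrow> (\<phi> - \<psi>) x = 0"
    using assms unfolding vem_space_def by simp
  ultimately show ?thesis
    using poly_plane_diff[OF f(1) g(1)] unfolding vem_space_def by blast
qed

lemma vem_boundary_eq_0: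
  assumes tri: "\<not> collinear {a, b, c}"
    and Qe: "\<And>e. e \<in> triangle_edges a b c \<Longrightarrow> is_basis (Qe e) (poly_edge (int k - 2) e)"
    and \<phi>: "\<phi> \<in> vem_space k a b c"
    and dofs: "\<And>d. d \<in> boundary_dofs a b c Qe \<Longrightarrow> dof_value (closed_triangle a b c) d \<phi> = 0"
    and x: "x \<in> frontier (closed_triangle a b c)"
  shows "\<phi> x = 0"
proof -
  obtain e where e: "e \<in> triangle_edges a b c" "x \<in> edge_set e"
    using x unfolding frontier_closed_triangle triangle_edges_def by blast
  have v: "\<phi> a = 0" "\<phi> b = 0" "\<phi> c = 0"
    using dofs[of "Vertex_Value a"] dofs[of "Vertex_Value b"] dofs[of "Vertex_Value c"]
    by (simp_all add: boundary_dofs_def)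
  have "a \<noteq> b" "b \<noteq> c" "c \<noteq> a" using tri by (auto simp: insert_commute)
  then have ne: "fst e \<noteq> snd e" and ends: "\<phi> (fst e) = 0" "\<phi> (snd e) = 0"
    using e(1) v by (auto simp: triangle_edges_def)
  show ?thesis
  proof (rule edge_polynomial_eq_0[OF ne _ ends Qe[OF e(1)] _ e(2)])
    show "restr0 (edge_set e) \<phi> \<in> poly_edge (int k) e"
      using \<phi> e(1) unfolding vem_space_def by blast
    show "dof_value (closed_triangle a b c) (Edge_Moment e q) \<phi> = 0" if "q \<in> Qe e" for q
      using dofs that e(1) unfolding boundary_dofs_def by blast
  qed
qed

text \<open>
  Dividing by the linear forms of the edges, one after the other, gives \<open>f\<close> as their product times some
  \<open>r\<close> of degree at most \<open>d - 3\<close>. Each division needs zeros only on the open edge, where the forms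
  already split off do not vanish. With barycentric coordinates \<open>u\<close>, \<open>v\<close>, \<open>w\<close> and
  \<open>D = cross2 a b c\<close>, the product \<open>D f r\<close> is \<open>u v w (D\<^sup>2 r)\<^sup>2 \<ge> 0\<close>, and its integral is zero.
\<close>

lemma poly2_eq_0_on_triangle:
  assumes tri: "\<not> collinear {a, b, c}" and f: "f \<in> poly2 d"
    and bd: "\<And>x. x \<in> frontier (closed_triangle a b c) \<Longrightarrow> f x = 0"
    and mom: "\<And>r. r \<in> poly2 (d - 3) \<Longrightarrow> (LINT x:closed_triangle a b c|lborel. f x * r x) = 0"
    and x: "x \<in> closed_triangle a b c"
  shows "f x = 0"
proof -
  let ?E = "closed_triangle a b c"
  define D where "D = cross2 a b c"
  have D: "D \<noteq> 0" using cross2_nonzero[OF tri] by (simp add: D_def)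
  have ne: "a \<noteq> b" "b \<noteq> c" "c \<noteq> a" using tri by (auto simp: insert_commute)
  have fe: "f (linepath p q t) = 0" if "(p, q) \<in> triangle_edges a b c" "0 < t" "t < 1" for p q t
  proof (rule bd)
    have "linepath p q t \<in> edge_set (p, q)" using linepath_in_edge[of t "(p, q)"] that by simp
    then show "linepath p q t \<in> frontier ?E"
      using that(1) unfolding frontier_closed_triangle triangle_edges_def by blast
  qed
  obtain g1 where g1: "g1 \<in> poly2 (d - 1)" "\<And>z. f z = cross2 a b z * g1 z"
    using poly2_divide_by_line[OF ne(1) f fe] by (auto simp: triangle_edges_def)
  have l1: "cross2 a b (linepath b c t) = t * D" for t
    unfolding D_def by (rule cross2_barycentric(1)[of 0 "1 - t" t]) (simp_all add: linepath_def)
  have l2: "cross2 a b (linepath c a t) = (1 - t) * D" "cross2 b c (linepath c a t) = t * D" for t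
    unfolding D_def using cross2_barycentric(1,2)[of t 0 "1 - t" "linepath c a t" a b c]
    by (simp_all add: linepath_def algebra_simps)
  have "g1 (linepath b c t) = 0" if "0 < t" "t < 1" for t
    using fe[of b c t] that D by (simp add: g1(2) l1 triangle_edges_def)
  then obtain g2 where g2: "g2 \<in> poly2 (d - 1 - 1)" "\<And>z. g1 z = cross2 b c z * g2 z"
    using poly2_divide_by_line[OF ne(2) g1(1)] by blast
  have "g2 (linepath c a t) = 0" if "0 < t" "t < 1" for t
    using fe[of c a t] that D by (simp add: g1(2) g2(2) l2 triangle_edges_def)
  then obtain r where r: "r \<in> poly2 (d - 1 - 1 - 1)" "\<And>z. g2 z = cross2 c a z * r z"
    using poly2_divide_by_line[OF ne(3) g2(1)] by blast
  have r3: "r \<in> poly2 (d - 3)" using r(1) by (simp add: algebra_simps)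
  have fr: "f z = cross2 a b z * (cross2 b c z * (cross2 c a z * r z))" for z
    using g1(2) g2(2) r(2) by simp
  define F where "F = restr0 ?E (\<lambda>x. D * (f x * r x))"
  have F0: "F x = 0" for x
  proof (rule eq_0_if_integral_eq_0)
    show "continuous_on UNIV F"
      unfolding F_def
    proof (rule continuous_on_restr0[OF compact_imp_closed[OF compact_closed_triangle]])
      show "continuous_on ?E (\<lambda>x. D * (f x * r x))"
        by (intro continuous_intros continuous_on_subset[OF poly2_continuous[OF f] subset_UNIV]
            continuous_on_subset[OF poly2_continuous[OF r3] subset_UNIV])
    qed (simp add: bd)
    show "F z \<ge> 0" for z
    proof (cases "z \<in> ?E")
      case True
      then obtain u v w where uvw: "0 \<le> u" "0 \<le> v" "0 \<le> w" "u + v + w = 1" "z = u *\<^sub>R a + v *\<^sub>R b + w *\<^sub>R c"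
        using closed_triangle_barycentric by blast
      have "F z = D * (w * D * (u * D * (v * D * r z)) * r z)"
        using True unfolding F_def restr0_def fr D_def cross2_barycentric[OF uvw(4,5)] by simp
      also have "\<dots> = u * v * w * (D\<^sup>2 * r z)\<^sup>2"
        by (simp add: power2_eq_square algebra_simps)
      finally show ?thesis using uvw by simp
    qed (simp add: F_def restr0_def)
    show "F z = 0" if "z \<notin> ?E" for z using that by (simp add: F_def restr0_def)
    show "bounded ?E" using compact_imp_bounded[OF compact_closed_triangle] .
    have "(LINT x:?E|lborel. F x) = (LINT x:?E|lborel. D * (f x * r x))"
      unfolding set_lebesgue_integral_def
      by (rule Bochner_Integration.integral_cong) (auto simp: F_def restr0_def indicator_def)
    then show "(LINT x:?E|lborel. F x) = 0" using mom[OF r3] by simp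
  qed
  have "f x * r x = 0" using F0[of x] x D by (simp add: F_def restr0_def)
  then show ?thesis using fr[of x] by auto
qed

lemma moment_eq_0_poly_plane:
  assumes Q: "is_basis Q (poly_plane d E)" and E: "compact E" and \<phi>: "continuous_on E \<phi>"
    and dofs: "\<And>q. q \<in> Q \<Longrightarrow> dof_value E (Internal_Moment q) \<phi> = 0" and r: "r \<in> poly2 d"
  shows "(LINT x:E|lborel. \<phi> x * r x) = 0"
proof -
  have "restr0 E r \<in> fun_space.span Q" using Q r unfolding is_basis_def poly_plane_eq by blast
  moreover have "continuous_on E q" if "q \<in> Q" for q
    using that Q fun_space.span_base poly_plane_continuous unfolding is_basis_def by blast
  ultimately have "(LINT x:E|lborel. \<phi> x * restr0 E r x) = 0"
    using moment_eq_0_on_span[OF E \<phi>, of Q "\<lambda>x. x" "restr0 E r"] dofs by simp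
  moreover have "(LINT x:E|lborel. \<phi> x * restr0 E r x) = (LINT x:E|lborel. \<phi> x * r x)"
    unfolding set_lebesgue_integral_def
    by (rule Bochner_Integration.integral_cong) (auto simp: restr0_def indicator_def)
  ultimately show ?thesis by simp
qed

text \<open>
  The boundary degrees of freedom give zero boundary values, so the extension by zero is continuous; the
  internal moments include the moment against the Laplacian itself.
\<close>

lemma vem_unisolvence:
  assumes tri: "\<not> collinear {a, b, c}"
    and Qe: "\<And>e. e \<in> triangle_edges a b c \<Longrightarrow> is_basis (Qe e) (poly_edge (int k - 2) e)"
    and Q: "is_basis Q (poly_plane (int k) (closed_triangle a b c))"
    and \<phi>: "\<phi> \<in> vem_space k a b c"
    and dofs: "\<And>d. d \<in> boundary_dofs a b c Qe \<union> Internal_Moment ` Q \<Longrightarrow> dof_value (closed_triangle a b c) d \<phi> = 0"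
  shows "\<phi> x = 0"
proof -
  let ?E = "closed_triangle a b c"
  have c: "continuous_on ?E \<phi>" and off: "\<And>x. x \<notin> ?E \<Longrightarrow> \<phi> x = 0"
    using \<phi> unfolding vem_space_def by blast+
  obtain h where h: "h \<in> poly_plane (int k) ?E" "has_weak_laplacian \<phi> h (interior ?E)"
    using \<phi> unfolding vem_space_def by blast
  obtain g where g: "g \<in> poly2 (int k)" "h = restr0 ?E g" using h(1) unfolding poly_plane_eq by blast
  have bd: "\<phi> x = 0" if "x \<in> frontier ?E" for x
    using vem_boundary_eq_0[OF tri Qe \<phi> _ that] dofs by blast
  have off_int: "\<phi> x = 0" if "x \<notin> interior ?E" for x
    using that off bd[of x] closure_subset[of ?E] unfolding frontier_def by blast
  have "\<phi> = restr0 ?E \<phi>" using off by (auto simp: restr0_def fun_eq_iff)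
  then have c': "continuous_on UNIV \<phi>"
    using continuous_on_restr0[OF compact_imp_closed[OF compact_closed_triangle] c bd] by simp
  show ?thesis
  proof (rule weak_laplacian_uniqueness[OF c' off_int])
    show "bounded (interior ?E)"
      using compact_imp_bounded[OF compact_closed_triangle] interior_subset bounded_subset by metis
    show "continuous_on UNIV g" using poly2_continuous[OF g(1)] .
    have "(LINT x:interior ?E|lborel. h x * \<psi> x) = (LINT x:interior ?E|lborel. g x * \<psi> x)" for \<psi>
      unfolding set_lebesgue_integral_def
      by (rule Bochner_Integration.integral_cong)
        (use interior_subset[of ?E] in \<open>auto simp: g restr0_def indicator_def\<close>)
    then show "has_weak_laplacian \<phi> g (interior ?E)"
      using h(2) unfolding has_weak_laplacian_def by simp
    have "(LINT x:interior ?E|lborel. \<phi> x * g x) = (LINT x:?E|lborel. \<phi> x * g x)"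
      unfolding set_lebesgue_integral_def
      by (rule Bochner_Integration.integral_cong)
        (use interior_subset[of ?E] off_int in \<open>auto simp: indicator_def\<close>)
    also have "\<dots> = 0"
      using moment_eq_0_poly_plane[OF Q compact_closed_triangle c _ g(1)] dofs by blast
    finally show "(LINT x:interior ?E|lborel. \<phi> x * g x) = 0" .
  qed
qed

lemma poly_plane_unisolvence:
  assumes tri: "\<not> collinear {a, b, c}"
    and Qe: "\<And>e. e \<in> triangle_edges a b c \<Longrightarrow> is_basis (Qe e) (poly_edge (int k - 2) e)"
    and Q': "is_basis Q' (poly_plane (int k - 3) (closed_triangle a b c))"
    and p: "p \<in> poly_plane (int k) (closed_triangle a b c)"
    and dofs: "\<And>d. d \<in> boundary_dofs a b c Qe \<union> Internal_Moment ` Q' \<Longrightarrow> dof_value (closed_triangle a b c) d p = 0"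
  shows "p x = 0"
proof -
  let ?E = "closed_triangle a b c"
  obtain f where f: "f \<in> poly2 (int k)" "p = restr0 ?E f" using p unfolding poly_plane_eq by blast
  have pf: "x \<in> ?E \<Longrightarrow> p x = f x" "x \<notin> ?E \<Longrightarrow> p x = 0" for x by (simp_all add: f restr0_def)
  have "f x = 0" if "x \<in> ?E" for x
  proof (rule poly2_eq_0_on_triangle[OF tri f(1) _ _ that])
    fix y assume y: "y \<in> frontier ?E"
    then have "y \<in> ?E"
      using frontier_subset_closed[OF compact_imp_closed[OF compact_closed_triangle]] by blast
    moreover have "p y = 0"
      using vem_boundary_eq_0[OF tri Qe poly_plane_in_vem_space[OF p] _ y] dofs by blast
    ultimately show "f y = 0" using pf by simp
  next
    fix r assume r: "r \<in> poly2 (int k - 3)"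
    have "(LINT x:?E|lborel. p x * r x) = 0"
      using moment_eq_0_poly_plane[OF Q' compact_closed_triangle poly_plane_continuous[OF p] _ r] dofs by blast
    moreover have "(LINT x:?E|lborel. p x * r x) = (LINT x:?E|lborel. f x * r x)"
      unfolding set_lebesgue_integral_def
      by (rule Bochner_Integration.integral_cong) (auto simp: f restr0_def indicator_def)
    ultimately show "(LINT x:?E|lborel. f x * r x) = 0" by simp
  qed
  then show ?thesis using pf by (cases "x \<in> ?E") auto
qed

lemma card_boundary_and_internal_dofs:
  assumes k: "k \<ge> 1" and tri: "\<not> collinear {a, b, c}"
    and Qe: "\<And>e. e \<in> triangle_edges a b c \<Longrightarrow> is_basis (Qe e) (poly_edge (int k - 2) e)"
    and Q': "is_basis Q' (poly_plane (int k - 3) (closed_triangle a b c))"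
  shows "card (boundary_dofs a b c Qe \<union> Internal_Moment ` Q') = card (degs (int k))"
proof -
  let ?E = "closed_triangle a b c"
  have ne: "a \<noteq> b" "b \<noteq> c" "c \<noteq> a" using tri by (auto simp: insert_commute)
  have q: "finite (Qe e) \<and> card (Qe e) = k - 1" if "e \<in> triangle_edges a b c" for e
  proof -
    have "fst e \<noteq> snd e" using that ne by (auto simp: triangle_edges_def)
    from card_basis_poly_edge[OF this Qe[OF that]] have "finite (Qe e) \<and> card (Qe e) = nat (int k - 2 + 1)" .
    moreover have "nat (int k - 2 + 1) = k - 1" using k by linarith
    ultimately show ?thesis by simp
  qed
  have q': "finite Q' \<and> card Q' = card (degs (int k - 3))"
    by (rule basis_card_family(2)[OF finite_degs poly_plane_lin_indep[OF interior_triangle_nonempty[OF tri]]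
          poly_plane_family Q'])
  let ?V = "Vertex_Value ` {a, b, c}" and ?M = "(\<lambda>(e, q). Edge_Moment e q) ` Sigma (triangle_edges a b c) Qe"
  have b: "boundary_dofs a b c Qe = ?V \<union> ?M"
    unfolding boundary_dofs_def by (auto simp: image_iff)
  have T: "finite (triangle_edges a b c)" "card (triangle_edges a b c) = 3"
    using ne by (auto simp: triangle_edges_def)
  have "card ?V = 3" using ne by (subst card_image) (auto simp: inj_on_def)
  moreover have "card ?M = 3 * (k - 1)"
    using q T by (subst card_image) (auto simp: inj_on_def)
  moreover have "finite ?V" "finite ?M" using q T by (auto intro!: finite_imageI finite_SigmaI)
  moreover have "?V \<inter> ?M = {}" by auto
  ultimately have "finite (boundary_dofs a b c Qe)" "card (boundary_dofs a b c Qe) = 3 + 3 * (k - 1)"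
    unfolding b by (simp_all only: card_Un_disjoint finite_Un)
  moreover have "card (Internal_Moment ` Q') = card (degs (int k - 3))"
    using q' by (subst card_image) (auto simp: inj_on_def)
  moreover have "boundary_dofs a b c Qe \<inter> Internal_Moment ` Q' = {}"
    unfolding boundary_dofs_def by auto
  ultimately show ?thesis
    using q' k card_degs_three_steps[OF k] by (simp add: card_Un_disjoint)
qed

lemma vec_space_basis:
  obtains J where "is_basis J (vec_space S)" "finite J" "card J = S"
proof -
  let ?e = "\<lambda>r i. if i = r then 1 else 0 :: real"
  have sum: "(\<Sum>r\<in>{1..S}. c r * ?e r i) = (if i \<in> {1..S} then c i else 0)" for c i
  proof -
    have "(\<Sum>r\<in>{1..S}. c r * ?e r i) = (\<Sum>r\<in>{1..S}. if r = i then c r else 0)"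
      by (rule sum.cong) auto
    then show ?thesis by simp
  qed
  have "lin_indep_family {1..S} ?e"
    unfolding lin_indep_family_def sum by (metis (full_types))
  note b = basis_from_family[OF finite_atLeastAtMost this]
  have "vec_space S = {(\<lambda>i. \<Sum>r\<in>{1..S}. c r * ?e r i) | c. True}"
    unfolding sum vec_space_def by (auto simp: fun_eq_iff)
  then show ?thesis using that[of "?e ` {1..S}"] b card_image[OF b(1)] by simp
qed

section \<open>The Serendipity projection and space\<close>

lemma admissible_dof_if_bases:
  assumes "\<And>e. e \<in> triangle_edges a b c \<Longrightarrow> is_basis (Qe e) (poly_edge m e)"
    and "is_basis Q (poly_plane n (closed_triangle a b c))"
    and d: "d \<in> boundary_dofs a b c Qe \<union> Internal_Moment ` Q"
  shows "admissible_dof (closed_triangle a b c) d"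
proof -
  have e: "q \<in> poly_edge m e" if "e \<in> triangle_edges a b c" "q \<in> Qe e" for e q
    using assms(1)[OF that(1)] that(2) fun_space.span_base unfolding is_basis_def by blast
  have i: "q \<in> poly_plane n (closed_triangle a b c)" if "q \<in> Q" for q
    using assms(2) that fun_space.span_base unfolding is_basis_def by blast
  consider v where "d = Vertex_Value v"
    | e q where "d = Edge_Moment e q" "e \<in> triangle_edges a b c" "q \<in> Qe e"
    | q where "d = Internal_Moment q" "q \<in> Q"
    using d unfolding boundary_dofs_def by blast
  then show ?thesis
  proof cases
    case 2
    then show ?thesis using poly_edge_continuous[OF e[OF 2(2,3)]] edge_subset_triangle[OF 2(2)] by simp
  next
    case 3
    then show ?thesis using poly_plane_continuous[OF i[OF 3(2)]] by simp
  qed simp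
qed

text \<open>
  An injective linear map between spaces of the same finite dimension is onto. As linearity is available
  on continuous functions only, the argument is carried out with the images of the monomials.
\<close>

lemma dof_vector_poly_bij:
  assumes k: "k \<ge> 1" and tri: "\<not> collinear {a, b, c}"
    and Qe: "\<And>e. e \<in> triangle_edges a b c \<Longrightarrow> is_basis (Qe e) (poly_edge (int k - 2) e)"
    and Q': "is_basis Q' (poly_plane (int k - 3) (closed_triangle a b c))"
    and \<delta>: "bij_betw \<delta> {1..S} (boundary_dofs a b c Qe \<union> Internal_Moment ` Q')"
  shows "bij_betw (dof_vector (closed_triangle a b c) \<delta> S)
    (poly_plane (int k) (closed_triangle a b c)) (vec_space S)"
proof -
  let ?E = "closed_triangle a b c"
  let ?P = "poly_plane (int k) ?E" and ?D = "dof_vector ?E \<delta> S"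
  let ?m = "\<lambda>p. restr0 ?E (mono2 p)"
  have adm: "admissible_dof ?E (\<delta> r)" if "r \<in> {1..S}" for r
    using admissible_dof_if_bases[OF Qe Q'] bij_betwE[OF \<delta>] that by blast
  have zero: "p = 0" if p: "p \<in> ?P" "?D p = 0" for p
  proof
    fix x
    show "p x = 0 x"
      unfolding zero_fun_def
    proof (rule poly_plane_unisolvence[OF tri Qe Q' p(1)])
      fix d assume "d \<in> boundary_dofs a b c Qe \<union> Internal_Moment ` Q'"
      then obtain r where "r \<in> {1..S}" "d = \<delta> r"
        using bij_betw_imp_surj_on[OF \<delta>] by blast
      then show "dof_value ?E d p = 0"
        using fun_cong[OF p(2), of r] by (simp add: dof_vector_def)
    qed
  qed
  have cm: "continuous_on ?E (?m p)" if "p \<in> degs (int k)" for p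
    using continuous_restr0_poly2[OF poly2_mono2[OF that]] .
  have comb: "?D (\<lambda>x. \<Sum>p\<in>degs (int k). cf p * ?m p x) = (\<lambda>r. \<Sum>p\<in>degs (int k). cf p * ?D (?m p) r)" for cf
    using dof_value_sum[OF compact_closed_triangle adm finite_degs cm]
    by (auto simp: dof_vector_def fun_eq_iff)
  have P: "?P = {(\<lambda>x. \<Sum>p\<in>degs (int k). cf p * ?m p x) | cf. True}"
    by (rule poly_plane_family)
  have indep: "lin_indep_family (degs (int k)) ?m"
    by (rule poly_plane_lin_indep[OF interior_triangle_nonempty[OF tri]])
  have indepD: "lin_indep_family (degs (int k)) (\<lambda>p. ?D (?m p))"
    unfolding lin_indep_family_def
  proof (intro allI impI)
    fix cf assume "\<forall>r. (\<Sum>p\<in>degs (int k). cf p * ?D (?m p) r) = 0"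
    then have "?D (\<lambda>x. \<Sum>p\<in>degs (int k). cf p * ?m p x) = 0"
      unfolding comb by (simp add: zero_fun_def)
    moreover have "(\<lambda>x. \<Sum>p\<in>degs (int k). cf p * ?m p x) \<in> ?P" unfolding P by blast
    ultimately have "(\<lambda>x. \<Sum>p\<in>degs (int k). cf p * ?m p x) = 0" by (rule zero[rotated])
    then have "\<forall>x. (\<Sum>p\<in>degs (int k). cf p * ?m p x) = 0" unfolding fun_eq_iff zero_fun_def by simp
    then show "\<forall>p\<in>degs (int k). cf p = 0" using indep unfolding lin_indep_family_def by blast
  qed
  obtain J where J: "is_basis J (vec_space S)" "finite J" "card J = S" by (rule vec_space_basis)
  have "S = card (degs (int k))"
    using bij_betw_same_card[OF \<delta>] card_boundary_and_internal_dofs[OF k tri Qe Q'] by simp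
  then have J': "card J = card (degs (int k))" using J by simp
  have span: "fun_space.span J = vec_space S" using J unfolding is_basis_def by blast
  have range: "?D p \<in> vec_space S" for p by (simp add: vec_space_def dof_vector_def)
  show ?thesis
  proof (rule bij_betw_imageI)
    show "inj_on ?D ?P"
    proof (rule inj_onI)
      fix p q assume pq: "p \<in> ?P" "q \<in> ?P" "?D p = ?D q"
      have "?D (p - q) = 0"
      proof
        fix r
        have "dof_value ?E (\<delta> r) (\<lambda>x. 1 * p x + (- 1) * q x) =
            1 * dof_value ?E (\<delta> r) p + (- 1) * dof_value ?E (\<delta> r) q" if "r \<in> {1..S}"
          by (rule dof_value_linear[OF compact_closed_triangle adm[OF that]
                poly_plane_continuous[OF pq(1)] poly_plane_continuous[OF pq(2)]])
        moreover have "(\<lambda>x. 1 * p x + (- 1) * q x) = p - q" by (simp add: fun_eq_iff)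
        ultimately show "?D (p - q) r = 0 r"
          using fun_cong[OF pq(3), of r] by (auto simp: dof_vector_def)
      qed
      then have "p - q = 0" using zero[OF poly_plane_diff[OF pq(1,2)]] by simp
      then show "p = q" by simp
    qed
    show "?D ` ?P = vec_space S"
    proof
      show "?D ` ?P \<subseteq> vec_space S" using range by blast
      show "vec_space S \<subseteq> ?D ` ?P"
      proof
        fix w assume "w \<in> vec_space S"
        then obtain cf where "\<forall>r. w r = (\<Sum>p\<in>degs (int k). cf p * ?D (?m p) r)"
          using independent_family_spans[OF finite_degs indepD J(2) J'] range unfolding span by blast
        then have "w = ?D (\<lambda>x. \<Sum>p\<in>degs (int k). cf p * ?m p x)"
          unfolding comb by (simp add: fun_eq_iff)
        then show "w \<in> ?D ` ?P" unfolding P by blast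
      qed
    qed
  qed
qed

text \<open>
  Since the polynomials realise every vector of degrees of freedom, a residual that is orthogonal to all
  of them is orthogonal to itself, hence zero.
\<close>

lemma serendipity_proj_interpolates:
  assumes bij: "bij_betw (dof_vector E \<delta> S) (poly_plane (int k) E) (vec_space S)"
    and B: "sym_pos_def_form S B"
    and E: "compact E" and adm: "\<And>r. r \<in> {1..S} \<Longrightarrow> admissible_dof E (\<delta> r)"
    and \<phi>: "continuous_on E \<phi>"
  shows "serendipity_proj k E \<delta> S B \<phi> \<in> poly_plane (int k) E \<and>
    dof_vector E \<delta> S (serendipity_proj k E \<delta> S B \<phi>) = dof_vector E \<delta> S \<phi>"
proof -
  let ?P = "poly_plane (int k) E" and ?D = "dof_vector E \<delta> S"
  have range: "?D p \<in> vec_space S" for p by (simp add: vec_space_def dof_vector_def)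
  have hom: "\<forall>c. \<forall>u\<in>vec_space S. \<forall>w\<in>vec_space S. B (fun_scale c u) w = c * B u w"
    and pos: "\<forall>u\<in>vec_space S. u \<noteq> 0 \<longrightarrow> B u u > 0"
    using B unfolding sym_pos_def_form_def by simp_all
  have diff: "?D (p - \<phi>) = ?D p - ?D \<phi>" if "p \<in> ?P" for p
  proof
    fix r
    have "dof_value E (\<delta> r) (\<lambda>x. 1 * p x + (- 1) * \<phi> x) =
        1 * dof_value E (\<delta> r) p + (- 1) * dof_value E (\<delta> r) \<phi>" if "r \<in> {1..S}"
      by (rule dof_value_linear[OF E adm[OF that] poly_plane_continuous[OF \<open>p \<in> ?P\<close>] \<phi>])
    moreover have "(\<lambda>x. 1 * p x + (- 1) * \<phi> x) = p - \<phi>" by (simp add: fun_eq_iff)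
    ultimately show "?D (p - \<phi>) r = (?D p - ?D \<phi>) r" by (auto simp: dof_vector_def)
  qed
  obtain p where p: "p \<in> ?P" "?D p = ?D \<phi>"
    using range bij_betw_imp_surj_on[OF bij] by (metis imageE)
  have "serendipity_proj k E \<delta> S B \<phi> = p"
    unfolding serendipity_proj_def
  proof (rule the_equality)
    have "0 \<in> vec_space S" by (simp add: vec_space_def)
    then have "B 0 w = 0" if "w \<in> vec_space S" for w
      using hom[rule_format, OF _ that, of 0 0] by simp
    then show "p \<in> ?P \<and> (\<forall>q\<in>?P. B (?D (p - \<phi>)) (?D q) = 0)"
      using p range by (simp add: diff)
  next
    fix p' assume p': "p' \<in> ?P \<and> (\<forall>q\<in>?P. B (?D (p' - \<phi>)) (?D q) = 0)"
    obtain q where q: "q \<in> ?P" "?D q = ?D (p' - \<phi>)"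
      using range bij_betw_imp_surj_on[OF bij] by (metis imageE)
    then have "B (?D (p' - \<phi>)) (?D (p' - \<phi>)) = 0" using p' by metis
    then have "?D (p' - \<phi>) = 0"
      using pos range[of "p' - \<phi>"] by (metis less_irrefl)
    then have "?D p' = ?D p" using diff p p' by (simp add: fun_eq_iff)
    then show "p' = p" using bij p(1) p' unfolding bij_betw_def inj_on_def by blast
  qed
  then show ?thesis using p by simp
qed

theorem mainTheorem6:
  fixes k S N :: nat
    and a b c :: plane
    and Qe :: "edge \<Rightarrow> (plane \<Rightarrow> real) set"
    and Q Q' :: "(plane \<Rightarrow> real) set"
    and \<delta> :: "nat \<Rightarrow> dof"
    and B :: "(nat \<Rightarrow> real) \<Rightarrow> (nat \<Rightarrow> real) \<Rightarrow> real"
  assumes "k \<ge> 1"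
    and "\<not> collinear {a, b, c}"
    and "\<And>e. e \<in> triangle_edges a b c \<Longrightarrow> is_basis (Qe e) (poly_edge (int k - 2) e)"
    and "is_basis Q (poly_plane (int k) (closed_triangle a b c))"
    and "is_basis Q' (poly_plane (int k - 3) (closed_triangle a b c))"
    and "Q' \<subseteq> Q"
    and "bij_betw \<delta> {1..S} (boundary_dofs a b c Qe \<union> Internal_Moment ` Q')"
    and "bij_betw \<delta> {1..N} (boundary_dofs a b c Qe \<union> Internal_Moment ` Q)"
    and "sym_pos_def_form S B"
  shows "unisolvent (closed_triangle a b c) \<delta> S (serendipity_space k a b c \<delta> S N B)
    \<and> S = fun_space.dim (poly_plane (int k) (closed_triangle a b c))
    \<and> serendipity_space k a b c \<delta> S N B = poly_plane (int k) (closed_triangle a b c)"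
proof -
  let ?E = "closed_triangle a b c"
  let ?P = "poly_plane (int k) ?E" and ?D = "dof_vector ?E \<delta> S"
  note k = assms(1) and tri = assms(2) and Qe = assms(3) and Q = assms(4) and Q' = assms(5)
    and \<delta>S = assms(7) and \<delta>N = assms(8) and B = assms(9)
  have bij: "bij_betw ?D ?P (vec_space S)"
    by (rule dof_vector_poly_bij[OF k tri Qe Q' \<delta>S])
  have admS: "admissible_dof ?E (\<delta> r)" if "r \<in> {1..S}" for r
    using admissible_dof_if_bases[OF Qe Q'] bij_betwE[OF \<delta>S] that by blast
  have admN: "admissible_dof ?E (\<delta> r)" if "r \<in> {1..N}" for r
    using admissible_dof_if_bases[OF Qe Q] bij_betwE[OF \<delta>N] that by blast
  have proj: "serendipity_proj k ?E \<delta> S B \<phi> \<in> ?P \<and> ?D (serendipity_proj k ?E \<delta> S B \<phi>) = ?D \<phi>"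
    if "continuous_on ?E \<phi>" for \<phi>
    by (rule serendipity_proj_interpolates[OF bij B compact_closed_triangle admS that])
  have eq: "serendipity_space k a b c \<delta> S N B = ?P"
  proof
    show "?P \<subseteq> serendipity_space k a b c \<delta> S N B"
    proof
      fix p assume p: "p \<in> ?P"
      have "serendipity_proj k ?E \<delta> S B p = p"
        using proj[OF poly_plane_continuous[OF p]] p bij unfolding bij_betw_def inj_on_def by blast
      then show "p \<in> serendipity_space k a b c \<delta> S N B"
        using poly_plane_in_vem_space[OF p] unfolding serendipity_space_def by simp
    qed
    show "serendipity_space k a b c \<delta> S N B \<subseteq> ?P"
    proof
      fix \<phi> assume \<phi>: "\<phi> \<in> serendipity_space k a b c \<delta> S N B"
      then have vem: "\<phi> \<in> vem_space k a b c" unfolding serendipity_space_def by blast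
      then have c: "continuous_on ?E \<phi>" unfolding vem_space_def by blast
      define p where "p = serendipity_proj k ?E \<delta> S B \<phi>"
      have p: "p \<in> ?P" "?D p = ?D \<phi>" using proj[OF c] unfolding p_def by blast+
      have same: "dof_value ?E (\<delta> r) \<phi> = dof_value ?E (\<delta> r) p" if r: "r \<in> {1..N}" for r
      proof (cases "r \<le> S")
        case True
        then show ?thesis using fun_cong[OF p(2), of r] r by (simp add: dof_vector_def)
      next
        case False
        then show ?thesis using \<phi> r unfolding serendipity_space_def p_def by simp
      qed
      have "(\<phi> - p) x = 0" for x
      proof (rule vem_unisolvence[OF tri Qe Q vem_space_diff[OF vem poly_plane_in_vem_space[OF p(1)]]])
        fix d assume "d \<in> boundary_dofs a b c Qe \<union> Internal_Moment ` Q"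
        then obtain r where r: "r \<in> {1..N}" "d = \<delta> r"
          using bij_betw_imp_surj_on[OF \<delta>N] by blast
        have "dof_value ?E (\<delta> r) (\<lambda>x. 1 * \<phi> x + (- 1) * p x) =
            1 * dof_value ?E (\<delta> r) \<phi> + (- 1) * dof_value ?E (\<delta> r) p"
          by (rule dof_value_linear[OF compact_closed_triangle admN[OF r(1)] c poly_plane_continuous[OF p(1)]])
        moreover have "(\<lambda>x. 1 * \<phi> x + (- 1) * p x) = \<phi> - p" by (simp add: fun_eq_iff)
        ultimately show "dof_value ?E d (\<phi> - p) = 0" using same[OF r(1)] r(2) by simp
      qed
      then have "\<phi> = p" by (simp add: fun_eq_iff)
      then show "\<phi> \<in> ?P" using p(1) by simp
    qed
  qed
  moreover have "S = fun_space.dim ?P"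
    using bij_betw_same_card[OF \<delta>S] card_boundary_and_internal_dofs[OF k tri Qe Q']
      basis_card_family(1)[OF finite_degs poly_plane_lin_indep[OF interior_triangle_nonempty[OF tri]]
        poly_plane_family, of "int k"] by simp
  ultimately show ?thesis using bij unfolding unisolvent_def by simp
qed

end
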